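(* The subgroup of $\mathrm{Out}(F_3)$ generated by the seven involutions $\tau_a,\tau_b,\tau_c,\tau_d,\tau_x,\tau_y,\tau_z$ is equal to $\mathcal{T}_3'$.
   Context: $F_3$ is the free group on $A,B,C$. The elements $\tau_a,\dots,\tau_z\in\mathrm{Out}(F_3)$ are the outer classes of the automorphisms sending $(A,B,C)$ respectively to: $\tau_a$: $(CB^{-1}A^{-1}C^{-1}B,\;B^{-1},\;C^{-1})$; $\tau_b$: $(A^{-1},\;AC^{-1}B^{-1}A^{-1}C,\;C^{-1})$; $\tau_c$: $(A^{-1},\;B^{-1},\;BA^{-1}C^{-1}B^{-1}A)$; $\tau_d$: $(A^{-1},\;B^{-1},\;C^{-1})$; $\tau_x$: $(A^{-1},\;C^{-1}B^{-1}C,\;C^{-1})$; $\tau_y$: $(A^{-1},\;B^{-1},\;A^{-1}C^{-1}A)$; $\tau_z$: $(B^{-1}A^{-1}B,\;B^{-1},\;C^{-1})$. Abelianization gives a surjection $\mathrm{Out}(F_n)\to\mathrm{GL}(n,\mathbb{Z})$, whose kernel is the Torelli subgroup $\mathcal{T}_n$. The group $\mathcal{T}_n'$ is the preimage of the center $\{\pm I_n\}$ under this map, i.e. the kernel of $\mathrm{Out}(F_n)\to\mathrm{PGL}(n,\mathbb{Z})$; it contains $\mathcal{T}_n$ with index two. *)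

theory Defs
  imports
    "HOL-Algebra.Bij"
    "HOL-Algebra.Coset"
    "HOL-Algebra.Generated_Groups"
    "HOL-Algebra.Multiplicative_Group"
    "HOL-Analysis.Finite_Cartesian_Product"
begin

section \<open>Free groups as groups of reduced words\<close>

text \<open>
  A letter \<open>(a, True)\<close> stands for the generator \<open>a\<close>, a letter \<open>(a, False)\<close> for its inverse.
\<close>

type_synonym 'a word = "('a \<times> bool) list"

definition cancels :: "'a \<times> bool \<Rightarrow> 'a \<times> bool \<Rightarrow> bool" where
  "cancels x y \<longleftrightarrow> fst x = fst y \<and> snd x \<noteq> snd y"

definition reduced :: "'a word \<Rightarrow> bool" where
  "reduced w \<longleftrightarrow> successively (\<lambda>x y. \<not> cancels x y) w"

fun push :: "'a \<times> bool \<Rightarrow> 'a word \<Rightarrow> 'a word" where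
  "push x [] = [x]"
| "push x (y # w) = (if cancels x y then w else x # y # w)"

definition reduce :: "'a word \<Rightarrow> 'a word" where
  "reduce w = foldr push w []"

text \<open>The free group on the set of all elements of the type \<open>'a\<close>.\<close>

definition free_group :: "'a word monoid" where
  "free_group = \<lparr>carrier = {w. reduced w}, mult = (\<lambda>u v. reduce (u @ v)), one = []\<rparr>"

lemma reduced_Nil [simp]: "reduced []"
  by (simp add: reduced_def)

lemma reduced_push: "reduced w \<Longrightarrow> reduced (push x w)"
  by (cases w; cases "tl w") (auto simp: reduced_def)

lemma reduced_foldr_push: "reduced v \<Longrightarrow> reduced (foldr push u v)"
  by (induction u) (auto simp: reduced_push)

lemma reduced_reduce: "reduced (reduce w)"
  by (simp add: reduce_def reduced_foldr_push)

lemma reduce_reduced: "reduced w \<Longrightarrow> reduce w = w"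
proof (induction w)
  case (Cons x w)
  then have "reduced w" by (cases w) (auto simp: reduced_def)
  with Cons show ?case by (cases w) (auto simp: reduced_def reduce_def)
qed (simp add: reduce_def)

lemma push_push_cancel:
  assumes "cancels x y" "reduced w"
  shows "push x (push y w) = w"
proof (cases w)
  case Nil
  with assms show ?thesis by simp
next
  case (Cons z v)
  show ?thesis
  proof (cases "cancels y z")
    case True
    with assms(1) have "x = z" by (auto simp: cancels_def prod_eq_iff)
    with True Cons assms show ?thesis by (cases v) (auto simp: reduced_def)
  next
    case False
    with Cons assms show ?thesis by simp
  qed
qed

lemma foldr_push_push:
  "reduced v \<Longrightarrow> foldr push (push x w) v = push x (foldr push w v)"
  by (cases w) (auto simp: push_push_cancel reduced_foldr_push)

lemma foldr_push_reduce: "reduced v \<Longrightarrow> foldr push (reduce u) v = foldr push u v"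
  by (induction u) (auto simp: reduce_def foldr_push_push)

lemma reduce_append: "reduce (u @ v) = foldr push u (reduce v)"
  by (simp add: reduce_def)

lemma reduce_reduce_append: "reduce (reduce u @ v) = reduce (u @ v)"
  by (simp add: reduce_append foldr_push_reduce reduced_reduce)

lemma reduce_append_reduce: "reduce (u @ reduce v) = reduce (u @ v)"
  by (simp add: reduce_append reduce_reduced reduced_reduce)

lemma reduce_inverse_append: "reduce (rev (map (\<lambda>(a, e). (a, \<not> e)) w) @ w) = []"
proof (induction w)
  case (Cons x w)
  have "push (fst x, \<not> snd x) (push x (reduce w)) = reduce w"
    by (rule push_push_cancel) (auto simp: cancels_def reduced_reduce)
  then show ?case
    using Cons by (simp add: reduce_append case_prod_beta) (simp add: reduce_def)
qed (simp add: reduce_def)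

theorem group_free_group: "group (free_group :: 'a word monoid)"
proof (rule groupI)
  fix w :: "'a word"
  assume "w \<in> carrier free_group"
  show "\<exists>v\<in>carrier free_group. v \<otimes>\<^bsub>free_group\<^esub> w = \<one>\<^bsub>free_group\<^esub>"
    by (rule bexI[of _ "reduce (rev (map (\<lambda>(a, e). (a, \<not> e)) w))"])
       (simp_all add: free_group_def reduce_reduce_append reduce_inverse_append reduced_reduce)
qed (simp_all add: free_group_def reduced_reduce reduce_reduced reduce_reduce_append
       reduce_append_reduce)

text \<open>The homomorphism from the free group to \<open>G\<close> sending each generator \<open>a\<close> to \<open>f a\<close>.\<close>

definition free_extension :: "('b, 'c) monoid_scheme \<Rightarrow> ('a \<Rightarrow> 'b) \<Rightarrow> 'a word \<Rightarrow> 'b" where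
  "free_extension G f =
     (\<lambda>w\<in>carrier free_group.
        foldr (\<lambda>(a, e) y. (if e then f a else inv\<^bsub>G\<^esub> (f a)) \<otimes>\<^bsub>G\<^esub> y) w \<one>\<^bsub>G\<^esub>)"


section \<open>Outer automorphisms\<close>

definition Inn :: "('a, 'b) monoid_scheme \<Rightarrow> ('a \<Rightarrow> 'a) set" where
  "Inn G = (\<lambda>g. \<lambda>x\<in>carrier G. g \<otimes>\<^bsub>G\<^esub> x \<otimes>\<^bsub>G\<^esub> inv\<^bsub>G\<^esub> g) ` carrier G"

definition Out :: "('a, 'b) monoid_scheme \<Rightarrow> ('a \<Rightarrow> 'a) set monoid" where
  "Out G = AutoGroup G Mod Inn G"

definition outer_class :: "('a, 'b) monoid_scheme \<Rightarrow> ('a \<Rightarrow> 'a) \<Rightarrow> ('a \<Rightarrow> 'a) set" where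
  "outer_class G \<phi> = Inn G #>\<^bsub>AutoGroup G\<^esub> \<phi>"


section \<open>The action on the abelianization\<close>

definition exponent_sum :: "'a \<Rightarrow> 'a word \<Rightarrow> int" where
  "exponent_sum a w = (\<Sum>(b, e)\<leftarrow>w. if b = a then if e then 1 else - 1 else 0)"

text \<open>
  The automorphism of \<open>\<int>\<^sup>n\<close> induced by \<open>\<phi>\<close>, as a matrix acting on column vectors: column \<open>j\<close> is
  the image of the generator \<open>j\<close> in the abelianization.
\<close>

definition ab_matrix :: "('n word \<Rightarrow> 'n word) \<Rightarrow> int ^ 'n ^ 'n" where
  "ab_matrix \<phi> = (\<chi> i j. exponent_sum i (\<phi> [(j, True)]))"

text \<open>
  An outer automorphism is a coset of automorphisms. They all induce the same matrix (see
  \<open>Out_ab_outer_class\<close> below), which is the value of \<open>Out_ab\<close> on the coset.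
\<close>

definition Out_ab :: "('n word \<Rightarrow> 'n word) set \<Rightarrow> int ^ 'n ^ 'n" where
  "Out_ab X = the_elem (ab_matrix ` X)"

text \<open>
  The preimage of the center \<open>{\<plusminus>I}\<close> of \<open>GL(n, \<int>)\<close>, equivalently the kernel of the map to
  \<open>PGL(n, \<int>)\<close>. The Torelli subgroup is the preimage of \<open>I\<close> alone.
\<close>

definition extended_Torelli :: "('n::finite word \<Rightarrow> 'n word) set set" where
  "extended_Torelli = {X \<in> carrier (Out free_group). Out_ab X \<in> {mat 1, - mat 1}}"

lemma exponent_sum_append: "exponent_sum a (u @ v) = exponent_sum a u + exponent_sum a v"
  by (simp add: exponent_sum_def)

lemma exponent_sum_push: "exponent_sum a (push x w) = exponent_sum a (x # w)"
  by (cases w) (auto simp: exponent_sum_def cancels_def case_prod_beta)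

lemma exponent_sum_reduce: "exponent_sum a (reduce w) = exponent_sum a w"
proof (induction w)
  case (Cons x w)
  have "exponent_sum a (reduce (x # w)) = exponent_sum a (x # reduce w)"
    by (simp add: reduce_def exponent_sum_push)
  with Cons show ?case by (simp add: exponent_sum_def)
qed (simp add: reduce_def)

lemma exponent_sum_mult:
  "exponent_sum a (u \<otimes>\<^bsub>free_group\<^esub> v) = exponent_sum a u + exponent_sum a v"
  by (simp add: free_group_def exponent_sum_reduce exponent_sum_append)

lemma exponent_sum_conj:
  assumes "g \<in> carrier free_group"
  shows "exponent_sum a (g \<otimes>\<^bsub>free_group\<^esub> x \<otimes>\<^bsub>free_group\<^esub> inv\<^bsub>free_group\<^esub> g)
         = exponent_sum a x"
proof -
  have "exponent_sum a g + exponent_sum a (inv\<^bsub>free_group\<^esub> g) = exponent_sum a []"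
    unfolding exponent_sum_mult[symmetric]
    using group.r_inv[OF group_free_group assms] by (simp add: free_group_def)
  then show ?thesis by (simp add: exponent_sum_mult) (simp add: exponent_sum_def)
qed

lemma Inn_subset_auto:
  assumes "group G"
  shows "Inn G \<subseteq> auto G"
proof -
  interpret group G by fact
  have "(\<lambda>x\<in>carrier G. g \<otimes>\<^bsub>G\<^esub> x \<otimes>\<^bsub>G\<^esub> inv\<^bsub>G\<^esub> g) \<in> auto G" if g: "g \<in> carrier G" for g
  proof -
    have cancel:
      "g \<otimes>\<^bsub>G\<^esub> (inv\<^bsub>G\<^esub> g \<otimes>\<^bsub>G\<^esub> x) = x" "inv\<^bsub>G\<^esub> g \<otimes>\<^bsub>G\<^esub> (g \<otimes>\<^bsub>G\<^esub> x) = x" if "x \<in> carrier G" for x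
      using g that by (simp_all flip: m_assoc)
    have "bij_betw (\<lambda>x\<in>carrier G. g \<otimes>\<^bsub>G\<^esub> x \<otimes>\<^bsub>G\<^esub> inv\<^bsub>G\<^esub> g) (carrier G) (carrier G)"
      by (rule bij_betw_byWitness[where f' = "\<lambda>x. inv\<^bsub>G\<^esub> g \<otimes>\<^bsub>G\<^esub> x \<otimes>\<^bsub>G\<^esub> g"])
         (use g in \<open>auto simp: m_assoc cancel\<close>)
    moreover have "(\<lambda>x\<in>carrier G. g \<otimes>\<^bsub>G\<^esub> x \<otimes>\<^bsub>G\<^esub> inv\<^bsub>G\<^esub> g) \<in> hom G G"
      using g by (auto simp: hom_def m_assoc cancel)
    ultimately show ?thesis by (simp add: auto_def Bij_def)
  qed
  then show ?thesis by (auto simp: Inn_def)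
qed

lemma Out_ab_outer_class:
  fixes \<phi> :: "'n::finite word \<Rightarrow> 'n word"
  assumes "\<phi> \<in> auto free_group"
  shows "Out_ab (outer_class free_group \<phi>) = ab_matrix \<phi>"
proof -
  interpret group free_group by (rule group_free_group)
  have gen: "[(j, True)] \<in> carrier free_group" for j :: 'n
    by (simp add: free_group_def reduced_def)
  have "ab_matrix (\<iota> \<otimes>\<^bsub>AutoGroup free_group\<^esub> \<phi>) = ab_matrix \<phi>" if \<iota>: "\<iota> \<in> Inn free_group" for \<iota>
  proof -
    obtain g where g: "g \<in> carrier free_group"
      and \<iota>_eq: "\<iota> = (\<lambda>x\<in>carrier free_group. g \<otimes>\<^bsub>free_group\<^esub> x \<otimes>\<^bsub>free_group\<^esub> inv\<^bsub>free_group\<^esub> g)"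
      using \<iota> by (auto simp: Inn_def)
    have "\<iota> \<otimes>\<^bsub>AutoGroup free_group\<^esub> \<phi> = compose (carrier free_group) \<iota> \<phi>"
      using \<iota> Inn_subset_auto[OF group_free_group] assms
      by (auto simp: AutoGroup_def BijGroup_def auto_def)
    moreover have "\<phi> [(j, True)] \<in> carrier free_group" for j
      using assms gen by (auto simp: auto_def hom_def)
    ultimately show ?thesis
      using g gen by (simp add: ab_matrix_def \<iota>_eq compose_def exponent_sum_conj)
  qed
  moreover have "outer_class free_group \<phi> = (\<lambda>\<iota>. \<iota> \<otimes>\<^bsub>AutoGroup free_group\<^esub> \<phi>) ` Inn free_group"
    by (auto simp: outer_class_def r_coset_def)
  moreover have "(Inn free_group :: ('n word \<Rightarrow> 'n word) set) \<noteq> {}"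
    by (auto simp: Inn_def)
  ultimately have "ab_matrix ` outer_class free_group \<phi> = {ab_matrix \<phi>}"
    by (simp add: image_image image_constant_conv cong: image_cong)
  then show ?thesis by (simp add: Out_ab_def)
qed


section \<open>The seven outer automorphisms of the free group of rank three\<close>

datatype gen3 = gA | gB | gC

instance gen3 :: finite
proof
  have "(UNIV :: gen3 set) = {gA, gB, gC}"
    using gen3.exhaust by blast
  then show "finite (UNIV :: gen3 set)" by (metis finite.emptyI finite.insertI)
qed

abbreviation F3 :: "gen3 word monoid" where
  "F3 \<equiv> free_group"

abbreviation lA :: "gen3 \<times> bool" where "lA \<equiv> (gA, True)"
abbreviation lB :: "gen3 \<times> bool" where "lB \<equiv> (gB, True)"
abbreviation lC :: "gen3 \<times> bool" where "lC \<equiv> (gC, True)"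
abbreviation lA' :: "gen3 \<times> bool" where "lA' \<equiv> (gA, False)"
abbreviation lB' :: "gen3 \<times> bool" where "lB' \<equiv> (gB, False)"
abbreviation lC' :: "gen3 \<times> bool" where "lC' \<equiv> (gC, False)"

text \<open>The outer class of the automorphism of \<open>F3\<close> sending \<open>(A, B, C)\<close> to \<open>(u, v, w)\<close>.\<close>

definition out3 :: "gen3 word \<Rightarrow> gen3 word \<Rightarrow> gen3 word \<Rightarrow> (gen3 word \<Rightarrow> gen3 word) set" where
  "out3 u v w = outer_class F3 (free_extension F3 (case_gen3 u v w))"

definition tau_a :: "(gen3 word \<Rightarrow> gen3 word) set" where
  "tau_a = out3 [lC, lB', lA', lC', lB] [lB'] [lC']"

definition tau_b :: "(gen3 word \<Rightarrow> gen3 word) set" where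
  "tau_b = out3 [lA'] [lA, lC', lB', lA', lC] [lC']"

definition tau_c :: "(gen3 word \<Rightarrow> gen3 word) set" where
  "tau_c = out3 [lA'] [lB'] [lB, lA', lC', lB', lA]"

definition tau_d :: "(gen3 word \<Rightarrow> gen3 word) set" where
  "tau_d = out3 [lA'] [lB'] [lC']"

definition tau_x :: "(gen3 word \<Rightarrow> gen3 word) set" where
  "tau_x = out3 [lA'] [lC', lB', lC] [lC']"

definition tau_y :: "(gen3 word \<Rightarrow> gen3 word) set" where
  "tau_y = out3 [lA'] [lB'] [lA', lC', lA]"

definition tau_z :: "(gen3 word \<Rightarrow> gen3 word) set" where
  "tau_z = out3 [lB', lA', lB] [lB'] [lC']"

end

theory Submission
  imports Defs
begin

text \<open>
  Nielsen reduction shows that \<open>Aut(F\<^sub>3)\<close> is generated by the transvection \<open>B \<mapsto> AB\<close>, two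
  transpositions of generators and one inversion. Conjugating the seven involutions by these
  generators gives words in the involutions, up to inner automorphisms, so the subgroup they
  generate is normal. Let \<open>N\<close> be the normal subgroup of automorphisms that act trivially on
  \<open>\<int>\<^sup>3\<close> and whose outer class lies in it. In \<open>Q = Aut(F\<^sub>3)/N\<close> the generators satisfy the
  Steinberg relations and the relations of signed permutation matrices. These relations alone make
  the action of \<open>Q\<close> on \<open>\<int>\<^sup>3\<close> faithful: with \<open>K\<^sub>i\<^sub>j\<close> generated by the elements acting on
  coordinates \<open>i, j\<close> and \<open>H\<close> by the evident stabilizers of the line of \<open>e\<^sub>1\<close>, one proves
  \<open>Q = K\<^sub>2\<^sub>3 K\<^sub>1\<^sub>2 H\<close> by showing that the right side is closed under left multiplication by
  \<open>E\<^sub>2\<^sub>1\<close>, by induction on the third coordinate of the image of \<open>e\<^sub>1\<close>. An element that acts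
  trivially then lies in \<open>H\<close>, and the case of rank two, which is Euclid's algorithm, finishes.
  The involution \<open>tau_d\<close> acts as \<open>-1\<close>, which reduces the matrix \<open>-I\<close> to the matrix \<open>I\<close>.
\<close>

section \<open>Groups generated by a subset\<close>

text \<open>No presentation of GL(3, Z) is taken for granted: that the relations suffice is the
  faithfulness of the action of \<open>Q\<close>, proved directly. Faithfulness is what is needed,
  since it says that an automorphism acting trivially on homology lies in \<open>N\<close>. Both
  conditions in \<open>N\<close> matter: the seven involutions act as -1, so dividing by all
  automorphisms whose outer class they generate would leave an action only up to sign. Most
  relations between the four generators already hold in Aut(F3). The others fail by a partial
  conjugation, such as B to A B A^-1, or by multiplying a generator by a commutator of the other
  two; these defects are inner automorphisms times words of even length in the involutions, so they
  vanish in \<open>Q\<close>. In the product decomposition E21 is the only serious case: the signs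
  and the transposition of e2, e3 lie in the first factor, E12 passes through it, and the
  transposition of e1, e2 is a product of E12, E21 and a sign. Groups are written additively
  although they are not commutative, so that the class \<open>group_add\<close> supplies the
  algebra.\<close>

inductive_set cl :: "'g::group_add set \<Rightarrow> 'g set" for A where
  zero: "0 \<in> cl A"
| plus: "a \<in> A \<Longrightarrow> g \<in> cl A \<Longrightarrow> a + g \<in> cl A"
| minus: "a \<in> A \<Longrightarrow> g \<in> cl A \<Longrightarrow> - a + g \<in> cl A"

text \<open>Words are normalised to sums with negated terms; the rule taken out of the simplifier
  would turn these back into differences.\<close>

declare add_uminus_conv_diff [simp del]
lemmas group_nf = add.assoc minus_add diff_conv_add_uminus

lemma cl_gen: "a \<in> A \<Longrightarrow> a \<in> cl A"
  using cl.plus[OF _ cl.zero] by fastforce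

lemma cl_add: "g \<in> cl A \<Longrightarrow> h \<in> cl A \<Longrightarrow> g + h \<in> cl A"
  by (induction rule: cl.induct) (auto simp: add.assoc intro: cl.intros)

lemma cl_uminus: "g \<in> cl A \<Longrightarrow> - g \<in> cl A"
proof (induction rule: cl.induct)
  case (plus a g)
  then show ?case using cl_add[OF plus.IH cl.minus[OF plus.hyps(1) cl.zero]] by (simp add: minus_add)
next
  case (minus a g)
  then show ?case using cl_add[OF minus.IH cl.plus[OF minus.hyps(1) cl.zero]] by (simp add: minus_add)
qed (simp add: cl.zero)

lemma cl_subset: "A \<subseteq> cl B \<Longrightarrow> g \<in> cl A \<Longrightarrow> g \<in> cl B"
  by (rotate_tac, induction rule: cl.induct) (auto intro: cl.zero cl_add cl_uminus)

lemma cl_hom: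
  fixes f :: "'a::group_add \<Rightarrow> 'b::group_add"
  assumes add: "\<And>g h. f (g + h) = f g + f h" and A: "\<And>a. a \<in> A \<Longrightarrow> f a \<in> cl B" and "g \<in> cl A"
  shows "f g \<in> cl B"
proof -
  have 0: "f 0 = 0" using add_left_cancel[of "f 0" "f 0" 0] add[of 0 0] by simp
  have m: "f (- g) = - f g" for g using add[of "- g" g] 0 by (simp add: add_eq_0_iff2)
  show ?thesis using assms(3)
    by (induction rule: cl.induct) (auto simp: 0 m add intro: cl.zero A cl_add cl_uminus)
qed

text \<open>Relations are stored as \<open>k + a = b + k\<close>; from this form both conjugates
  demanded by \<open>cl_normal\<close> are read off.\<close>

lemma conj_forms: "k + a = b + k \<Longrightarrow> k + a - k = b \<and> - k + b + k = a" for a :: "'a::group_add"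
proof -
  assume *: "k + a = b + k"
  have "- k + (b + k) = a" unfolding *[symmetric] by simp
  moreover have "k + a - k = b" unfolding * by simp
  ultimately show ?thesis by (simp add: add.assoc)
qed

lemma conj_involution: "k + k = 0 \<Longrightarrow> k + a = b + k \<Longrightarrow> - k + a + k = b \<and> k + a - k = b" for a :: "'a::group_add"
proof -
  assume k: "k + k = 0" and *: "k + a = b + k"
  have "- k = k" using k by (simp add: add_eq_0_iff)
  then show ?thesis using conj_forms[OF *] by (simp add: diff_conv_add_uminus)
qed

lemma cl_conj:
  assumes "\<And>a. a \<in> A \<Longrightarrow> - k + a + k \<in> cl B" "g \<in> cl A"
  shows "- k + g + k \<in> cl B"
  using assms(2)
proof (induction rule: cl.induct)
  case (plus a g)
  have "- k + (a + g) + k = (- k + a + k) + (- k + g + k)" by (simp add: add.assoc)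
  then show ?case using cl_add[OF assms(1)[OF plus.hyps(1)] plus.IH] by simp
next
  case (minus a g)
  have "- k + (- a + g) + k = - (- k + a + k) + (- k + g + k)" by (simp add: group_nf)
  then show ?case using cl_add[OF cl_uminus[OF assms(1)[OF minus.hyps(1)]] minus.IH] by simp
qed (simp add: cl.zero)

text \<open>Conjugating by a word is a chain of conjugations by its letters, inverses included, so
  the generators are checked in both directions.\<close>

lemma cl_normal:
  assumes "\<And>k a. k \<in> A \<Longrightarrow> a \<in> B \<Longrightarrow> - k + a + k \<in> cl B \<and> k + a - k \<in> cl B"
    and "k \<in> cl A" "g \<in> cl B"
  shows "- k + g + k \<in> cl B"
  using assms(2,3)
proof (induction arbitrary: g rule: cl.induct)
  case (plus a k)
  have "- (a + k) + g + (a + k) = - k + (- a + g + a) + k" by (simp add: group_nf)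
  moreover have "- a + g + a \<in> cl B"
    by (rule cl_conj[OF _ plus.prems]) (use assms(1)[OF plus.hyps(1)] in auto)
  ultimately show ?case using plus.IH by simp
next
  case (minus a k)
  have "- (- a + k) + g + (- a + k) = - k + (a + g - a) + k" by (simp add: group_nf)
  moreover have "a + g - a \<in> cl B"
    using cl_conj[OF _ minus.prems, of "- a" B] assms(1)[OF minus.hyps(1)]
    by (simp add: diff_conv_add_uminus)
  ultimately show ?case using minus.IH by simp
qed simp

section \<open>Integer powers in additive notation\<close>

definition zp :: "'g::group_add \<Rightarrow> int \<Rightarrow> 'g" where
  "zp g n = (if 0 \<le> n then (((+) g) ^^ nat n) 0 else (((+) (- g)) ^^ nat (- n)) 0)"

lemma zp_0 [simp]: "zp g 0 = 0" by (simp add: zp_def)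

lemma zp_Suc: "zp g (n + 1) = g + zp g n"
proof (cases "0 \<le> n")
  case True
  then have "nat (n + 1) = Suc (nat n)" by simp
  then show ?thesis using True by (simp add: zp_def)
next
  case False
  then have "nat (- n) = Suc (nat (- 1 - n))" by simp
  then show ?thesis using False by (cases "n = - 1") (auto simp: zp_def)
qed

lemma zp_minus1: "zp g (n - 1) = - g + zp g n"
  using zp_Suc[of g "n - 1"] by (simp add: add.assoc)

lemma zp_1 [simp]: "zp g 1 = g" using zp_Suc[of g 0] by simp

lemma int_induct_pm:
  assumes "P 0" "\<And>i. P i \<Longrightarrow> P (i + 1)" "\<And>i. P i \<Longrightarrow> P (i - 1)"
  shows "P (i :: int)"
  by (rule int_induct[of P 0]) (use assms in auto)

lemma conj_uminus: "k + g = h + k \<Longrightarrow> k + - g = - h + k" for g :: "'g::group_add"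
  by (metis add.assoc add.right_neutral add_left_cancel right_minus left_minus add_0)

lemma zp_conj: "k + g = h + k \<Longrightarrow> k + zp g n = zp h n + k"
proof (induction n rule: int_induct_pm)
  case (2 i)
  then show ?case by (metis add.assoc zp_Suc)
next
  case (3 i)
  show ?case using 3 conj_uminus[OF 3(2)] by (metis add.assoc zp_minus1)
qed simp

lemma zp_add: "zp g (m + n) = zp g m + zp g n"
proof (induction m rule: int_induct_pm)
  case (2 i) then show ?case using zp_Suc[of g "i+n"] zp_Suc[of g i] by (simp add: add.assoc algebra_simps)
next
  case (3 i)
  have "i - 1 + n = (i + n) - 1" by simp
  with 3 show ?case using zp_minus1[of g "i+n"] zp_minus1[of g i] by (metis add.assoc)
qed simp

lemma zp_minus1_right: "zp g (n - 1) = zp g n + - g"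
  using zp_add[of g n "- 1"] zp_minus1[of g 0] by (simp add: diff_conv_add_uminus)

lemma zp_uminus: "zp (- g) n = zp g (- n)"
proof (induction n rule: int_induct_pm)
  case (2 i)
  have "- (i + 1) = - i - 1" by simp
  with 2 show ?case using zp_Suc[of "-g" i] zp_minus1[of g "-i"] by metis
next
  case (3 i) then show ?case using zp_minus1[of "-g" i] zp_Suc[of g "-i"] by simp
qed simp

section \<open>A presentation of GL(3, Z)\<close>

text \<open>The generators \<open>x, t, u, s\<close> play the roles of the elementary matrix \<open>E\<^sub>1\<^sub>2\<close>, of the
  transpositions of \<open>e\<^sub>1, e\<^sub>2\<close> and of \<open>e\<^sub>2, e\<^sub>3\<close>, and of the reflection in \<open>e\<^sub>1\<close>.\<close>

locale gl3_relations =
  fixes x t u s :: "'g::group_add"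
    and act :: "'g \<Rightarrow> int \<times> int \<times> int \<Rightarrow> int \<times> int \<times> int"
  assumes gen: "\<And>P g. P 0 \<Longrightarrow> (\<And>g. P g \<Longrightarrow> P (x + g)) \<Longrightarrow> (\<And>g. P g \<Longrightarrow> P (t + g)) \<Longrightarrow>
      (\<And>g. P g \<Longrightarrow> P (u + g)) \<Longrightarrow> (\<And>g. P g \<Longrightarrow> P (s + g)) \<Longrightarrow> P g"
    and act_add: "act (g + h) v = act g (act h v)"
    and act_0: "act 0 v = v"
    and act_x: "act x (a, b, c) = (a + b, b, c)"
    and act_t: "act t (a, b, c) = (b, a, c)"
    and act_u: "act u (a, b, c) = (a, c, b)"
    and act_s: "act s (a, b, c) = (- a, b, c)"
    and tt: "t + t = 0" and uu: "u + u = 0" and ss: "s + s = 0"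
    and tut: "t + u + t = u + t + u"
    and us: "u + s = s + u"
    and stst: "s + (t + s + t) = (t + s + t) + s"
    and s1x: "s + x + s = - x"
    and s2x: "(t + s + t) + x + (t + s + t) = - x"
    and s3x: "(u + (t + s + t) + u) + x = x + (u + (t + s + t) + u)"
    and x12_x13: "x + (u + x + u) = (u + x + u) + x"
    and x12_x32: "x + (u + (t + (u + x + u) + t) + u) = (u + (t + (u + x + u) + t) + u) + x"
    and x12_x23: "x + (t + (u + x + u) + t) = (u + x + u) + (t + (u + x + u) + t) + x"
    and xt: "x + t - x = t + x + t + (t + s + t)"
begin

text \<open>Conjugation by the two transpositions permutes the indices of elementary matrices and
  signs, so a relation proved once is transported to other index patterns.\<close>

definition "ct g = t + g + t"
definition "cu g = u + g + u"

lemma tt' [simp]: "t + (t + g) = g" by (simp add: tt flip: add.assoc)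
lemma uu' [simp]: "u + (u + g) = g" by (simp add: uu flip: add.assoc)
lemma ss' [simp]: "s + (s + g) = g" by (simp add: ss flip: add.assoc)
lemma mt [simp]: "- t = t" using tt by (metis add_eq_0_iff)
lemma mu [simp]: "- u = u" using uu by (metis add_eq_0_iff)
lemma ms [simp]: "- s = s" using ss by (metis add_eq_0_iff)

lemma ct_add: "ct (g + h) = ct g + ct h" by (simp add: ct_def add.assoc)
lemma cu_add: "cu (g + h) = cu g + cu h" by (simp add: cu_def add.assoc)
lemma ct_ct [simp]: "ct (ct g) = g" by (simp add: ct_def add.assoc tt)
lemma cu_cu [simp]: "cu (cu g) = g" by (simp add: cu_def add.assoc uu)
lemma ct_uminus: "ct (- g) = - ct g" by (simp add: ct_def add.assoc minus_add)
lemma cu_uminus: "cu (- g) = - cu g" by (simp add: cu_def add.assoc minus_add)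

section \<open>Elementary matrices and signs under permutation of the indices\<close>

lemma ct_cu_ct: "ct (cu (ct g)) = cu (ct (cu g))"
proof -
  have "ct (cu (ct g)) = (t + u + t) + g + (t + u + t)" by (simp add: ct_def cu_def add.assoc)
  also have "\<dots> = cu (ct (cu g))" unfolding tut by (simp add: ct_def cu_def add.assoc)
  finally show ?thesis .
qed

text \<open>\<open>xij\<close> plays the role of E_ij, with \<open>x\<close> itself as E_12;
  \<open>s2\<close> and \<open>s3\<close> are the reflections in e2 and e3.\<close>

definition "x13 = cu x"
definition "x23 = ct x13"
definition "x21 = ct x"
definition "x31 = cu x21"
definition "x32 = cu x23"
definition "s2 = ct s"
definition "s3 = cu s2"

lemma cu_s [simp]: "cu s = s" by (simp add: cu_def us add.assoc uu)

lemma ct_tab [simp]: "ct x = x21" "ct x21 = x" "ct x13 = x23" "ct x23 = x13" "ct x31 = x32" "ct x32 = x31"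
  "ct s = s2" "ct s2 = s" "ct s3 = s3" "ct t = t"
proof -
  \<comment> \<open>Moving \<open>x31\<close> and fixing \<open>s3\<close> is where the braid
    relation of \<open>t\<close> and \<open>u\<close> enters.\<close>
  show 1: "ct x31 = x32" unfolding x31_def x32_def x21_def x23_def x13_def by (rule ct_cu_ct)
  show "ct x32 = x31" using arg_cong[OF 1, of ct] by simp
  show "ct s3 = s3" using ct_cu_ct[of s] by (simp add: s3_def s2_def)
qed (simp_all add: x21_def x23_def s2_def ct_def[of t] tt)

lemma cu_tab [simp]: "cu x = x13" "cu x13 = x" "cu x21 = x31" "cu x31 = x21" "cu x23 = x32" "cu x32 = x23"
  "cu s2 = s3" "cu s3 = s2" "cu u = u"
  by (simp_all add: x31_def x32_def x13_def s3_def uu cu_def[of u])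

lemma s2_eq: "s2 = t + s + t" by (simp add: s2_def ct_def del: ct_tab)
lemma s3_eq: "s3 = u + (t + s + t) + u" by (simp add: s3_def s2_def ct_def cu_def del: ct_tab cu_tab)
lemma x13_eq: "x13 = u + x + u" by (simp add: x13_def cu_def del: cu_tab)
lemma x23_eq: "x23 = t + (u + x + u) + t" by (simp add: x23_def x13_def ct_def cu_def del: cu_tab ct_tab)
lemma x32_eq: "x32 = u + (t + (u + x + u) + t) + u" by (simp add: x32_def x23_def x13_def ct_def cu_def del: cu_tab ct_tab)

lemmas conj_t = arg_cong[of _ _ ct]
lemmas conj_u = arg_cong[of _ _ cu]
lemmas conj_push = ct_add ct_uminus cu_add cu_uminus

lemma r12_13: "x + x13 = x13 + x" using x12_x13 by (simp add: x13_eq)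
lemma r12_32: "x + x32 = x32 + x" using x12_x32 by (simp add: x32_eq)
lemma r12_23: "x + x23 = x13 + x23 + x" using x12_x23 by (simp add: x13_eq x23_eq)
text \<open>The relation behind Euclid's algorithm in the plane of e1 and e2. Solved for
  \<open>t\<close>, it writes the transposition as a product of \<open>x\<close>, \<open>x21\<close>
  and a sign.\<close>

lemma r_xt: "x + t - x = x21 + s2" using xt by (simp add: x21_def s2_def ct_def del: ct_tab)

lemma r13_23: "x13 + x23 = x23 + x13" using conj_u[OF r12_32] by (simp add: conj_push)
lemma r21_31: "x21 + x31 = x31 + x21" using conj_t[OF r12_32] by (simp add: conj_push)
lemma r21_23: "x21 + x23 = x23 + x21" using conj_t[OF r12_13] by (simp add: conj_push)
lemma r21_13: "x21 + x13 = x23 + x13 + x21" using conj_t[OF r12_23] by (simp add: conj_push)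
lemma r23_31: "x23 + x31 = x21 + x31 + x23" using conj_t[OF conj_u[OF r12_23]] by (simp add: conj_push)

lemma s12: "s + s2 = s2 + s" using stst by (simp add: s2_eq)
lemma s13: "s + s3 = s3 + s" using conj_u[OF s12] by (simp add: conj_push)
lemma s23: "s2 + s3 = s3 + s2" using conj_t[OF s13] by (simp add: conj_push)
lemma s2s2: "s2 + s2 = 0" by (simp add: s2_eq add.assoc tt)
lemma s3s3: "s3 + s3 = 0" by (simp add: s3_eq add.assoc uu tt)

lemma t_s: "t + s = s2 + t" "t + s2 = s + t" "t + s3 = s3 + t"
  using arg_cong[OF ct_tab(9), of "\<lambda>g. g + t"] by (simp_all add: s2_eq add.assoc tt ct_def[of s3] del: ct_tab)
lemma u_s: "u + s = s + u" "u + s2 = s3 + u" "u + s3 = s2 + u"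
  using us by (simp_all add: s3_eq s2_eq add.assoc uu tt)

lemma flip_inv: "w + w = 0 \<Longrightarrow> w + g + w = - g \<Longrightarrow> w + g = - g + w" for w g :: 'g
  by (metis add.assoc add.right_neutral)

lemma s_x: "s + x = - x + s" "s2 + x = - x + s2" "s3 + x = x + s3"
  using flip_inv[OF ss s1x] flip_inv[OF s2s2, of x] s2x s3x unfolding s2_eq s3_eq by blast+
lemma s_x13: "s + x13 = - x13 + s" "s2 + x13 = x13 + s2" "s3 + x13 = - x13 + s3"
  using conj_u[OF s_x(1)] conj_u[OF s_x(2)] conj_u[OF s_x(3)] by (simp_all add: conj_push)
lemma s_x23: "s + x23 = x23 + s" "s2 + x23 = - x23 + s2" "s3 + x23 = - x23 + s3"
  using conj_t[OF s_x13(1)] conj_t[OF s_x13(2)] conj_t[OF s_x13(3)] by (simp_all add: conj_push)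
lemma s_x21: "s + x21 = - x21 + s" "s2 + x21 = - x21 + s2" "s3 + x21 = x21 + s3"
  using conj_t[OF s_x(1)] conj_t[OF s_x(2)] conj_t[OF s_x(3)] by (simp_all add: conj_push)
lemma s_x31: "s + x31 = - x31 + s" "s2 + x31 = x31 + s2" "s3 + x31 = - x31 + s3"
  using conj_u[OF s_x21(1)] conj_u[OF s_x21(2)] conj_u[OF s_x21(3)] by (simp_all add: conj_push)

text \<open>\<open>K\<close> acts on the first two coordinates, and \<open>L\<close> is its part that fixes \<open>e\<^sub>1\<close> up to sign.\<close>

definition "K = cl {x, t, s, s3}"
definition "L = cl {x, s, s2, s3}"
text \<open>Equality of left cosets of \<open>L\<close>. A Euclid word stands for a point of an
  orbit, so it matters only up to the stabilizer on the right.\<close>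

definition eqL (infix "\<sim>" 50) where "g \<sim> h \<longleftrightarrow> - g + h \<in> L"

lemma eqL_refl [simp]: "g \<sim> g" by (simp add: eqL_def L_def cl.zero)
lemma eqL_sym: "g \<sim> h \<Longrightarrow> h \<sim> g"
  using cl_uminus[of "- g + h" "{x, s, s2, s3}"] by (simp add: eqL_def L_def minus_add)
lemma eqL_trans [trans]: "g \<sim> h \<Longrightarrow> h \<sim> k \<Longrightarrow> g \<sim> k"
  using cl_add[of "- g + h" "{x, s, s2, s3}" "- h + k"] by (simp add: eqL_def L_def add.assoc)
lemma eqL_left: "k + g \<sim> k + h \<longleftrightarrow> g \<sim> h"
  by (simp add: eqL_def group_nf)
lemma eqL_right: "l \<in> L \<Longrightarrow> g \<sim> g + l"
  by (simp add: eqL_def add.assoc)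
lemma L_gens: "x \<in> L" "- x \<in> L" "s \<in> L" "s2 \<in> L" "s3 \<in> L"
  by (simp_all add: L_def cl_gen cl_uminus)

text \<open>Euclid's algorithm gives a section of the orbit map of \<open>K\<close> on the plane of the first two
  coordinates, up to scaling by the gcd.\<close>

function euclid :: "int \<Rightarrow> int \<Rightarrow> 'g" where
  "euclid a b = (if b = 0 then 0 else zp x (a div b) + t + euclid b (a mod b))"
  by auto
termination by (relation "measure (\<lambda>(a, b). nat \<bar>b\<bar>)") (auto simp: abs_mod_less)

declare euclid.simps [simp del]

lemma euclid_0 [simp]: "euclid a 0 = 0" by (simp add: euclid.simps)

lemma euclid_x: "euclid (a + b) b \<sim> x + euclid a b"
proof (cases "b = 0")
  case True
  then show ?thesis using L_gens by (simp add: eqL_def)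
next
  case False
  then have "euclid (a + b) b = x + euclid a b"
    by (subst (1 2) euclid.simps) (simp add: zp_Suc add.assoc)
  then show ?thesis by simp
qed

lemma euclid_less:
  assumes "0 \<le> a \<and> a < b \<or> b < a \<and> a \<le> 0"
  shows "euclid a b = t + euclid b a"
proof -
  have "a div b = 0" "a mod b = a" "b \<noteq> 0" using assms by auto
  then show ?thesis by (subst euclid.simps) simp
qed

lemma x_s2: "t + x + t = x + t - x - s2" "- x - s2 = s2 + x"
  using r_xt s_x(2) by (auto simp: group_nf s2s2 x21_def ct_def simp del: ct_tab)
    (metis add.assoc add.right_neutral right_minus s2s2 add_eq_0_iff)+

text \<open>If the signs agree and the numbers differ, one of them is its own residue modulo the
  other, and a step of the algorithm with quotient 0 is exactly the swap. Only \<open>a = b\<close>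
  needs a relation.\<close>

lemma euclid_swap_same:
  assumes "0 \<le> a \<and> 0 \<le> b \<or> a \<le> 0 \<and> b \<le> 0" "a \<noteq> 0 \<or> b \<noteq> 0"
  shows "euclid b a \<sim> t + euclid a b"
proof -
  consider "a = b" | "0 \<le> a \<and> a < b \<or> b < a \<and> a \<le> 0" | "0 \<le> b \<and> b < a \<or> a < b \<and> b \<le> 0"
    using assms by linarith
  then show ?thesis
  proof cases
    case 1
    with assms have eq: "euclid a a = x + t" by (subst euclid.simps) simp
    have "t + (x + t) = x + t + (- x - s2)" using x_s2(1) by (simp add: group_nf)
    moreover have "- x - s2 \<in> L" using x_s2(2) cl_add[of s2 "{x,s,s2,s3}" x] L_gens by (simp add: L_def)
    ultimately show ?thesis using eqL_right 1 eq by simp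
  next
    case 2
    then show ?thesis using euclid_less[of a b] by simp
  next
    case 3
    then show ?thesis using euclid_less[of b a] by simp
  qed
qed

text \<open>Changing both signs keeps the quotients and negates the remainders. As
  \<open>s + s2\<close>, minus the identity of the plane, commutes with \<open>x\<close> and
  \<open>t\<close>, it passes through the whole word and ends in \<open>L\<close>.\<close>

lemma euclid_uminus: "euclid (- a) (- b) \<sim> s + s2 + euclid a b"
proof (induction a b rule: euclid.induct)
  case (1 a b)
  show ?case
  proof (cases "b = 0")
    case True
    then show ?thesis using L_gens by (simp add: eqL_def L_def cl_add)
  next
    case False
    have "(s + s2) + x = s + (- x + s2)" using s_x(2) by (simp add: add.assoc)
    also have "\<dots> = x + (s + s2)" using conj_uminus[OF s_x(1)] by (simp flip: add.assoc)
    finally have c: "(s + s2) + zp x n = zp x n + (s + s2)" for n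
      by (rule zp_conj)
    have d: "(s + s2) + t = t + (s + s2)"
    proof -
      have "s + (s2 + t) = (s + t) + s" by (simp only: t_s(1)[symmetric] add.assoc)
      also have "\<dots> = t + (s2 + s)" by (simp only: t_s(2)[symmetric] add.assoc)
      finally show ?thesis unfolding add.assoc s12[symmetric] .
    qed
    have "euclid (- a) (- b) = zp x (a div b) + t + euclid (- b) (- (a mod b))"
      using False by (subst euclid.simps) (simp add: div_minus_minus mod_minus_minus)
    also have "\<dots> \<sim> zp x (a div b) + t + (s + s2 + euclid b (a mod b))"
      using 1[OF False] by (simp add: eqL_left)
    also have "\<dots> = s + s2 + euclid a b"
    proof -
      have "\<dots> = (zp x (a div b) + (t + (s + s2))) + euclid b (a mod b)" by (simp only: add.assoc)
      also have "\<dots> = ((zp x (a div b) + (s + s2)) + t) + euclid b (a mod b)"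
        unfolding d[symmetric] by (simp only: add.assoc)
      also have "\<dots> = (s + s2) + (zp x (a div b) + t + euclid b (a mod b))"
        unfolding c[symmetric] by (simp only: add.assoc)
      finally show ?thesis using False by (subst (2) euclid.simps) simp
    qed
    finally show ?thesis .
  qed
qed

text \<open>Negating \<open>a\<close> turns a nonzero remainder \<open>r\<close> into
  \<open>b - r\<close>. Both runs meet at the pair \<open>(b - r, r)\<close>: one by
  \<open>euclid_x\<close>, the other by \<open>euclid_x\<close> and a swap of two numbers of equal
  sign. The relations \<open>x_s2\<close> reconcile the two routes.\<close>

lemma euclid_s: "euclid (- a) b \<sim> s + euclid a b"
proof (cases "b = 0")
  case True
  then show ?thesis using L_gens by (simp add: eqL_def)
next
  case b: False
  have sz: "s + zp x n = zp x (- n) + s" for n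
    using zp_conj[OF s_x(1)] by (simp add: zp_uminus)
  have st: "s + t = t + s2" using t_s by simp
  define q r where "q = a div b" and "r = a mod b"
  have a: "a = q * b + r" by (simp add: q_def r_def)
  have s_eu: "s + euclid a b = zp x (- q) + t + (s2 + euclid b r)"
    using b by (subst euclid.simps) (simp add: q_def r_def flip: add.assoc, simp add: sz add.assoc,
      simp add: st flip: add.assoc)
  show ?thesis
  proof (cases "r = 0")
    case True
    have "euclid (- a) b = zp x (- q) + t"
      using b a True by (subst euclid.simps) (simp add: minus_mult_left del: mult_minus_left)
    then show ?thesis using s_eu True eqL_right[OF L_gens(4)] by simp
  next
    case False
    have div: "(- a) div b = - q - 1" "(- a) mod b = b - r"
      using False b unfolding q_def r_def by (simp_all add: zdiv_zminus1_eq_if zmod_zminus1_eq_if)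
    have sgn: "0 < r \<and> r < b \<or> b < r \<and> r < 0"
      using False b pos_mod_sign[of b a] pos_mod_bound[of b a] neg_mod_sign[of b a] neg_mod_bound[of b a]
      unfolding r_def by linarith
    have "euclid b (b - r) \<sim> x + euclid r (b - r)"
      using euclid_x[of r "b - r"] by simp
    also have "\<dots> \<sim> x + (t + euclid (b - r) r)"
      unfolding eqL_left by (rule euclid_swap_same) (use sgn in auto)
    finally have "zp x (- q - 1) + t + euclid b (b - r) \<sim> zp x (- q - 1) + t + (x + (t + euclid (b - r) r))"
      by (simp add: eqL_left)
    also have "\<dots> = zp x (- q) + - x + (t + x + t) + euclid (b - r) r"
      by (simp add: zp_minus1_right add.assoc)
    also have "\<dots> = zp x (- q) + (t + s2) + (x + euclid (b - r) r)"
      using arg_cong[OF x_s2(2), of "\<lambda>z. z + euclid (b - r) r"]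
      unfolding x_s2(1) by (simp add: group_nf)
    also have "\<dots> \<sim> zp x (- q) + (t + s2) + euclid b r"
      unfolding eqL_left using euclid_x[of "b - r" r] by (simp add: eqL_sym)
    finally show ?thesis
      using s_eu div b by (subst euclid.simps) (simp add: add.assoc)
  qed
qed

text \<open>For opposite signs, flip the sign of \<open>b\<close>, swap, and undo the flip; the
  accumulated signs cancel across \<open>t\<close>.\<close>

lemma euclid_swap:
  assumes "a \<noteq> 0 \<or> b \<noteq> 0"
  shows "euclid b a \<sim> t + euclid a b"
proof (cases "0 \<le> a \<and> 0 \<le> b \<or> a \<le> 0 \<and> b \<le> 0")
  case True
  then show ?thesis using euclid_swap_same assms by blast
next
  case False
  have "euclid b a \<sim> s + euclid (- b) a" using euclid_s[of "- b" a] by simp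
  also have "\<dots> \<sim> s + (t + euclid a (- b))"
    unfolding eqL_left using euclid_swap_same[of a "- b"] False by auto
  also have "\<dots> \<sim> s + (t + (s + s2 + euclid (- a) b))"
    unfolding eqL_left using euclid_uminus[of "- a" b] by simp
  also have "\<dots> \<sim> s + (t + (s + s2 + (s + euclid a b)))"
    unfolding eqL_left using euclid_s[of a b] by simp
  also have "\<dots> = t + euclid a b"
  proof -
    have "s + s2 + (s + g) = s2 + g" for g by (metis add.assoc s12 ss')
    moreover have "s + (t + (s2 + g)) = t + g" for g by (metis add.assoc t_s(2) ss')
    ultimately show ?thesis by simp
  qed
  finally show ?thesis .
qed

section \<open>The action on vectors and the stabilizers in rank two\<close>

lemma act_uminus: "act g v = w \<Longrightarrow> act (- g) w = v"
  by (metis act_0 act_add left_minus)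

lemma act_table [simp]:
  "act x (a, b, c) = (a + b, b, c)" "act x13 (a, b, c) = (a + c, b, c)"
  "act x23 (a, b, c) = (a, b + c, c)" "act x21 (a, b, c) = (a, b + a, c)"
  "act x31 (a, b, c) = (a, b, c + a)"
  "act t (a, b, c) = (b, a, c)" "act u (a, b, c) = (a, c, b)"
  "act s (a, b, c) = (- a, b, c)" "act s2 (a, b, c) = (a, - b, c)" "act s3 (a, b, c) = (a, b, - c)"
  "act 0 v = v"
  by (simp_all add: x13_eq x23_eq x31_def x21_def s2_eq s3_eq ct_def cu_def act_add act_x act_t act_u act_s act_0
      del: ct_tab cu_tab)

lemma act_table_uminus [simp]:
  "act (- x) (a, b, c) = (a - b, b, c)" "act (- x13) (a, b, c) = (a - c, b, c)"
  "act (- x23) (a, b, c) = (a, b - c, c)" "act (- x21) (a, b, c) = (a, b - a, c)"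
  "act (- x31) (a, b, c) = (a, b, c - a)"
  by (rule act_uminus, simp)+

lemma K_act:
  assumes "k \<in> K"
  shows "\<exists>e f. \<bar>e\<bar> = 1 \<and> (\<forall>a b c. act k (a, b, c) = (fst (f a b), snd (f a b), e * c))"
proof -
  define Q where "Q k = (\<exists>e f. \<bar>e\<bar> = 1 \<and> (\<forall>a b c. act k (a, b, c) = (fst (f a b), snd (f a b), e * c)))" for k
  have QI: "Q g" if "\<bar>e\<bar> = 1" "\<And>a b c. act g (a, b, c) = (fst (f a b), snd (f a b), e * c)" for g e f
    unfolding Q_def using that by blast
  have Q_add: "Q (g + h)" if g: "Q g" and h: "Q h" for g h
  proof -
    obtain e f e' f' where "\<bar>e\<bar> = 1" "\<bar>e'\<bar> = 1"
      "\<And>a b c. act g (a, b, c) = (fst (f a b), snd (f a b), e * c)"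
      "\<And>a b c. act h (a, b, c) = (fst (f' a b), snd (f' a b), e' * c)"
      using g h unfolding Q_def by blast
    then show ?thesis
      by (intro QI[of "e * e'" _ "\<lambda>a b. f (fst (f' a b)) (snd (f' a b))"]) (auto simp: act_add abs_mult)
  qed
  have gens: "Q x" "Q (- x)" "Q t" "Q s" "Q s3"
    by (rule QI[of 1 _ "\<lambda>a b. (a + b, b)"] QI[of 1 _ "\<lambda>a b. (a - b, b)"] QI[of 1 _ "\<lambda>a b. (b, a)"]
          QI[of 1 _ "\<lambda>a b. (- a, b)"] QI[of "- 1" _ "\<lambda>a b. (a, b)"]; simp; fail)+
  have m3: "- s3 = s3" using s3s3 by (metis add_eq_0_iff)
  have "Q k"
    using assms unfolding K_def
  proof (induction rule: cl.induct)
    case zero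
    then show ?case by (rule QI[of 1 _ "\<lambda>a b. (a, b)"]) simp_all
  qed (use gens m3 Q_add in auto)
  then show ?thesis unfolding Q_def .
qed

text \<open>\<open>act\<close> is an abstract action by functions, so this is checked on the
  generators.\<close>

lemma act_zero: "act g (0, 0, 0) = (0, 0, 0)"
  by (rule gen[of "\<lambda>g. act g (0, 0, 0) = (0, 0, 0)"]) (simp_all add: act_add)

lemma euclid_s3: "s3 + euclid a b = euclid a b + s3"
proof (induction a b rule: euclid.induct)
  case (1 a b)
  show ?case
  proof (cases "b = 0")
    case False
    then have "s3 + euclid a b = (s3 + zp x (a div b)) + (t + euclid b (a mod b))"
      by (subst euclid.simps) (simp add: add.assoc)
    also have "\<dots> = zp x (a div b) + ((s3 + t) + euclid b (a mod b))"
      unfolding zp_conj[OF s_x(3)] by (simp add: add.assoc)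
    also have "\<dots> = zp x (a div b) + (t + (s3 + euclid b (a mod b)))"
      unfolding t_s(3)[symmetric] by (simp add: add.assoc)
    also have "\<dots> = euclid a b + s3"
      using 1[OF False] False by (subst (2) euclid.simps) (simp add: add.assoc)
    finally show ?thesis .
  qed simp
qed

lemma euclid_gens:
  assumes "a \<noteq> 0 \<or> b \<noteq> 0" "g \<in> {x, - x, t, s, s3}" "act g (a, b, 0) = (a', b', 0)"
  shows "euclid a' b' \<sim> g + euclid a b"
proof -
  have "euclid (a - b) b \<sim> - x + euclid a b"
    using euclid_x[of "a - b" b] eqL_left[of x "- x + euclid a b" "euclid (a - b) b"] by (simp add: eqL_sym)
  moreover have "euclid a b \<sim> s3 + euclid a b"
    unfolding euclid_s3 by (rule eqL_right) (rule L_gens)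
  ultimately show ?thesis
    using assms euclid_x[of a b] euclid_swap[of a b] euclid_s[of a b] by auto
qed

lemma involution_uminus: "- s2 = s2" "- s3 = s3"
  using s2s2 s3s3 by (metis add_eq_0_iff)+

text \<open>The Euclid section is equivariant modulo \<open>L\<close>. Letters of \<open>k\<close>
  are handled one at a time, and the vector stays nonzero throughout, as the swap requires.\<close>

lemma euclid_K:
  assumes "k \<in> K" "act k (a, b, 0) = (a', b', 0)" "a \<noteq> 0 \<or> b \<noteq> 0"
  shows "euclid a' b' \<sim> k + euclid a b"
proof -
  have step: "euclid a' b' \<sim> g + k + euclid a b"
    if kK: "k \<in> K" and g: "g \<in> {x, - x, t, s, s3}" and gk: "act (g + k) (a, b, 0) = (a', b', 0)"
      and IH: "\<And>a' b'. act k (a, b, 0) = (a', b', 0) \<Longrightarrow> euclid a' b' \<sim> k + euclid a b" for g k a' b'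
  proof -
    obtain a1 b1 where k: "act k (a, b, 0) = (a1, b1, 0)"
      using K_act[OF kK] by auto
    have nz: "a1 \<noteq> 0 \<or> b1 \<noteq> 0"
      using act_uminus[OF k] act_zero[of "- k"] assms(3) by auto
    have "euclid a' b' \<sim> g + euclid a1 b1"
      by (rule euclid_gens[OF nz g]) (use gk k in \<open>simp add: act_add\<close>)
    also have "\<dots> \<sim> g + (k + euclid a b)"
      unfolding eqL_left by (rule IH[OF k])
    finally show ?thesis by (simp add: add.assoc)
  qed
  show ?thesis
    using assms(1,2) unfolding K_def
  proof (induction arbitrary: a' b' rule: cl.induct)
    case (plus g k)
    show ?case by (rule step) (use plus in \<open>auto simp: K_def\<close>)
  next
    case (minus g k)
    show ?case by (rule step) (use minus in \<open>auto simp: K_def involution_uminus\<close>)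
  qed simp
qed

text \<open>The case of rank two: both Euclid words are empty when the second coordinate vanishes,
  so equivariance says that \<open>k\<close> itself is in \<open>L\<close>.\<close>

lemma K_stab:
  assumes "k \<in> K" "act k (a, 0, 0) = (b, 0, 0)" "a \<noteq> 0"
  shows "k \<in> L"
  using euclid_K[OF assms(1,2)] assms(3) by (simp add: eqL_def)

text \<open>\<open>K2\<close> and \<open>L2\<close> are the conjugates of \<open>K\<close> and \<open>L\<close> for the coordinates 2 and 3.\<close>

definition "K2 = cl {x23, u, s, s2}"
definition "L2 = cl {x23, s, s2, s3}"
text \<open>The evident elements keeping the line of e1: the first row together with
  \<open>K2\<close>.\<close>

definition "H = cl {x, x13, x23, u, s, s2}"

text \<open>Conjugation by \<open>t\<close> and then by \<open>u\<close> shifts coordinates 2, 3 to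
  1, 2, so facts about \<open>K2\<close> are inherited from \<open>K\<close>. The braid relation
  makes \<open>u\<close> become \<open>t\<close>.\<close>

lemma cu_ct_K2: "k \<in> K2 \<Longrightarrow> cu (ct k) \<in> K"
proof -
  assume k: "k \<in> K2"
  have "cu (ct u) = t"
    using cu_cu[of t] unfolding ct_def[of u] cu_def[of t] tut .
  then show ?thesis using k unfolding K2_def K_def
    by (elim cl_hom[of "\<lambda>g. cu (ct g)", rotated 2]) (auto simp: conj_push intro: cl_gen)
qed

lemma K2_act:
  assumes "k \<in> K2"
  shows "\<exists>e f. \<bar>e\<bar> = 1 \<and> (\<forall>a b c. act k (a, b, c) = (e * a, fst (f b c), snd (f b c)))"
proof -
  obtain e f where "\<bar>e\<bar> = 1" and
    *: "\<And>a b c. act (cu (ct k)) (a, b, c) = (fst (f a b), snd (f a b), e * c)"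
    using K_act[OF cu_ct_K2[OF assms]] by blast
  have "k = t + (u + cu (ct k) + u) + t"
    by (simp add: cu_def ct_def add.assoc tt uu)
  from arg_cong[OF this, of act]
  have "act k (a, b, c) = (e * a, fst (f b c), snd (f b c))" for a b c
    by (simp add: act_add *)
  with \<open>\<bar>e\<bar> = 1\<close> show ?thesis by blast
qed

lemma K2_stab:
  assumes "k \<in> K2" "act k (0, a, 0) = (0, b, 0)" "a \<noteq> 0"
  shows "k \<in> L2"
proof -
  have "act (cu (ct k)) (a, 0, 0) = (b, 0, 0)"
    by (simp add: cu_def ct_def act_add assms)
  then have "cu (ct k) \<in> L" using K_stab cu_ct_K2 assms by blast
  then have "ct (cu (cu (ct k))) \<in> L2" unfolding L_def L2_def
    by (elim cl_hom[of "\<lambda>g. ct (cu g)", rotated 2]) (auto simp: conj_push intro: cl_gen)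
  then show ?thesis by simp
qed

lemma H_act:
  assumes "h \<in> H"
  shows "\<exists>e. \<bar>e\<bar> = 1 \<and> (\<forall>a. act h (a, 0, 0) = (e * a, 0, 0))"
  using assms unfolding H_def
proof (induction rule: cl.induct)
  case zero
  then show ?case by (auto intro!: exI[of _ 1])
next
  case (plus g h)
  then obtain e where e: "\<bar>e\<bar> = 1" "\<And>a. act h (a, 0, 0) = (e * a, 0, 0)" by auto
  have "\<exists>d. \<bar>d\<bar> = 1 \<and> (\<forall>a. act g (a, 0, 0) = (d * a, 0, 0))"
    using plus.hyps(1) by (auto intro: exI[of _ 1] exI[of _ "- 1"])
  then obtain d where "\<bar>d\<bar> = 1" "\<And>a. act g (a, 0, 0) = (d * a, 0, 0)" by auto
  with e show ?case by (intro exI[of _ "d * e"]) (auto simp: act_add abs_mult)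
next
  case (minus g h)
  then obtain e where e: "\<bar>e\<bar> = 1" "\<And>a. act h (a, 0, 0) = (e * a, 0, 0)" by auto
  have "\<exists>d. \<bar>d\<bar> = 1 \<and> (\<forall>a. act (- g) (a, 0, 0) = (d * a, 0, 0))"
    using minus.hyps(1) by (auto simp: involution_uminus intro: exI[of _ 1] exI[of _ "- 1"])
  then obtain d where "\<bar>d\<bar> = 1" "\<And>a. act (- g) (a, 0, 0) = (d * a, 0, 0)" by auto
  with e show ?case by (intro exI[of _ "d * e"]) (auto simp: act_add abs_mult)
qed

section \<open>Unipotent rows and columns normalised by the rank two subgroups\<close>

lemma u_conj: "u + g = cu g + u" by (simp add: cu_def add.assoc uu)
lemma t_conj: "t + g = ct g + t" by (simp add: ct_def add.assoc tt)

text \<open>The first row is the unipotent radical of \<open>H\<close>. Since \<open>K2\<close>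
  normalises it, it can be collected on the left of an element of \<open>H\<close> and moved past
  the first factor of \<open>S\<close>.\<close>

lemma N_normal:
  assumes "k \<in> K2" "n \<in> cl {x, x13}"
  shows "- k + n + k \<in> cl {x, x13}"
proof (rule cl_normal[OF _ assms(1)[unfolded K2_def] assms(2)])
  fix k a assume k: "k \<in> {x23, u, s, s2}" and a: "a \<in> {x, x13}"
  have gens: "x \<in> cl {x, x13}" "x13 \<in> cl {x, x13}" "- x \<in> cl {x, x13}" "- x13 \<in> cl {x, x13}"
    "x13 + x \<in> cl {x, x13}" "- x13 + x \<in> cl {x, x13}"
    by (simp_all add: cl_gen cl_uminus cl_add)
  have 1: "x23 + x = (- x13 + x) + x23" using r12_23 by (simp add: add.assoc)
  have 2: "x23 + (x13 + x) = x + x23" using r12_23 r13_23 by (simp add: add.assoc[symmetric])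
  show "- k + a + k \<in> cl {x, x13} \<and> k + a - k \<in> cl {x, x13}"
    using k a gens conj_forms[OF 1] conj_forms[OF 2] conj_forms[OF r13_23[symmetric]]
      conj_involution[OF ss s_x(1)] conj_involution[OF ss s_x13(1)]
      conj_involution[OF s2s2 s_x(2)] conj_involution[OF s2s2 s_x13(2)]
      conj_involution[OF uu u_conj[of x]] conj_involution[OF uu u_conj[of x13]]
    by (elim insertE emptyE) auto
qed

lemma column1_normal:
  assumes "k \<in> K2" "n \<in> cl {x21, x31}"
  shows "- k + n + k \<in> cl {x21, x31}"
proof (rule cl_normal[OF _ assms(1)[unfolded K2_def] assms(2)])
  fix k a assume k: "k \<in> {x23, u, s, s2}" and a: "a \<in> {x21, x31}"
  have gens: "x21 \<in> cl {x21, x31}" "x31 \<in> cl {x21, x31}" "- x21 \<in> cl {x21, x31}" "- x31 \<in> cl {x21, x31}"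
    "x21 + x31 \<in> cl {x21, x31}" "- x21 + x31 \<in> cl {x21, x31}"
    by (simp_all add: cl_gen cl_uminus cl_add)
  have "x23 + (- x21 + x31) = - x21 + (x23 + x31)"
    using conj_uminus[OF r21_23[symmetric]] by (simp add: add.assoc[symmetric])
  then have 2: "x23 + (- x21 + x31) = x31 + x23" using r23_31 by (simp add: add.assoc)
  show "- k + a + k \<in> cl {x21, x31} \<and> k + a - k \<in> cl {x21, x31}"
    using k a gens conj_forms[OF r23_31] conj_forms[OF 2] conj_forms[OF r21_23[symmetric]]
      conj_involution[OF ss s_x21(1)] conj_involution[OF ss s_x31(1)]
      conj_involution[OF s2s2 s_x21(2)] conj_involution[OF s2s2 s_x31(2)]
      conj_involution[OF uu u_conj[of x21]] conj_involution[OF uu u_conj[of x31]]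
    by (elim insertE emptyE) auto
qed

text \<open>The third column is normalised by \<open>K\<close> and contained in \<open>H\<close>, so
  it can be pushed through \<open>K\<close> and absorbed.\<close>

lemma column3_normal:
  assumes "k \<in> K" "n \<in> cl {x13, x23}"
  shows "- k + n + k \<in> cl {x13, x23}"
proof (rule cl_normal[OF _ assms(1)[unfolded K_def] assms(2)])
  fix k a assume k: "k \<in> {x, t, s, s3}" and a: "a \<in> {x13, x23}"
  have gens: "x13 \<in> cl {x13, x23}" "x23 \<in> cl {x13, x23}" "- x13 \<in> cl {x13, x23}" "- x23 \<in> cl {x13, x23}"
    "x13 + x23 \<in> cl {x13, x23}" "- x13 + x23 \<in> cl {x13, x23}"
    by (simp_all add: cl_gen cl_uminus cl_add)
  have "x + (- x13 + x23) = - x13 + (x + x23)"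
    using conj_uminus[OF r12_13] by (simp add: add.assoc[symmetric])
  then have 2: "x + (- x13 + x23) = x23 + x" using r12_23 by (simp add: add.assoc)
  show "- k + a + k \<in> cl {x13, x23} \<and> k + a - k \<in> cl {x13, x23}"
    using k a gens conj_forms[OF r12_23] conj_forms[OF 2] conj_forms[OF r12_13]
      conj_involution[OF ss s_x13(1)] conj_involution[OF ss s_x23(1)]
      conj_involution[OF s3s3 s_x13(3)] conj_involution[OF s3s3 s_x23(3)]
      conj_involution[OF tt t_conj[of x13]] conj_involution[OF tt t_conj[of x23]]
    by (elim insertE emptyE) auto
qed

section \<open>The product set of \<open>K2\<close>, \<open>K\<close> and \<open>H\<close>\<close>

definition "KH = {k + h | k h. k \<in> K \<and> h \<in> H}"
definition "S = {k + y | k y. k \<in> K2 \<and> y \<in> KH}"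

lemma H_add: "g \<in> H \<Longrightarrow> h \<in> H \<Longrightarrow> g + h \<in> H" by (simp add: H_def cl_add)

lemma KHI: "k \<in> K \<Longrightarrow> h \<in> H \<Longrightarrow> k + h \<in> KH" by (auto simp: KH_def)
lemma SI: "k \<in> K2 \<Longrightarrow> y \<in> KH \<Longrightarrow> k + y \<in> S" by (auto simp: S_def)
lemma zero_mem: "0 \<in> K" "0 \<in> K2" "0 \<in> H" by (simp_all add: K_def K2_def H_def cl.zero)

lemma KH_K: "k \<in> K \<Longrightarrow> y \<in> KH \<Longrightarrow> k + y \<in> KH"
  using KHI[of "k + _"] unfolding KH_def K_def by (fastforce simp: cl_add add.assoc)

lemma S_K2: "k \<in> K2 \<Longrightarrow> y \<in> S \<Longrightarrow> k + y \<in> S"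
  using SI[of "k + _"] unfolding S_def K2_def by (fastforce simp: cl_add add.assoc)

lemma H_subsets: "cl {x, x13} \<subseteq> H" "cl {x13, x23} \<subseteq> H" "K2 \<subseteq> H" "L \<subseteq> H" "L2 \<subseteq> H"
proof -
  have gens: "x \<in> H" "x13 \<in> H" "x23 \<in> H" "u \<in> H" "s \<in> H" "s2 \<in> H"
    by (simp_all add: H_def cl_gen)
  have "u + s2 + u \<in> H" by (intro H_add gens)
  then have "s3 \<in> H" using u_s by (simp add: uu add.assoc)
  with gens show "cl {x, x13} \<subseteq> H" "cl {x13, x23} \<subseteq> H" "K2 \<subseteq> H" "L \<subseteq> H" "L2 \<subseteq> H"
    unfolding K2_def L_def L2_def H_def by (auto intro: cl_subset[rotated])
qed

lemma H_decomp: "h \<in> H \<Longrightarrow> \<exists>n k. n \<in> cl {x, x13} \<and> k \<in> K2 \<and> h = n + k"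
proof -
  have N: "\<exists>n k. n \<in> cl {x, x13} \<and> k \<in> K2 \<and> g + h = n + k"
    if g: "g \<in> cl {x, x13}" and h: "\<exists>n k. n \<in> cl {x, x13} \<and> k \<in> K2 \<and> h = n + k" for g h
  proof -
    obtain n k where nk: "n \<in> cl {x, x13}" "k \<in> K2" "h = n + k" using h by blast
    have "g + h = (g + n) + k" by (simp add: nk(3) add.assoc)
    then show ?thesis using cl_add[OF g nk(1)] nk(2) by blast
  qed
  have K: "\<exists>n k. n \<in> cl {x, x13} \<and> k \<in> K2 \<and> g + h = n + k"
    if g: "g \<in> K2" and h: "\<exists>n k. n \<in> cl {x, x13} \<and> k \<in> K2 \<and> h = n + k" for g h
  proof -
    obtain n k where nk: "n \<in> cl {x, x13}" "k \<in> K2" "h = n + k" using h by blast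
    have "g + h = (- (- g) + n + - g) + (g + k)" by (simp add: nk(3) add.assoc)
    moreover have "- (- g) + n + - g \<in> cl {x, x13}"
      using g by (intro N_normal nk(1)) (simp add: K2_def cl_uminus)
    moreover have "g + k \<in> K2" using g nk(2) by (simp add: K2_def cl_add)
    ultimately show ?thesis by blast
  qed
  have in_K2: "x23 \<in> K2" "- x23 \<in> K2" "u \<in> K2" "s \<in> K2" "s2 \<in> K2"
    by (simp_all add: K2_def cl_gen cl_uminus)
  have in_N: "x \<in> cl {x, x13}" "- x \<in> cl {x, x13}" "x13 \<in> cl {x, x13}" "- x13 \<in> cl {x, x13}"
    by (simp_all add: cl_gen cl_uminus)
  assume "h \<in> H"
  then show ?thesis
    unfolding H_def
  proof (induction rule: cl.induct)
    case zero
    have "0 \<in> cl {x, x13}" "0 \<in> K2" "(0::'g) = 0 + 0" by (simp_all add: K2_def cl.zero)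
    then show ?case by blast
  next
    case (plus g h)
    from plus.hyps(1) show ?case
      by (elim insertE emptyE) (simp_all only: N K in_K2 in_N plus.IH)
  next
    case (minus g h)
    from minus.hyps(1) show ?case
      by (elim insertE emptyE) (simp_all only: mu ms involution_uminus N K in_K2 in_N minus.IH)
  qed
qed

lemma KH_column3:
  assumes "r \<in> cl {x13, x23}" "y \<in> KH"
  shows "r + y \<in> KH"
proof -
  obtain k h where kh: "k \<in> K" "h \<in> H" "y = k + h" using assms(2) by (auto simp: KH_def)
  have "- k + r + k \<in> H" using column3_normal[OF kh(1) assms(1)] H_subsets by blast
  then have "k + ((- k + r + k) + h) \<in> KH" by (intro KHI kh(1) H_add[OF _ kh(2)])
  then show ?thesis by (simp add: kh(3) add.assoc)
qed

lemma x_K: "x \<in> K" "- x \<in> K" "t \<in> K" "s \<in> K" "s2 \<in> K" "s3 \<in> K" "x21 \<in> K"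
proof -
  show *: "x \<in> K" "- x \<in> K" "t \<in> K" "s \<in> K" "s3 \<in> K" by (simp_all add: K_def cl_gen cl_uminus)
  have "t + s + t \<in> K" "t + x + t \<in> K" using * by (auto simp: K_def intro: cl_add)
  then show "s2 \<in> K" "x21 \<in> K" by (simp_all add: s2_eq x21_def ct_def del: ct_tab)
qed

text \<open>A first row element passes \<open>K2\<close> by normality. Then its \<open>x\<close>
  letters join \<open>K\<close>, while its \<open>x13\<close> letters pass \<open>K\<close> inside
  the third column and join \<open>H\<close>.\<close>

lemma S_row1: "n \<in> cl {x, x13} \<Longrightarrow> y \<in> S \<Longrightarrow> n + y \<in> S"
proof -
  assume n: "n \<in> cl {x, x13}" and "y \<in> S"
  then obtain k z where y: "k \<in> K2" "z \<in> KH" "y = k + z" by (auto simp: S_def)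
  have KH: "n + z \<in> KH" if "n \<in> cl {x, x13}" for n
    using that
  proof (induction rule: cl.induct)
    case (plus a g)
    then show ?case using KH_K[OF x_K(1)] KH_column3[OF cl_gen, of x13] by (auto simp: add.assoc)
  next
    case (minus a g)
    then show ?case using KH_K[OF x_K(2)] KH_column3[OF cl_uminus[OF cl_gen], of x13]
      by (auto simp: add.assoc)
  qed (simp add: y)
  have "n + y = k + ((- k + n + k) + z)" by (simp add: y add.assoc)
  then show ?thesis using KH[OF N_normal[OF y(1) n]] y(1) by (simp add: SI)
qed

lemma KH_subset_S: "y \<in> KH \<Longrightarrow> y \<in> S"
  using SI[OF zero_mem(2)] by simp

lemma KH_L2: "l \<in> L2 \<Longrightarrow> y \<in> KH \<Longrightarrow> l + y \<in> KH"
  unfolding L2_def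
proof (induction rule: cl.induct)
  case (plus a g)
  then show ?case using KH_K x_K KH_column3[OF cl_gen, of x23] by (auto simp: add.assoc)
next
  case (minus a g)
  then show ?case using KH_K x_K KH_column3[OF cl_uminus[OF cl_gen], of x23]
    by (auto simp: add.assoc involution_uminus)
qed simp

text \<open>Follow e1 through the factors: \<open>h\<close> changes at most its sign,
  \<open>k'\<close> spreads it over the first two coordinates, and \<open>k\<close> keeps the first
  up to sign and spreads \<open>d\<close> over the last two.\<close>

lemma S_elim:
  assumes "g \<in> S" "act g (1, 0, 0) = (a, b, c)"
  obtains k k' h e a' d f where "k \<in> K2" "k' \<in> K" "h \<in> H" "g = k + (k' + h)" "\<bar>e\<bar> = 1" "\<bar>f\<bar> = 1"
    "act k' (e, 0, 0) = (a', d, 0)" "a = f * a'" "act k (0, d, 0) = (0, b, c)"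
proof -
  obtain k k' h where g: "k \<in> K2" "k' \<in> K" "h \<in> H" "g = k + (k' + h)"
    using assms(1) by (auto simp: S_def KH_def)
  obtain e where e: "\<bar>e\<bar> = 1" "act h (1, 0, 0) = (e, 0, 0)" using H_act[OF g(3)] by force
  obtain a' d where k': "act k' (e, 0, 0) = (a', d, 0)" using K_act[OF g(2)] by force
  obtain f F where f: "\<bar>f\<bar> = 1" "\<And>a b c. act k (a, b, c) = (f * a, fst (F b c), snd (F b c))"
    using K2_act[OF g(1)] by blast
  have "act k (a', d, 0) = (a, b, c)" using assms(2) by (simp add: g(4) act_add e k')
  then show ?thesis using that[OF g e(1) f(1) k'] by (simp add: f(2))
qed

lemma eq_0_of_act: "act k (0, d, 0) = (0, 0, 0) \<Longrightarrow> d = 0"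
  using act_uminus[of k "(0, d, 0)" "(0, 0, 0)"] act_zero[of "- k"] by simp

text \<open>One factor degenerates: \<open>d = 0\<close> puts \<open>k'\<close> into
  \<open>L\<close>, and \<open>d \<noteq> 0\<close> puts \<open>k\<close> into \<open>L2\<close>.
  Either way \<open>g\<close> lies in \<open>KH\<close>, which absorbs \<open>x21\<close> because
  \<open>x21\<close> lies in \<open>K\<close>.\<close>

lemma S_x21_c0:
  assumes "g \<in> S" "act g (1, 0, 0) = (a, b, 0)"
  shows "x21 + g \<in> S"
proof -
  obtain k k' h e a' d f where g: "k \<in> K2" "k' \<in> K" "h \<in> H" "g = k + (k' + h)" "\<bar>e\<bar> = 1"
    and k': "act k' (e, 0, 0) = (a', d, 0)" and k: "act k (0, d, 0) = (0, b, 0)"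
    by (rule S_elim[OF assms]) blast
  have "k' + h \<in> KH" using g by (intro KHI)
  have "g \<in> KH"
  proof (cases "d = 0")
    case True
    have "e \<noteq> 0" using g(5) by auto
    then have "k' \<in> L" using K_stab[OF g(2)] k' True by blast
    then have "k' \<in> H" using H_subsets by blast
    moreover have "k \<in> H" using g(1) H_subsets by blast
    ultimately have "k + (k' + h) \<in> H" using g(3) by (intro H_add)
    then show ?thesis using KHI[OF zero_mem(1)] g(4) by simp
  next
    case False
    then have "k \<in> L2" using K2_stab k g by blast
    then show ?thesis unfolding g(4) using \<open>k' + h \<in> KH\<close> by (rule KH_L2)
  qed
  then show ?thesis by (intro KH_subset_S KH_K x_K)
qed

text \<open>Here \<open>t + k'\<close> keeps the line of e1, so \<open>g\<close> is
  \<open>k\<close>, then \<open>t\<close>, then an element of \<open>H\<close>. Moved past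
  \<open>k\<close>, \<open>x21\<close> becomes a first column element; moved past \<open>t\<close>,
  it becomes a second column element, which lies in \<open>H\<close>.\<close>

lemma S_x21_a0:
  assumes "g \<in> S" "act g (1, 0, 0) = (0, b, c)"
  shows "x21 + g \<in> S"
proof -
  obtain k k' h e a' d f where g: "k \<in> K2" "k' \<in> K" "h \<in> H" "g = k + (k' + h)" "\<bar>e\<bar> = 1"
    and k': "act k' (e, 0, 0) = (a', d, 0)" and a': "0 = f * a'" "\<bar>f\<bar> = 1"
    by (rule S_elim[OF assms]) blast
  have "act (t + k') (e, 0, 0) = (d, 0, 0)" using k' a' by (auto simp: act_add)
  then have "t + k' \<in> H"
  proof -
    have "t + k' \<in> K" using g(2) x_K(3) by (simp add: K_def cl_add)
    moreover have "e \<noteq> 0" using g(5) by auto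
    ultimately have "t + k' \<in> L" using K_stab \<open>act (t + k') (e, 0, 0) = (d, 0, 0)\<close> by blast
    then show ?thesis using H_subsets by blast
  qed
  then have h': "t + k' + h \<in> H" by (rule H_add[OF _ g(3)])
  have "x21 \<in> cl {x21, x31}" by (simp add: cl_gen)
  from column1_normal[OF g(1) this] have "ct (- k + x21 + k) \<in> cl {x, x32}"
    by (elim cl_hom[of ct, rotated 2]) (auto simp: conj_push intro: cl_gen)
  moreover have "{x, x32} \<subseteq> H"
  proof -
    have "u + x23 + u \<in> H" by (intro H_add) (simp_all add: H_def cl_gen)
    then show ?thesis by (simp add: x32_def cu_def H_def cl_gen del: cu_tab)
  qed
  ultimately have "ct (- k + x21 + k) \<in> H" unfolding H_def by (rule cl_subset[rotated])
  then have "k + (t + (ct (- k + x21 + k) + (t + k' + h))) \<in> S"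
    by (intro SI KHI H_add h' g(1) x_K)
  moreover have "k + (t + (ct (- k + x21 + k) + (t + k' + h))) = x21 + g"
    by (simp add: ct_def g(4) add.assoc del: ct_tab)
  ultimately show ?thesis by simp
qed

lemma zp_iff:
  assumes "\<And>y. P (g + y) \<longleftrightarrow> P y"
  shows "P (zp g n + y) \<longleftrightarrow> P y"
proof (induction n rule: int_induct_pm)
  case (2 i)
  then show ?case using assms by (simp add: zp_Suc add.assoc)
next
  case (3 i)
  have "P (- g + (zp g i + y)) \<longleftrightarrow> P (zp g i + y)" using assms[of "- g + (zp g i + y)"] by simp
  with 3 show ?case by (simp add: zp_minus1 add.assoc)
qed simp

lemma act_zp:
  "act (zp x n) (a, b, c) = (a + n * b, b, c)"
  "act (zp x13 n) (a, b, c) = (a + n * c, b, c)"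
  "act (zp x23 n) (a, b, c) = (a, b + n * c, c)"
proof -
  show "act (zp x n) (a, b, c) = (a + n * b, b, c)"
    by (induction n rule: int_induct_pm) (simp_all add: zp_Suc zp_minus1 act_add algebra_simps)
  show "act (zp x13 n) (a, b, c) = (a + n * c, b, c)"
    by (induction n rule: int_induct_pm) (simp_all add: zp_Suc zp_minus1 act_add algebra_simps)
  show "act (zp x23 n) (a, b, c) = (a, b + n * c, c)"
    by (induction n rule: int_induct_pm) (simp_all add: zp_Suc zp_minus1 act_add algebra_simps)
qed

lemma S_uminus: "(\<And>y. y \<in> S \<Longrightarrow> g + y \<in> S) \<Longrightarrow> (\<And>y. y \<in> S \<Longrightarrow> - g + y \<in> S) \<Longrightarrow> g + y \<in> S \<longleftrightarrow> y \<in> S"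
  using minus_add_cancel[of g y] by fastforce

lemma S_iff: "x13 + y \<in> S \<longleftrightarrow> y \<in> S" "x23 + y \<in> S \<longleftrightarrow> y \<in> S" "u + y \<in> S \<longleftrightarrow> y \<in> S" "s + y \<in> S \<longleftrightarrow> y \<in> S"
  by (rule S_uminus; rule S_row1 S_K2; simp add: cl_gen cl_uminus K2_def; fail)+

text \<open>For \<open>c \<noteq> 0\<close>, the elements \<open>x13\<close> and \<open>x23\<close>, which commute with \<open>x21\<close> up to \<open>x23\<close>, reduce \<open>a\<close>
  and \<open>b\<close> modulo \<open>c\<close>. Choosing the residues of \<open>a\<close> and \<open>b\<close> with opposite signs keeps \<open>\<bar>a + b\<bar>\<close>
  below \<open>\<bar>c\<bar>\<close>; then \<open>x21\<close> is replaced by the other three sides of the square spanned by the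
  commuting elements \<open>x21\<close> and \<open>x31\<close>.\<close>

lemma S_x21:
  assumes "g \<in> S" "act g (1, 0, 0) = (a, b, c)"
  shows "x21 + g \<in> S"
  using assms
proof (induction "nat \<bar>c\<bar>" arbitrary: g a b c rule: less_induct)
  case less
  have IH: "x21 + g \<in> S" if "g \<in> S" "act g (1, 0, 0) = (a', b', c')" "\<bar>c'\<bar> < \<bar>c\<bar>" for g a' b' c'
    using less(1)[of c' g a' b'] that by simp
  have IH': "x31 + g \<in> S" if "g \<in> S" "act g (1, 0, 0) = (a', b', c')" "\<bar>b'\<bar> < \<bar>c\<bar>" for g a' b' c'
  proof -
    \<comment> \<open>Conjugation by \<open>u\<close> exchanges the last two coordinates: the
      hypothesis for \<open>x21\<close>, governed by the third coordinate, becomes one for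
      \<open>x31\<close>, governed by the second.\<close>
    have "x21 + (u + g) \<in> S" by (rule IH[of _ a' c' b']) (use that in \<open>simp_all add: S_iff act_add\<close>)
    then have "u + (x21 + (u + g)) \<in> S" by (simp add: S_iff)
    then show ?thesis using u_conj[of x21] by (simp flip: add.assoc) (simp add: add.assoc)
  qed
  have IH'': "- x31 + g \<in> S" if "g \<in> S" "act g (1, 0, 0) = (a', b', c')" "\<bar>b'\<bar> < \<bar>c\<bar>" for g a' b' c'
  proof -
    \<comment> \<open>Conjugation by \<open>s\<close> inverts \<open>x31\<close>.\<close>
    have "x31 + (s + g) \<in> S" by (rule IH'[of _ "- a'" b' c']) (use that in \<open>simp_all add: S_iff act_add\<close>)
    then have "s + (x31 + (s + g)) \<in> S" by (simp add: S_iff)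
    moreover have "s + (x31 + (s + g)) = (s + x31) + (s + g)" by (simp add: add.assoc)
    ultimately show ?thesis unfolding s_x31 by (simp add: add.assoc)
  qed
  show ?case
  proof (cases "c = 0")
    case True
    then show ?thesis using S_x21_c0 less by blast
  next
    case c: False
    define y where "y = zp x23 ((- b) div c) + (zp x13 (- (a div c)) + g)"
    define p q where "p = a mod c" and "q = - ((- b) mod c)"
    have "a div c * c + p = a" "(- b) div c * c + - q = - b"
      unfolding p_def q_def by simp_all
    then have pq: "a + - (a div c) * c = p" "b + ((- b) div c) * c = q"
      unfolding mult_minus_left by linarith+
    have act_y: "act y (1, 0, 0) = (p, q, c)"
      unfolding y_def act_add less(3) act_zp pq ..
    have y: "y \<in> S" unfolding y_def using less(2) zp_iff[of "\<lambda>y. y \<in> S"] S_iff by simp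
    have "x21 + (x13 + z) = x23 + (x13 + (x21 + z))" for z
      using arg_cong[OF r21_13, of "\<lambda>w. w + z"] by (simp only: add.assoc)
    then have P13: "x21 + (x13 + z) \<in> S \<longleftrightarrow> x21 + z \<in> S" for z by (simp add: S_iff)
    have "x21 + (x23 + z) = x23 + (x21 + z)" for z
      using arg_cong[OF r21_23, of "\<lambda>w. w + z"] by (simp only: add.assoc)
    then have P23: "x21 + (x23 + z) \<in> S \<longleftrightarrow> x21 + z \<in> S" for z by (simp add: S_iff)
    have "x21 + y \<in> S"
    proof (cases "p = 0")
      case True
      then show ?thesis using S_x21_a0 y act_y by blast
    next
      case p: False
      \<comment> \<open>In turn these bound the coordinates that govern \<open>- x31\<close>,
        \<open>x21\<close> and \<open>x31\<close>. The middle bound uses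
        \<open>p \<noteq> 0\<close>; otherwise \<open>c - p\<close> would not drop.\<close>
      have ineq: "\<bar>q\<bar> < \<bar>c\<bar>" "\<bar>c - p\<bar> < \<bar>c\<bar>" "\<bar>q + p\<bar> < \<bar>c\<bar>"
        using c p pos_mod_sign[of c a] pos_mod_bound[of c a] neg_mod_sign[of c a] neg_mod_bound[of c a]
          pos_mod_sign[of c "- b"] pos_mod_bound[of c "- b"] neg_mod_sign[of c "- b"] neg_mod_bound[of c "- b"]
        unfolding p_def[symmetric] q_def[symmetric] unfolding q_def by linarith+
      have "- x31 + y \<in> S" by (rule IH''[OF y act_y ineq(1)])
      moreover have "act (- x31 + y) (1, 0, 0) = (p, q, c - p)" by (simp add: act_add act_y)
      ultimately have "x21 + (- x31 + y) \<in> S" using ineq IH by blast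
      moreover have "act (x21 + (- x31 + y)) (1, 0, 0) = (p, q + p, c - p)" by (simp add: act_add act_y)
      ultimately have "x31 + (x21 + (- x31 + y)) \<in> S" using ineq IH' by blast
      moreover have "x31 + (x21 + z) = x21 + (x31 + z)" for z
      using arg_cong[OF r21_31, of "\<lambda>w. w + z"] by (simp only: add.assoc)
      ultimately show ?thesis by simp
    qed
    then show ?thesis
      unfolding y_def using zp_iff[of "\<lambda>z. x21 + z \<in> S", OF P23] zp_iff[of "\<lambda>z. x21 + z \<in> S", OF P13] by simp
  qed
qed

lemma S_UNIV: "g \<in> S"
proof (rule gen[of "\<lambda>g. g \<in> S"])
  have "0 + (0 + 0) \<in> S" by (intro SI KHI zero_mem)
  then show "0 \<in> S" by simp
next
  have N: "x \<in> cl {x, x13}" "- x \<in> cl {x, x13}" by (simp_all add: cl_gen cl_uminus)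
  have s2: "s2 + y \<in> S" if "y \<in> S" for y using that by (intro S_K2) (simp add: K2_def cl_gen)
  have x21: "x21 + y \<in> S" if "y \<in> S" for y using S_x21[OF that] by (metis prod_cases3)
  show "x + y \<in> S" if "y \<in> S" for y using S_row1 that N by blast
  show "t + y \<in> S" if "y \<in> S" for y
  proof -
    \<comment> \<open>By \<open>r_xt\<close>, \<open>t\<close> is a product of \<open>x\<close>,
      \<open>x21\<close> and \<open>s2\<close>, for each of which closure is known.\<close>
    have "x + (t + y) = x + t - x + (x + y)" by (simp add: group_nf)
    also have "\<dots> = x21 + (s2 + (x + y))" unfolding r_xt by (simp add: add.assoc)
    finally have "- x + (x21 + (s2 + (x + y))) = t + y" by (metis minus_add_cancel)
    moreover have "- x + (x21 + (s2 + (x + y))) \<in> S"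
      by (intro S_row1[OF N(2)] x21 s2 S_row1[OF N(1)] that)
    ultimately show ?thesis by simp
  qed
qed (simp_all add: S_iff)

section \<open>Normal forms and faithfulness\<close>

lemma zp_form_row1: "n \<in> cl {x, x13} \<Longrightarrow> \<exists>i j. n = zp x i + zp x13 j"
proof (induction rule: cl.induct)
  case zero
  then show ?case by (auto intro!: exI[of _ 0])
next
  have comm: "x13 + zp x i = zp x i + x13" for i by (rule zp_conj) (rule r12_13[symmetric])
  {
    case (plus a g)
    then obtain i j where g: "g = zp x i + zp x13 j" by blast
    have "x + g = zp x (i + 1) + zp x13 j" by (simp add: g zp_Suc add.assoc)
    moreover have "x13 + g = zp x i + zp x13 (j + 1)" using comm by (simp add: g zp_Suc flip: add.assoc)
    ultimately show ?case using plus.hyps(1) by auto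
  next
    case (minus a g)
    then obtain i j where g: "g = zp x i + zp x13 j" by blast
    have "- x13 + zp x i = zp x i + - x13"
      by (rule conj_uminus[OF comm[symmetric], symmetric])
    then have "- x13 + g = zp x i + zp x13 (j - 1)" by (simp add: g zp_minus1 flip: add.assoc)
    moreover have "- x + g = zp x (i - 1) + zp x13 j" by (simp add: g zp_minus1 add.assoc)
    ultimately show ?case using minus.hyps(1) by auto
  }
qed

text \<open>The eight diagonal sign matrices as explicit words, which the action can tell
  apart.\<close>

definition sg :: "bool \<Rightarrow> bool \<Rightarrow> bool \<Rightarrow> 'g" where
  "sg p q r = (if p then s else 0) + ((if q then s2 else 0) + (if r then s3 else 0))"

lemma sg_add: "s + sg p q r = sg (\<not> p) q r" "s2 + sg p q r = sg p (\<not> q) r" "s3 + sg p q r = sg p q (\<not> r)"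
proof -
  have s2s2': "s2 + (s2 + g) = g" and s3s3': "s3 + (s3 + g) = g" for g
    by (simp_all add: s2s2 s3s3 flip: add.assoc)
  have comm: "s2 + (s + g) = s + (s2 + g)" "s3 + (s + g) = s + (s3 + g)" "s3 + (s2 + g) = s2 + (s3 + g)" for g
    by (simp_all add: s12 s13 s23 flip: add.assoc)
  show "s + sg p q r = sg (\<not> p) q r" "s2 + sg p q r = sg p (\<not> q) r" "s3 + sg p q r = sg p q (\<not> r)"
    by (cases p; cases q; cases r; simp add: sg_def comm s12[symmetric] s13[symmetric] s23[symmetric] s2s2 s3s3 s2s2' s3s3' ss; fail)+
qed

lemma L2_form: "l \<in> L2 \<Longrightarrow> \<exists>i p q r. l = zp x23 i + sg p q r"
  unfolding L2_def
proof (induction rule: cl.induct)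
  case zero
  then show ?case by (auto simp: sg_def intro!: exI[of _ 0] exI[of _ False])
next
  have z: "s + zp x23 i = zp x23 i + s" "s2 + zp x23 i = zp x23 (- i) + s2" "s3 + zp x23 i = zp x23 (- i) + s3" for i
    using zp_conj[OF s_x23(1)] zp_conj[OF s_x23(2)] zp_conj[OF s_x23(3)] by (simp_all add: zp_uminus)
  {
    case (plus a g)
    then obtain i p q r where g: "g = zp x23 i + sg p q r" by blast
    have "x23 + g = zp x23 (i + 1) + sg p q r" by (simp add: g zp_Suc add.assoc)
    moreover have "s + g = zp x23 i + sg (\<not> p) q r" "s2 + g = zp x23 (- i) + sg p (\<not> q) r"
      "s3 + g = zp x23 (- i) + sg p q (\<not> r)"
      unfolding g add.assoc[symmetric] z unfolding add.assoc sg_add by simp_all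
    ultimately show ?case using plus.hyps(1) by blast
  next
    case (minus a g)
    then obtain i p q r where g: "g = zp x23 i + sg p q r" by blast
    have "- x23 + g = zp x23 (i - 1) + sg p q r" by (simp add: g zp_minus1 add.assoc)
    moreover have "- s + g = zp x23 i + sg (\<not> p) q r" "- s2 + g = zp x23 (- i) + sg p (\<not> q) r"
      "- s3 + g = zp x23 (- i) + sg p q (\<not> r)"
      unfolding ms involution_uminus g add.assoc[symmetric] z unfolding add.assoc sg_add by simp_all
    ultimately show ?case using minus.hyps(1) by blast
  }
qed

theorem eq_0_if_act_trivial:
  assumes id: "\<And>v. act g v = v"
  shows "g = 0"
proof -
  obtain k k' h e a' d f where g: "k \<in> K2" "k' \<in> K" "h \<in> H" "g = k + (k' + h)" "\<bar>e\<bar> = 1"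
    and k': "act k' (e, 0, 0) = (a', d, 0)" and k: "act k (0, d, 0) = (0, 0, 0)"
    by (rule S_elim[OF S_UNIV id]) blast
  \<comment> \<open>As e1 is fixed, \<open>k'\<close> keeps its line and falls under the case of
    rank two; hence \<open>g\<close> lies in \<open>H\<close>.\<close>
  have "d = 0" using eq_0_of_act k by blast
  have "e \<noteq> 0" using g(5) by auto
  then have "k' \<in> L" using K_stab[OF g(2)] k' \<open>d = 0\<close> by blast
  then have "k' \<in> H" "k \<in> H" using H_subsets g(1) by blast+
  then have "g \<in> H" using H_add[OF \<open>k \<in> H\<close> H_add[OF \<open>k' \<in> H\<close> g(3)]] g(4) by simp
  from H_decomp[OF this] obtain n q where nq: "n \<in> cl {x, x13}" "q \<in> K2" "g = n + q" by blast
  from zp_form_row1[OF nq(1)] obtain i j where n: "n = zp x i + zp x13 j" by blast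
  obtain f F where f: "\<And>a b c. act q (a, b, c) = (f * a, fst (F b c), snd (F b c))"
    using K2_act[OF nq(2)] by blast
  have F: "act g (a, b, c) = (f * a + j * snd (F b c) + i * fst (F b c), fst (F b c), snd (F b c))" for a b c
    by (cases "F b c") (simp add: nq(3) n act_add act_zp f)
  \<comment> \<open>The last two coordinates of the images of e2 and e3 give the values of
    \<open>F\<close>; the first coordinates are then \<open>i\<close> and \<open>j\<close>.\<close>
  have "i = 0" using F[of 0 1 0] id[of "(0, 1, 0)"] by (cases "F 1 0") auto
  moreover have "j = 0" using F[of 0 0 1] id[of "(0, 0, 1)"] by (cases "F 0 1") auto
  ultimately have "g = q" using nq n by simp
  \<comment> \<open>The case of rank two again, now for e2.\<close>
  then have "g \<in> L2" using K2_stab[OF nq(2), of 1 1] id by simp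
  then obtain i p q r where l: "g = zp x23 i + sg p q r" using L2_form by blast
  have act: "act g (a, b, c) = (if p then - a else a, (if q then - b else b) + i * (if r then - c else c), if r then - c else c)" for a b c
    by (simp add: l act_add act_zp sg_def)
  have "\<not> p" "\<not> q" "\<not> r" "i = 0"
    using act[of 1 0 0] act[of 0 1 0] act[of 0 0 1] id by (auto split: if_splits)
  then show ?thesis by (simp add: l sg_def)
qed

end

section \<open>Words and substitutions\<close>

declare add_uminus_conv_diff [simp]

lemma reduced_append:
  "reduced (u @ v) \<longleftrightarrow> reduced u \<and> reduced v \<and> (u \<noteq> [] \<longrightarrow> v \<noteq> [] \<longrightarrow> \<not> cancels (last u) (hd v))"
  by (auto simp: reduced_def successively_append_iff)

lemma reduced_Cons: "reduced (x # w) \<longleftrightarrow> reduced w \<and> (w \<noteq> [] \<longrightarrow> \<not> cancels x (hd w))"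
  using reduced_append[of "[x]" w] by (auto simp: reduced_def)

lemma reduced_single [simp]: "reduced [x]" by (simp add: reduced_def)

definition neg :: "'a \<times> bool \<Rightarrow> 'a \<times> bool" where "neg x = (fst x, \<not> snd x)"
definition winv :: "'a word \<Rightarrow> 'a word" where "winv w = rev (map neg w)"

lemma neg_neg [simp]: "neg (neg x) = x" by (simp add: neg_def)
lemma neg_eq_iff [simp]: "neg x = neg y \<longleftrightarrow> x = y" by (metis neg_neg)
lemma fst_neg [simp]: "fst (neg x) = fst x" by (simp add: neg_def)
lemma neg_neq [simp]: "neg x \<noteq> x" "x \<noteq> neg x" by (auto simp: neg_def prod_eq_iff)
lemma cancels_iff: "cancels x y \<longleftrightarrow> x = neg y" by (auto simp: cancels_def neg_def prod_eq_iff)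
lemma winv_winv [simp]: "winv (winv w) = w" by (simp add: winv_def rev_map comp_def)
lemma length_winv [simp]: "length (winv w) = length w" by (simp add: winv_def)
lemma winv_append [simp]: "winv (u @ v) = winv v @ winv u" by (simp add: winv_def)
lemma winv_Nil [simp]: "winv [] = []" by (simp add: winv_def)
lemma winv_Cons: "winv (x # w) = winv w @ [neg x]" by (simp add: winv_def)
lemma winv_eq_Nil [simp]: "winv w = [] \<longleftrightarrow> w = []" by (simp add: winv_def)
lemma reduced_winv [simp]: "reduced (winv w) \<longleftrightarrow> reduced w"
proof -
  have "reduced w \<Longrightarrow> reduced (winv w)" for w :: "'a word"
    by (induction w) (auto simp: winv_Cons reduced_append reduced_Cons cancels_iff winv_def last_rev hd_map)
  from this this[of "winv w"] show ?thesis by auto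
qed

lemma reduce_winv_append: "reduce (winv w @ w) = []"
proof -
  have m: "map neg w = map (\<lambda>(a, e). (a, \<not> e)) w" by (auto simp: neg_def)
  show ?thesis unfolding winv_def m by (rule reduce_inverse_append)
qed

lemma reduce_mid: "reduce w = [] \<Longrightarrow> reduce (u @ w @ v) = reduce (u @ v)"
  by (metis append.left_neutral append_assoc reduce_append_reduce reduce_reduce_append)

lemma reduce_cancel: "reduce (u @ winv w @ w @ v) = reduce (u @ v)" "reduce (u @ w @ winv w @ v) = reduce (u @ v)"
  using reduce_mid[OF reduce_winv_append, of u w v] reduce_mid[OF reduce_winv_append, of u "winv w" v] by simp_all

definition letter_image :: "('a \<Rightarrow> 'b word) \<Rightarrow> 'a \<times> bool \<Rightarrow> 'b word" where
  "letter_image f x = (if snd x then f (fst x) else winv (f (fst x)))"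

text \<open>The homomorphism extending \<open>f\<close>, reduced once at the end. For reduced images
  and on reduced words it is \<open>free_extension\<close>.\<close>

definition sub :: "('a \<Rightarrow> 'b word) \<Rightarrow> 'a word \<Rightarrow> 'b word" where
  "sub f w = reduce (concat (map (letter_image f) w))"

lemma letter_image_neg: "letter_image f (neg x) = winv (letter_image f x)"
  by (simp add: letter_image_def neg_def)

lemma reduced_sub [simp]: "reduced (sub f w)" by (simp add: sub_def reduced_reduce)
lemma sub_Nil [simp]: "sub f [] = []" by (simp add: sub_def reduce_def)

lemma sub_append: "sub f (u @ v) = reduce (sub f u @ sub f v)"
  by (simp add: sub_def reduce_append_reduce reduce_reduce_append)

lemma sub_Cons: "sub f (x # w) = reduce (letter_image f x @ sub f w)"
  by (simp add: sub_def reduce_append_reduce)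

lemma sub_push: "sub f (push x w) = sub f (x # w)"
proof (cases w)
  case (Cons y v)
  show ?thesis
  proof (cases "cancels x y")
    case True
    then have "x = neg y" by (simp add: cancels_iff)
    then have "sub f (x # y # v) = sub f v"
      using reduce_cancel(1)[of "[]" "letter_image f y" "concat (map (letter_image f) v)"]
      by (simp add: sub_def letter_image_neg)
    with Cons True show ?thesis by simp
  qed (simp add: Cons)
qed simp

lemma sub_reduce: "sub f (reduce w) = sub f w"
proof (induction w)
  case (Cons x w)
  have "sub f (reduce (x # w)) = sub f (x # reduce w)"
    by (simp add: reduce_def sub_push)
  with Cons show ?case by (simp add: sub_Cons)
qed (simp add: reduce_def)

lemma sub_mult: "sub f (reduce (u @ v)) = reduce (sub f u @ sub f v)"
  by (simp add: sub_reduce sub_append)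

lemma inverse_reduce: "reduce (winv w) = winv (reduce w)"
proof -
  have "winv (reduce w) = reduce (winv (reduce w) @ (w @ winv w))"
    using reduce_cancel(2)[of "winv (reduce w)" w "[]"] by (simp add: reduce_reduced reduced_reduce)
  also have "\<dots> = reduce (reduce (winv (reduce w) @ reduce w) @ winv w)"
    by (metis append_assoc reduce_append_reduce reduce_reduce_append)
  also have "\<dots> = reduce (winv w)" by (simp add: reduce_winv_append)
  finally show ?thesis ..
qed

lemma sub_winv: "sub f (winv w) = winv (sub f w)"
proof -
  have "concat (map (letter_image f) (winv w)) = winv (concat (map (letter_image f) w))"
    by (induction w) (simp_all add: winv_Cons letter_image_neg)
  then show ?thesis by (simp add: sub_def inverse_reduce)
qed

lemma letter_image_sub: "letter_image (\<lambda>a. sub f (g a)) x = sub f (letter_image g x)"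
  by (simp add: letter_image_def sub_winv)

lemma sub_sub: "sub (\<lambda>a. sub f (g a)) w = sub f (sub g w)"
proof (induction w)
  case (Cons x w)
  then show ?case by (simp add: sub_Cons letter_image_sub sub_mult)
qed simp

lemma sub_letter: "(\<And>a. reduced (f a)) \<Longrightarrow> sub f [x] = letter_image f x"
  by (simp add: sub_def letter_image_def reduce_reduced)

lemma sub_id: "reduced w \<Longrightarrow> sub (\<lambda>a. [(a, True)]) w = w"
proof -
  have "concat (map (letter_image (\<lambda>a. [(a, True)])) w) = w"
    by (induction w) (auto simp: letter_image_def winv_def neg_def prod_eq_iff)
  then show "reduced w \<Longrightarrow> ?thesis" by (simp add: sub_def reduce_reduced)
qed

section \<open>Cancellation\<close>

text \<open>Cancellation in a product of reduced words \<open>u\<close> and \<open>v\<close> is the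
  common prefix of \<open>winv u\<close> and \<open>v\<close>; see
  \<open>reduce_append_lcp\<close>.\<close>

fun lcp :: "'a list \<Rightarrow> 'a list \<Rightarrow> nat" where
  "lcp (x # u) (y # v) = (if x = y then Suc (lcp u v) else 0)"
| "lcp _ _ = 0"

lemma lcp_sym: "lcp u v = lcp v u"
  by (induction u v rule: lcp.induct) auto

lemma lcp_take: "take (lcp u v) u = take (lcp u v) v"
  by (induction u v rule: lcp.induct) auto

lemma lcp_le: "lcp u v \<le> length u" "lcp u v \<le> length v"
  by (induction u v rule: lcp.induct) auto

text \<open>The comparison ends before position \<open>m\<close>, so later letters cannot affect it.
  Cancellation against a long product is thus decided within the image of its first letter.\<close>

lemma lcp_take_append: "lcp u v < m \<Longrightarrow> m \<le> length v \<Longrightarrow> lcp u (take m v @ w) = lcp u v"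
proof (induction u v arbitrary: m rule: lcp.induct)
  case (1 x u y v)
  then show ?case by (cases m) auto
next
  case ("2_2" u)
  then show ?case by (cases u) auto
qed auto

lemma reduce_winv_lcp:
  "reduced u \<Longrightarrow> reduced v \<Longrightarrow> reduce (winv u @ v) = winv (drop (lcp u v) u) @ drop (lcp u v) v"
proof (induction u v rule: lcp.induct)
  case (1 x u y v)
  then have red: "reduced u" "reduced v" by (simp_all add: reduced_Cons)
  show ?case
  proof (cases "x = y")
    case True
    have "reduce (winv (x # u) @ x # v) = reduce (winv u @ v)"
      using reduce_cancel(1)[of "winv u" "[x]" v] by (simp add: winv_Cons winv_def)
    with True 1(1)[OF True red] show ?thesis by simp
  next
    case False
    have "reduced (winv (x # u) @ y # v)"
      using 1 False by (simp only: reduced_append reduced_winv) (simp add: winv_Cons cancels_iff)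
    then show ?thesis using False by (simp add: reduce_reduced)
  qed
qed (simp_all add: reduce_reduced)

lemma reduce_append_lcp:
  assumes "reduced u" "reduced v"
  defines "c \<equiv> lcp (winv u) v"
  shows "reduce (u @ v) = take (length u - c) u @ drop c v"
proof -
  have "winv (drop c (winv u)) = take (length u - c) u"
    by (simp add: winv_def rev_map drop_map drop_rev comp_def)
  then show ?thesis using reduce_winv_lcp[of "winv u" v] assms by simp
qed

text \<open>Agreement at position \<open>i\<close> makes that letter inverse to its mirror image.
  Reaching the middle would give a letter inverse to itself, or two adjacent letters that
  cancel.\<close>

lemma lcp_self:
  assumes "reduced u" "u \<noteq> []"
  shows "2 * lcp (winv u) u < length u"
proof (rule ccontr)
  define n where "n = length u"
  assume "\<not> ?thesis"
  then have n: "n \<le> 2 * lcp (winv u) u" by (simp add: n_def)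
  have "n > 0" using assms by (simp add: n_def)
  have eq: "neg (u ! (n - 1 - i)) = u ! i" if "i < lcp (winv u) u" for i
  proof -
    have "i < n" using that lcp_le(2)[of "winv u" u] by (simp add: n_def)
    then have "winv u ! i = neg (u ! (n - 1 - i))" by (simp add: winv_def rev_nth n_def)
    moreover have "winv u ! i = u ! i"
      using arg_cong[OF lcp_take[of "winv u" u], of "\<lambda>w. w ! i"] that by simp
    ultimately show ?thesis by simp
  qed
  show False
  proof (cases "odd n")
    case True
    then obtain m where m: "n = 2 * m + 1" by (auto elim: oddE)
    with n have "m < lcp (winv u) u" by linarith
    from eq[OF this] m show False by simp
  next
    case False
    then obtain m where m: "n = 2 * m" by (auto elim: evenE)
    with \<open>n > 0\<close> obtain j where j: "m = Suc j" by (cases m) auto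
    from n m j have "j < lcp (winv u) u" by linarith
    from eq[OF this] have "neg (u ! Suc j) = u ! j" using m j by simp
    moreover have "Suc j < length u" using m j by (simp add: n_def)
    then have "\<not> cancels (u ! j) (u ! Suc j)"
      using assms(1) unfolding reduced_def by (simp add: successively_conv_nth)
    ultimately show False by (metis cancels_iff)
  qed
qed

section \<open>Nielsen reduction\<close>

fun digit :: "gen3 \<times> bool \<Rightarrow> nat" where
  "digit (a, e) = (case a of gA \<Rightarrow> 0 | gB \<Rightarrow> 2 | gC \<Rightarrow> 4) + (if e then 1 else 0)"

text \<open>A word read as a base six numeral: the lexicographic order on words of equal length, as
  a number that can be added up in a measure.\<close>

fun wval :: "gen3 word \<Rightarrow> nat" where
  "wval [] = 0"
| "wval (x # w) = digit x * 6 ^ length w + wval w"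

lemma digit_less: "digit x < 6"
  by (cases x) (auto split: gen3.split)

lemma digit_inj: "digit x = digit y \<longleftrightarrow> x = y"
  by (cases x; cases y) (auto split: gen3.splits if_splits)

lemma wval_less: "wval w < 6 ^ length w"
proof (induction w)
  case (Cons x w)
  have "digit x * 6 ^ length w + wval w < (digit x + 1) * 6 ^ length w" using Cons by simp
  also have "\<dots> \<le> 6 * 6 ^ length w" using digit_less[of x] by (intro mult_right_mono) auto
  finally show ?case by simp
qed simp

lemma wval_inj: "length u = length v \<Longrightarrow> wval u = wval v \<Longrightarrow> u = v"
proof (induction u v rule: list_induct2)
  case (Cons x u y v)
  have "digit x = digit y"
  proof -
    have "(digit x * 6 ^ length u + wval u) div 6 ^ length u = (digit y * 6 ^ length u + wval v) div 6 ^ length u"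
      using Cons by simp
    then show ?thesis using wval_less[of u] wval_less[of v] Cons.hyps by simp
  qed
  with Cons show ?case by (simp add: digit_inj)
qed simp

lemma wval_append: "wval (u @ v) = wval u * 6 ^ length v + wval v"
  by (induction u) (simp_all add: power_add algebra_simps)

text \<open>\<open>weight\<close> compares words of equal length by their initial halves and those of their inverses.
  It decreases when a cancelling half of a word is replaced by a smaller one, which breaks the
  ties that length reduction leaves open.\<close>

definition half :: "'a word \<Rightarrow> 'a word" where "half w = take ((length w + 1) div 2) w"
definition weight :: "gen3 word \<Rightarrow> nat" where "weight w = wval (half w) + wval (half (winv w))"

lemma weight_winv [simp]: "weight (winv w) = weight w" by (simp add: weight_def)

lemma weight_less:
  assumes "length p = k" "length q = k" "2 * k \<le> length (q @ b)" "wval p < wval q"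
  shows "weight (p @ b) < weight (q @ b)"
proof -
  \<comment> \<open>Half the length, rounded up. The initial half of the inverse word lies entirely
    in the inverse of \<open>b\<close>, so exchanging the prefix changes only one summand of the
    weight.\<close>
  define h where "h = (length b + k + 1) div 2"
  have h: "k \<le> h" "h \<le> length b" using assms by (auto simp: h_def)
  have "half (p @ b) = p @ take (h - k) b" "half (q @ b) = q @ take (h - k) b"
    using assms h by (simp_all add: half_def h_def add.commute)
  moreover have "half (winv (p @ b)) = take h (winv b)" "half (winv (q @ b)) = take h (winv b)"
    using assms h by (simp_all add: half_def h_def add.commute)
  ultimately show ?thesis using assms by (simp add: weight_def wval_append)
qed

text \<open>The automorphism sending the letter \<open>z\<close> to \<open>y z\<close>. Allowing
  \<open>z\<close> to be an inverse letter covers multiplication of a generator on either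
  side.\<close>

definition transv :: "'a \<times> bool \<Rightarrow> 'a \<times> bool \<Rightarrow> 'a \<Rightarrow> 'a word" where
  "transv y z a = (if a = fst z then if snd z then [y, z] else [neg z, neg y] else [(a, True)])"

lemma transv_other: "a \<noteq> fst z \<Longrightarrow> transv y z a = [(a, True)]" by (simp add: transv_def)
lemma transv_same: "transv y z (fst z) = (if snd z then [y, z] else winv [y, z])"
  by (simp add: transv_def winv_def)

text \<open>A local minimum of length and then weight: no transvection improves it. The aim is that
  part of each image survives in every reduced product.\<close>

locale nielsen_reduced =
  fixes f :: "gen3 \<Rightarrow> gen3 word"
  assumes red: "reduced (f a)" and nonempty: "f a \<noteq> []"
    and minimal: "fst y \<noteq> fst z \<Longrightarrow>
      (length (reduce (letter_image f y @ letter_image f z)), weight (reduce (letter_image f y @ letter_image f z)))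
        \<notin> {(m, n). m < length (letter_image f z) \<or> m = length (letter_image f z) \<and> n < weight (letter_image f z)}"
begin

abbreviation "V \<equiv> letter_image f"
definition "cn y z = lcp (winv (V y)) (V z)"

lemma V_red [simp]: "reduced (V y)" by (simp add: letter_image_def red)
lemma V_nonempty [simp]: "V y \<noteq> []" by (simp add: letter_image_def nonempty)

lemma cn_sym: "cn (neg z) (neg y) = cn y z"
  by (simp add: cn_def letter_image_neg lcp_sym)

lemma V_mult: "reduce (V y @ V z) = take (length (V y) - cn y z) (V y) @ drop (cn y z) (V z)"
  using reduce_append_lcp[of "V y" "V z"] by (simp add: cn_def)

lemma cn_le: "cn y z \<le> length (V y)" "cn y z \<le> length (V z)"
  using lcp_le[of "winv (V y)" "V z"] by (simp_all add: cn_def)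

lemma length_V_mult: "length (reduce (V y @ V z)) = length (V y) + length (V z) - 2 * cn y z"
  using cn_le[of y z] by (simp add: V_mult)

lemma cn_self: "2 * cn y y < length (V y)"
  unfolding cn_def by (rule lcp_self) simp_all

text \<open>If more than half of \<open>V y\<close> cancelled, the product would be shorter than
  \<open>V z\<close>.\<close>

lemma cn_half_left: "y \<noteq> neg z \<Longrightarrow> 2 * cn y z \<le> length (V y)"
proof (cases "y = z")
  case False
  assume "y \<noteq> neg z"
  with False have "fst y \<noteq> fst z" by (auto simp: neg_def prod_eq_iff)
  from minimal[OF this] show ?thesis using cn_le[of y z] by (auto simp: length_V_mult)
next
  case True
  then show ?thesis using cn_self[of z] by simp
qed

lemma cn_half_right: "y \<noteq> neg z \<Longrightarrow> 2 * cn y z \<le> length (V z)"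
  using cn_half_left[of "neg z" "neg y"] by (auto simp: cn_sym letter_image_neg)

text \<open>If exactly half of \<open>V y\<close> cancels, the product is as long as
  \<open>V z\<close> and differs from it by having the first half of \<open>V y\<close> as prefix;
  minimality of the weight compares the prefixes.\<close>

lemma wval_le:
  assumes "fst y \<noteq> fst z" "length (V y) = 2 * cn y z"
  shows "wval (take (cn y z) (V z)) \<le> wval (take (cn y z) (V y))"
proof (rule ccontr)
  assume less: "\<not> ?thesis"
  have len: "2 * cn y z \<le> length (V z)" using assms by (intro cn_half_right) auto
  have prod: "reduce (V y @ V z) = take (cn y z) (V y) @ drop (cn y z) (V z)"
    using assms(2) by (simp add: V_mult)
  have "weight (take (cn y z) (V y) @ drop (cn y z) (V z)) < weight (take (cn y z) (V z) @ drop (cn y z) (V z))"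
    by (rule weight_less[of _ "cn y z"]) (use assms(2) len less in auto)
  with minimal[OF assms(1)] show False
    unfolding prod using assms(2) len by simp
qed

text \<open>Otherwise each neighbour cancels exactly half of \<open>V y\<close>. The weight
  inequality on both sides makes the first halves of \<open>V y\<close> and of its inverse equal, so
  \<open>V y\<close> is a word times its inverse and reduces to the empty word.\<close>

lemma middle_survives:
  assumes "x \<noteq> neg y" "y \<noteq> neg z"
  shows "cn x y + cn y z < length (V y)"
proof (rule ccontr)
  assume "\<not> ?thesis"
  with cn_half_right[OF assms(1)] cn_half_left[OF assms(2)]
  have eq: "length (V y) = 2 * cn x y" "length (V y) = 2 * cn y z" by linarith+
  have "x \<noteq> y" "y \<noteq> z" using cn_self[of y] eq by auto
  with assms have fst: "fst x \<noteq> fst y" "fst y \<noteq> fst z" by (auto simp: neg_def prod_eq_iff)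
  define k where "k = cn x y"
  have k: "cn x y = k" "cn y z = k" "length (V y) = 2 * k" using eq by (simp_all add: k_def)
  have z: "take k (V z) = take k (V (neg y))"
    using lcp_take[of "winv (V y)" "V z"] k by (simp add: cn_def letter_image_neg)
  have x: "take k (V (neg x)) = take k (V y)"
    using lcp_take[of "winv (V x)" "V y"] k by (simp add: cn_def letter_image_neg)
  have "wval (take k (V z)) \<le> wval (take k (V y))" using wval_le[OF fst(2)] k by simp
  moreover have "wval (take k (V (neg x))) \<le> wval (take k (V (neg y)))"
    using wval_le[of "neg y" "neg x"] fst k by (auto simp: cn_sym) (simp add: letter_image_neg)
  ultimately have "take k (V y) = take k (V (neg y))"
    using x z k by (intro wval_inj) (simp_all add: letter_image_neg)
  moreover have "take k (V (neg y)) = winv (drop k (V y))"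
    using k by (simp add: letter_image_neg winv_def rev_map take_map take_rev)
  ultimately have "drop k (V y) = winv (take k (V y))" by simp
  then have "V y = take k (V y) @ winv (take k (V y))" by (metis append_take_drop_id)
  then have "reduce (V y) = []"
    using reduce_cancel(2)[of "[]" "take k (V y)" "[]"] by (simp add: reduce_def)
  then show False by (simp add: reduce_reduced)
qed

definition "next_cn y ys = (case ys of [] \<Rightarrow> 0 | z # _ \<Rightarrow> cn y z)"

text \<open>Induction from the right. What the next letter leaves of the first image stays as a
  visible prefix, long enough to decide the next cancellation, and every further letter adds at
  least one to the length.\<close>

lemma sub_prefix:
  "reduced (y # ys) \<Longrightarrow> \<exists>r. sub f (y # ys) = take (length (V y) - next_cn y ys) (V y) @ r \<and>
             length ys + (length (V y) - next_cn y ys) \<le> length (sub f (y # ys))"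
proof (induction ys arbitrary: y)
  case Nil
  then show ?case by (simp add: sub_letter red next_cn_def)
next
  case (Cons z zs)
  define e' where "e' = next_cn z zs"
  define c where "c = cn y z"
  have rz: "reduced (z # zs)" and yz: "y \<noteq> neg z" using Cons.prems by (auto simp: reduced_Cons cancels_iff)
  from Cons.IH[OF rz] obtain r where r: "sub f (z # zs) = take (length (V z) - e') (V z) @ r"
    and len: "length zs + (length (V z) - e') \<le> length (sub f (z # zs))" unfolding e'_def by blast
  \<comment> \<open>For the last letter only the left neighbour cancels, at most half; otherwise
    \<open>middle_survives\<close> applies.\<close>
  have c: "c + e' < length (V z)"
  proof (cases zs)
    case Nil
    then show ?thesis using cn_half_right[OF yz] V_nonempty[of z] unfolding c_def e'_def next_cn_def
      by (cases "V z") auto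
  next
    case (Cons z' _)
    then show ?thesis using middle_survives[OF yz, of z'] rz unfolding c_def e'_def next_cn_def
      by (auto simp: reduced_Cons cancels_iff)
  qed
  have lcp: "lcp (winv (V y)) (sub f (z # zs)) = c"
    unfolding r c_def cn_def by (rule lcp_take_append) (use c in \<open>auto simp: c_def cn_def\<close>)
  have "sub f (y # z # zs) = take (length (V y) - c) (V y) @ drop c (sub f (z # zs))"
    using reduce_append_lcp[of "V y" "sub f (z # zs)"] lcp by (simp add: sub_Cons[of _ y])
  moreover have "c \<le> length (V y)" by (simp add: c_def cn_le)
  ultimately show ?case using len c by (auto simp: c_def[symmetric] next_cn_def)
qed

lemma letter_if_sub_eq_letter:
  assumes "reduced w" "sub f w = [l]"
  shows "\<exists>y. w = [y]"
proof (cases w)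
  case (Cons y ys)
  define e where "e = next_cn y ys"
  have "e < length (V y)"
  proof (cases ys)
    case (Cons z zs)
    then have "y \<noteq> neg z" using assms(1) \<open>w = y # ys\<close> by (auto simp: reduced_Cons cancels_iff)
    from cn_half_left[OF this] show ?thesis using Cons V_nonempty[of y]
      by (cases "V y") (auto simp: e_def next_cn_def)
  qed (simp add: e_def next_cn_def)
  moreover have "length ys + (length (V y) - e) \<le> 1"
    using sub_prefix[of y ys] assms Cons unfolding e_def by auto
  ultimately show ?thesis using Cons by (cases ys) auto
qed (use assms in simp)

end

section \<open>Endomorphisms of F3 as triples of words, computable by
  \<open>code_simp\<close>\<close>

type_synonym triple = "gen3 word \<times> gen3 word \<times> gen3 word"

definition tfun :: "triple \<Rightarrow> gen3 \<Rightarrow> gen3 word" where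
  "tfun T = case_gen3 (fst T) (fst (snd T)) (snd (snd T))"
definition tcomp :: "triple \<Rightarrow> triple \<Rightarrow> triple" where
  "tcomp S T = (sub (tfun S) (fst T), sub (tfun S) (fst (snd T)), sub (tfun S) (snd (snd T)))"
definition treduced :: "triple \<Rightarrow> bool" where
  "treduced T \<longleftrightarrow> reduced (fst T) \<and> reduced (fst (snd T)) \<and> reduced (snd (snd T))"

definition tI :: triple where "tI = ([lA], [lB], [lC])"
definition tX :: triple where "tX = ([lA], [lA, lB], [lC])"
definition tT :: triple where "tT = ([lB], [lA], [lC])"
definition tU :: triple where "tU = ([lA], [lC], [lB])"
definition tS :: triple where "tS = ([lA'], [lB], [lC])"

lemma tfun_simps [simp]:
  "tfun T gA = fst T" "tfun T gB = fst (snd T)" "tfun T gC = snd (snd T)"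
  by (simp_all add: tfun_def)

lemma triple_eqI: "(\<And>a. tfun S a = tfun T a) \<Longrightarrow> S = T"
  by (metis prod_eqI tfun_simps)

lemma tfun_tcomp: "tfun (tcomp S T) a = sub (tfun S) (tfun T a)"
  by (cases a) (simp_all add: tcomp_def)

lemma tfun_tI: "tfun tI = (\<lambda>a. [(a, True)])"
proof
  show "tfun tI a = [(a, True)]" for a by (cases a) (simp_all add: tI_def)
qed

lemma treduced_iff: "treduced T \<longleftrightarrow> (\<forall>a. reduced (tfun T a))"
  unfolding treduced_def by (metis gen3.exhaust tfun_simps)

lemma treduced_tcomp [simp]: "treduced (tcomp S T)"
  by (simp add: treduced_def tcomp_def)

lemma tcomp_tI: "treduced T \<Longrightarrow> tcomp tI T = T" "treduced T \<Longrightarrow> tcomp T tI = T"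
  by (rule triple_eqI, simp add: tfun_tcomp tfun_tI sub_id sub_letter treduced_iff letter_image_def)+

lemma sub_tcomp: "sub (tfun (tcomp S T)) w = sub (tfun S) (sub (tfun T) w)"
  unfolding sub_sub[symmetric] tfun_tcomp ..

lemma tcomp_assoc: "tcomp (tcomp R S) T = tcomp R (tcomp S T)"
  by (rule triple_eqI) (simp add: tfun_tcomp sub_tcomp)

text \<open>Left composition with generators and no inverses, which is the induction principle
  \<open>gen\<close> of \<open>gl3_relations\<close>. Inverses are recovered in
  \<open>nielsen_inverse\<close>.\<close>

inductive nielsen :: "triple \<Rightarrow> bool" where
  base: "nielsen tI"
| step: "nielsen T \<Longrightarrow> G \<in> {tX, tT, tU, tS} \<Longrightarrow> nielsen (tcomp G T)"

lemma treduced_gens: "treduced tI" "treduced tX" "treduced tT" "treduced tU" "treduced tS"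
  by (simp_all add: treduced_def tI_def tX_def tT_def tU_def tS_def reduced_def cancels_def)

lemma nielsen_tcomp: "nielsen S \<Longrightarrow> nielsen T \<Longrightarrow> nielsen (tcomp S T)"
proof (induction rule: nielsen.induct)
  case base
  then have "treduced T" by cases (simp_all add: treduced_gens)
  then show ?case using base by (simp add: tcomp_tI)
next
  case (step S G)
  show ?case unfolding tcomp_assoc
    by (rule nielsen.step[OF step.IH[OF step.prems] step.hyps(2)])
qed

lemma nielsen_foldr: "set Gs \<subseteq> {tX, tT, tU, tS} \<Longrightarrow> nielsen (foldr tcomp Gs tI)"
  by (induction Gs) (auto intro: nielsen.intros)

definition letters :: "(gen3 \<times> bool) list" where
  "letters = [lA, lA', lB, lB', lC, lC']"

lemma in_letters: "x \<in> set letters"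
  by (cases x; cases "fst x"; cases "snd x") (auto simp: letters_def)

definition ttransv :: "gen3 \<times> bool \<Rightarrow> gen3 \<times> bool \<Rightarrow> triple" where
  "ttransv y z = (transv y z gA, transv y z gB, transv y z gC)"

lemma tfun_ttransv: "tfun (ttransv y z) = transv y z"
proof
  show "tfun (ttransv y z) a = transv y z a" for a by (cases a) (simp_all add: ttransv_def)
qed

definition perm_words :: "triple list list" where
  "perm_words = [[], [tT], [tU], [tU, tT], [tT, tU], [tT, tU, tT]]"
definition sign_words :: "triple list list" where
  "sign_words = [a @ b @ c. a \<leftarrow> [[], [tS]], b \<leftarrow> [[], [tT, tS, tT]], c \<leftarrow> [[], [tU, tT, tS, tT, tU]]]"

text \<open>Every transvection is conjugate to \<open>tX\<close> by a signed permutation. The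
  letters of \<open>p\<close> and \<open>d\<close> are involutions, so reversing a word inverts
  it.\<close>

lemma letters_check:
  "\<forall>y\<in>set letters. \<forall>z\<in>set letters. fst y \<noteq> fst z \<longrightarrow>
     tcomp (ttransv y z) (ttransv (neg y) z) = tI \<and>
     (\<exists>p\<in>set perm_words. \<exists>d\<in>set sign_words. ttransv y z = foldr tcomp (p @ d @ [tX] @ rev d @ rev p) tI)"
  by code_simp

lemma signed_perm_check:
  "\<forall>x\<in>set letters. \<forall>y\<in>set letters. \<forall>z\<in>set letters. fst x \<noteq> fst y \<and> fst x \<noteq> fst z \<and> fst y \<noteq> fst z \<longrightarrow>
     (\<exists>p\<in>set perm_words. \<exists>d\<in>set sign_words. ([x], [y], [z]) = foldr tcomp (p @ d) tI)"
  by code_simp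

lemma nielsen_ttransv:
  assumes "fst y \<noteq> fst z"
  shows "nielsen (ttransv y z)"
proof -
  have p: "set p \<subseteq> {tX, tT, tU, tS}" if "p \<in> set perm_words" for p
    using that by (auto simp: perm_words_def)
  have d: "set d \<subseteq> {tX, tT, tU, tS}" if "d \<in> set sign_words" for d
    using that by (auto simp: sign_words_def)
  obtain p d where pd: "p \<in> set perm_words" "d \<in> set sign_words"
    and eq: "ttransv y z = foldr tcomp (p @ d @ [tX] @ rev d @ rev p) tI"
    using letters_check in_letters assms by blast
  show ?thesis unfolding eq by (rule nielsen_foldr) (use p[OF pd(1)] d[OF pd(2)] in simp)
qed

lemma ttransv_inverse: "fst y \<noteq> fst z \<Longrightarrow> tcomp (ttransv y z) (ttransv (neg y) z) = tI"
  using letters_check in_letters by blast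

lemma treduced_nielsen: "nielsen T \<Longrightarrow> treduced T"
  by (induction rule: nielsen.induct) (auto simp: treduced_gens)

text \<open>By counting: all six one-letter words are images of letters and there are only six
  letters, so letters are permuted, compatibly with inversion.\<close>

lemma nielsen_signed_perm:
  assumes "\<And>l. \<exists>y. letter_image (tfun T) y = [l]"
  shows "nielsen T"
proof -
  define V where "V = letter_image (tfun T)"
  have sub: "range (\<lambda>l. [l]) \<subseteq> range V" using assms unfolding V_def by (metis image_subset_iff rangeI)
  have "card (range V) \<le> card (UNIV :: (gen3 \<times> bool) set)" by (rule card_image_le) simp
  also have "\<dots> = card (range (\<lambda>l :: gen3 \<times> bool. [l]))" by (rule card_image[symmetric]) (simp add: inj_on_def)
  finally have "range V = range (\<lambda>l. [l])" using sub by (metis card_seteq finite finite_imageI)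
  then have "\<exists>l. V y = [l]" for y by blast
  then obtain \<sigma> where \<sigma>: "V y = [\<sigma> y]" for y by metis
  have "tfun T a = V (a, True)" for a by (simp add: V_def letter_image_def)
  then have T: "T = ([\<sigma> lA], [\<sigma> lB], [\<sigma> lC])"
    by (intro triple_eqI) (metis \<sigma> tfun_simps fst_conv snd_conv gen3.exhaust)
  have neg: "fst (\<sigma> (a, e)) = fst (\<sigma> (a, True))" for a e
  proof -
    have "V (neg (a, True)) = [neg (\<sigma> (a, True))]"
      by (simp add: V_def letter_image_neg \<sigma>[unfolded V_def] winv_def)
    then have "\<sigma> (a, False) = neg (\<sigma> (a, True))" using \<sigma>[of "(a, False)"] by (simp add: neg_def)
    then show ?thesis by (cases e) simp_all
  qed
  have cover: "g \<in> {fst (\<sigma> lA), fst (\<sigma> lB), fst (\<sigma> lC)}" for g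
  proof -
    obtain y where "V y = [(g, True)]" using assms unfolding V_def by blast
    then have "fst (\<sigma> y) = g" using \<sigma>[of y] by simp
    moreover obtain a e where "y = (a, e)" by fastforce
    ultimately show ?thesis using neg[of a e] by (cases a) auto
  qed
  have "fst (\<sigma> lA) \<noteq> fst (\<sigma> lB) \<and> fst (\<sigma> lA) \<noteq> fst (\<sigma> lC) \<and> fst (\<sigma> lB) \<noteq> fst (\<sigma> lC)"
    using cover[of gA] cover[of gB] cover[of gC] by force
  then obtain p d where "p \<in> set perm_words" "d \<in> set sign_words" "T = foldr tcomp (p @ d) tI"
    using signed_perm_check in_letters unfolding T by blast
  moreover from this have "set (p @ d) \<subseteq> {tX, tT, tU, tS}"
    by (auto simp: perm_words_def sign_words_def)
  ultimately show ?thesis using nielsen_foldr by blast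
qed

lemma sum_gen3_less:
  fixes h h' :: "gen3 \<Rightarrow> nat"
  assumes "\<And>a. a \<noteq> b \<Longrightarrow> h' a = h a"
  shows "h' b = h b \<Longrightarrow> h' gA + h' gB + h' gC = h gA + h gB + h gC"
    and "h' b < h b \<Longrightarrow> h' gA + h' gB + h' gC < h gA + h gB + h gC"
  using assms[of gA] assms[of gB] assms[of gC] by (cases b; simp)+

section \<open>Descent by total length and weight\<close>

definition tlength :: "triple \<Rightarrow> nat" where
  "tlength T = length (tfun T gA) + length (tfun T gB) + length (tfun T gC)"
definition tweight :: "triple \<Rightarrow> nat" where
  "tweight T = weight (tfun T gA) + weight (tfun T gB) + weight (tfun T gC)"

lemma tfun_tcomp_ttransv:
  assumes "treduced T"
  shows "a \<noteq> fst z \<Longrightarrow> tfun (tcomp T (ttransv y z)) a = tfun T a"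
    and "tfun (tcomp T (ttransv y z)) (fst z) =
      (let w = reduce (letter_image (tfun T) y @ letter_image (tfun T) z) in if snd z then w else winv w)"
proof -
  have red: "reduced (tfun T a)" for a using assms by (simp add: treduced_iff)
  show "a \<noteq> fst z \<Longrightarrow> tfun (tcomp T (ttransv y z)) a = tfun T a"
    using red by (simp add: tfun_tcomp tfun_ttransv transv_other sub_letter letter_image_def)
  have "sub (tfun T) [y, z] = reduce (letter_image (tfun T) y @ letter_image (tfun T) z)"
    by (simp add: sub_def)
  then show "tfun (tcomp T (ttransv y z)) (fst z) =
      (let w = reduce (letter_image (tfun T) y @ letter_image (tfun T) z) in if snd z then w else winv w)"
    by (simp add: tfun_tcomp tfun_ttransv transv_same sub_winv Let_def)
qed

lemma tmeasure_ttransv: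
  fixes T y z
  defines "w \<equiv> reduce (letter_image (tfun T) y @ letter_image (tfun T) z)"
  assumes "treduced T"
    and "length w < length (letter_image (tfun T) z) \<or>
      length w = length (letter_image (tfun T) z) \<and> weight w < weight (letter_image (tfun T) z)"
  shows "(tcomp T (ttransv y z), T) \<in> measures [tlength, tweight]"
proof -
  let ?T = "tcomp T (ttransv y z)"
  have eq: "\<And>a. a \<noteq> fst z \<Longrightarrow> length (tfun ?T a) = length (tfun T a)"
    "\<And>a. a \<noteq> fst z \<Longrightarrow> weight (tfun ?T a) = weight (tfun T a)"
    using tfun_tcomp_ttransv(1)[OF assms(2)] by simp_all
  have z: "length (tfun ?T (fst z)) = length w" "weight (tfun ?T (fst z)) = weight w"
    using tfun_tcomp_ttransv(2)[OF assms(2)] by (simp_all add: Let_def w_def)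
  have V: "length (letter_image (tfun T) z) = length (tfun T (fst z))"
    "weight (letter_image (tfun T) z) = weight (tfun T (fst z))" by (simp_all add: letter_image_def)
  note l = sum_gen3_less[of "fst z" "\<lambda>a. length (tfun ?T a)" "\<lambda>a. length (tfun T a)", OF eq(1)]
  note w = sum_gen3_less(2)[of "fst z" "\<lambda>a. weight (tfun ?T a)" "\<lambda>a. weight (tfun T a)", OF eq(2)]
  show ?thesis
    using assms(3) l w unfolding V z measures_def tlength_def tweight_def by auto
qed

text \<open>A transvection that lowers the measure is composed on the right and later undone. At a
  local minimum only single letters can map to single letters, so the triple is a signed
  permutation.\<close>

theorem nielsen_if_automorphism:
  assumes "treduced T" "\<And>w. reduced w \<Longrightarrow> sub (tfun T) w = [] \<Longrightarrow> w = []"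
    "\<And>l. \<exists>w. reduced w \<and> sub (tfun T) w = [l]"
  shows "nielsen T"
  using assms
proof (induction T rule: wf_induct_rule[OF wf_measures[of "[tlength, tweight]"]])
  case (1 T)
  show ?case
  proof (cases "\<exists>y z. fst y \<noteq> fst z \<and> (tcomp T (ttransv y z), T) \<in> measures [tlength, tweight]")
    case True
    then obtain y z where yz: "fst y \<noteq> fst z" and less: "(tcomp T (ttransv y z), T) \<in> measures [tlength, tweight]"
      by blast
    let ?e = "ttransv y z" and ?e' = "ttransv (neg y) z"
    have inv: "tcomp ?e ?e' = tI" "tcomp ?e' ?e = tI"
      using ttransv_inverse[of y z] ttransv_inverse[of "neg y" z] yz by simp_all
    have id: "sub (tfun tI) w = w" if "reduced w" for w using that by (simp add: tfun_tI sub_id)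
    have "nielsen (tcomp T ?e)"
    proof (rule 1(1)[OF less])
      fix w assume w: "reduced w" "sub (tfun (tcomp T ?e)) w = []"
      then have "sub (tfun ?e) w = []" using 1(3) by (simp add: sub_tcomp)
      then have "sub (tfun (tcomp ?e' ?e)) w = []" by (simp add: sub_tcomp)
      then show "w = []" using id[OF w(1)] inv by simp
    next
      fix l
      obtain w where w: "reduced w" "sub (tfun T) w = [l]" using 1(4) by blast
      then have "sub (tfun (tcomp T ?e)) (sub (tfun ?e') w) = [l]"
        using id[OF w(1)] inv by (simp add: sub_tcomp flip: sub_tcomp[of ?e ?e'])
      then show "\<exists>w. reduced w \<and> sub (tfun (tcomp T ?e)) w = [l]" using reduced_sub by blast
    qed simp
    moreover have "nielsen ?e'" by (rule nielsen_ttransv) (use yz in simp)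
    ultimately have "nielsen (tcomp (tcomp T ?e) ?e')" by (rule nielsen_tcomp)
    then show ?thesis unfolding tcomp_assoc inv using 1(2) by (simp add: tcomp_tI)
  next
    case False
    interpret nielsen_reduced "tfun T"
    proof
      fix a y z
      show red: "reduced (tfun T a)" for a using 1(2) by (simp add: treduced_iff)
      have "sub (tfun T) [(a, True)] \<noteq> []" using 1(3)[of "[(a, True)]"] by auto
      then show "tfun T a \<noteq> []" using red by (simp add: sub_letter letter_image_def)
      show "fst y \<noteq> fst z \<Longrightarrow> (length (reduce (letter_image (tfun T) y @ letter_image (tfun T) z)),
          weight (reduce (letter_image (tfun T) y @ letter_image (tfun T) z)))
        \<notin> {(m, n). m < length (letter_image (tfun T) z) \<or> m = length (letter_image (tfun T) z) \<and> n < weight (letter_image (tfun T) z)}"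
        using tmeasure_ttransv[OF 1(2), of y z] False by blast
    qed
    have "\<exists>y. letter_image (tfun T) y = [l]" for l
      using 1(4)[of l] letter_if_sub_eq_letter[of _ l] sub_letter[of "tfun T"] red by metis
    then show ?thesis by (rule nielsen_signed_perm)
  qed
qed

section \<open>Automorphisms as triples of words\<close>

interpretation F3: group F3 by (rule group_free_group)

abbreviation "AutF3 \<equiv> AutoGroup F3"

interpretation AutF3: group AutF3 by (rule F3.AutoGroup)

lemma carrier_free_group: "w \<in> carrier free_group \<longleftrightarrow> reduced w"
  by (simp add: free_group_def)

lemma mult_free_group: "u \<otimes>\<^bsub>free_group\<^esub> v = reduce (u @ v)"
  by (simp add: free_group_def)

lemma one_free_group: "\<one>\<^bsub>free_group\<^esub> = []"
  by (simp add: free_group_def)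

lemma inv_free_group: "reduced w \<Longrightarrow> inv\<^bsub>free_group\<^esub> w = winv w"
  by (rule group.inv_equality[OF group_free_group])
     (simp_all add: carrier_free_group mult_free_group one_free_group reduce_winv_append)

lemma free_extension_apply:
  assumes "\<And>a. reduced (f a)" "reduced w"
  shows "free_extension free_group f w = sub f w"
proof -
  have "foldr (\<lambda>(a, e) y. (if e then f a else inv\<^bsub>free_group\<^esub> (f a)) \<otimes>\<^bsub>free_group\<^esub> y) w \<one>\<^bsub>free_group\<^esub> = sub f w"
    by (induction w) (auto simp: one_free_group mult_free_group inv_free_group sub_Cons letter_image_def assms(1))
  then show ?thesis using assms(2) by (simp add: free_extension_def carrier_free_group)
qed

definition aut :: "triple \<Rightarrow> gen3 word \<Rightarrow> gen3 word" where
  "aut T = free_extension F3 (tfun T)"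

lemma aut_apply: "treduced T \<Longrightarrow> reduced w \<Longrightarrow> aut T w = sub (tfun T) w"
  unfolding aut_def by (rule free_extension_apply) (simp_all add: treduced_iff)

lemma aut_extensional: "aut T \<in> extensional (carrier F3)"
  by (simp add: aut_def free_extension_def)

lemma aut_hom: "treduced T \<Longrightarrow> aut T \<in> hom F3 F3"
  by (auto simp: hom_def carrier_free_group mult_free_group aut_apply sub_mult reduced_reduce)

lemma compose_aut:
  assumes "treduced S" "treduced T"
  shows "compose (carrier F3) (aut S) (aut T) = aut (tcomp S T)"
proof (rule extensionalityI[of _ "carrier F3"])
  show "compose (carrier F3) (aut S) (aut T) w = aut (tcomp S T) w" if "w \<in> carrier F3" for w
    using that assms by (simp add: compose_def carrier_free_group aut_apply sub_tcomp)
qed (simp_all add: compose_extensional aut_extensional)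

lemma aut_tI: "aut tI = (\<lambda>w\<in>carrier F3. w)"
  by (rule extensionalityI[of _ "carrier F3"])
     (auto simp: aut_extensional carrier_free_group aut_apply treduced_gens tfun_tI sub_id)

lemma aut_in_auto:
  assumes "treduced S" "treduced T" "tcomp S T = tI" "tcomp T S = tI"
  shows "aut T \<in> auto F3"
proof -
  have id: "sub (tfun S) (sub (tfun T) w) = w" "sub (tfun T) (sub (tfun S) w) = w" if "reduced w" for w
    using that assms(3,4) by (simp_all add: tfun_tI sub_id flip: sub_tcomp)
  have "bij_betw (aut T) (carrier F3) (carrier F3)"
    by (rule bij_betw_byWitness[where f' = "aut S"])
       (use assms id in \<open>auto simp: carrier_free_group aut_apply\<close>)
  then show ?thesis by (simp add: auto_def Bij_def aut_hom assms aut_extensional)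
qed

lemma carrier_AutF3: "carrier AutF3 = auto F3" by (simp add: AutoGroup_def)

lemma mult_AutF3: "\<phi> \<in> auto F3 \<Longrightarrow> \<psi> \<in> auto F3 \<Longrightarrow> \<phi> \<otimes>\<^bsub>AutF3\<^esub> \<psi> = compose (carrier F3) \<phi> \<psi>"
  by (simp add: AutoGroup_def BijGroup_def auto_def)

lemma one_AutF3: "\<one>\<^bsub>AutF3\<^esub> = aut tI"
  by (simp add: AutoGroup_def BijGroup_def aut_tI)

lemma gens_in_auto: "G \<in> {tX, tT, tU, tS} \<Longrightarrow> aut G \<in> auto F3"
proof -
  have "tcomp tX ([lA], [lA', lB], [lC]) = tI" "tcomp ([lA], [lA', lB], [lC]) tX = tI"
    "tcomp tT tT = tI" "tcomp tU tU = tI" "tcomp tS tS = tI" "treduced ([lA], [lA', lB], [lC])"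
    by code_simp+
  then show "G \<in> {tX, tT, tU, tS} \<Longrightarrow> aut G \<in> auto F3"
    by (auto intro: aut_in_auto treduced_gens)
qed

lemma aut_mult: "aut S \<in> auto F3 \<Longrightarrow> aut T \<in> auto F3 \<Longrightarrow> treduced S \<Longrightarrow> treduced T \<Longrightarrow>
    aut S \<otimes>\<^bsub>AutF3\<^esub> aut T = aut (tcomp S T)"
  by (simp add: mult_AutF3 compose_aut)

lemma nielsen_in_auto: "nielsen T \<Longrightarrow> aut T \<in> auto F3"
proof (induction rule: nielsen.induct)
  case base
  then show ?case using AutF3.one_closed by (simp add: carrier_AutF3 one_AutF3)
next
  case (step T G)
  have "treduced G" "treduced T" using step treduced_gens treduced_nielsen by auto
  then show ?case
    using AutF3.m_closed[of "aut G" "aut T"] step gens_in_auto by (simp add: carrier_AutF3 aut_mult)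
qed

text \<open>Bijectivity supplies the trivial kernel and the preimages of letters on which the
  descent rests.\<close>

lemma auto_eq_aut:
  assumes "\<phi> \<in> auto F3"
  obtains T where "nielsen T" "\<phi> = aut T"
proof -
  define T where "T = (\<phi> [lA], \<phi> [lB], \<phi> [lC])"
  have hom: "\<phi> \<in> hom F3 F3" and bij: "bij_betw \<phi> (carrier F3) (carrier F3)"
    and ext: "\<phi> \<in> extensional (carrier F3)" using assms by (auto simp: auto_def Bij_def)
  interpret h: group_hom F3 F3 \<phi> by unfold_locales (rule hom)
  have red: "reduced (\<phi> w)" if "reduced w" for w using h.hom_closed[of w] that by (simp add: carrier_free_group)
  have T: "treduced T" by (simp add: T_def treduced_def red)
  have gen: "\<phi> [(a, True)] = tfun T a" for a by (cases a) (simp_all add: T_def)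
  have letter: "\<phi> [x] = letter_image (tfun T) x" for x
  proof (cases "snd x")
    case True
    then show ?thesis using gen[of "fst x"] by (cases x) (simp add: letter_image_def)
  next
    case False
    then have x: "[x] = inv\<^bsub>F3\<^esub> [(fst x, True)]"
      by (cases x) (simp add: inv_free_group winv_def neg_def)
    show ?thesis unfolding x h.hom_inv[unfolded carrier_free_group, OF reduced_single] gen
      using False T by (simp add: inv_free_group treduced_iff letter_image_def)
  qed
  have sub: "\<phi> w = sub (tfun T) w" if "reduced w" for w
    using that
  proof (induction w)
    case Nil
    then show ?case using h.hom_one by (simp add: one_free_group)
  next
    case (Cons x w)
    then have "\<phi> (x # w) = \<phi> ([x] \<otimes>\<^bsub>F3\<^esub> w)" by (simp add: mult_free_group reduce_reduced)
    also have "\<dots> = \<phi> [x] \<otimes>\<^bsub>F3\<^esub> \<phi> w"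
      using Cons by (intro h.hom_mult) (simp_all add: carrier_free_group reduced_Cons)
    finally show ?case using Cons by (simp add: letter mult_free_group sub_Cons reduced_Cons)
  qed
  have eq: "\<phi> = aut T"
    by (rule extensionalityI[OF ext aut_extensional]) (simp add: carrier_free_group sub aut_apply T)
  have "nielsen T"
  proof (rule nielsen_if_automorphism[OF T])
    show "w = []" if "reduced w" "sub (tfun T) w = []" for w
      using bij_betw_imp_inj_on[OF bij] that sub[of w] sub[of "[]"]
      by (auto simp: inj_on_def carrier_free_group)
    show "\<exists>w. reduced w \<and> sub (tfun T) w = [l]" for l
    proof -
      have "[l] \<in> \<phi> ` carrier F3" using bij_betw_imp_surj_on[OF bij] by (simp add: carrier_free_group)
      then show ?thesis using sub by (auto simp: carrier_free_group)
    qed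
  qed
  from this eq show thesis by (rule that)
qed

lemma aut_tcomp: "nielsen S \<Longrightarrow> nielsen T \<Longrightarrow> aut (tcomp S T) = aut S \<otimes>\<^bsub>AutF3\<^esub> aut T"
  by (simp add: aut_mult nielsen_in_auto treduced_nielsen)

lemma aut_inject: "treduced S \<Longrightarrow> treduced T \<Longrightarrow> aut S = aut T \<Longrightarrow> S = T"
  by (rule triple_eqI) (metis aut_apply reduced_single sub_letter treduced_iff letter_image_def fst_conv snd_conv)

lemma nielsen_iff: "treduced T \<Longrightarrow> nielsen T \<longleftrightarrow> aut T \<in> auto F3"
  by (metis auto_eq_aut aut_inject nielsen_in_auto treduced_nielsen)

section \<open>Inner automorphisms\<close>

definition tconj :: "gen3 word \<Rightarrow> triple \<Rightarrow> triple" where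
  "tconj g T = (reduce (g @ fst T @ winv g), reduce (g @ fst (snd T) @ winv g), reduce (g @ snd (snd T) @ winv g))"

definition inn_aut :: "gen3 word \<Rightarrow> gen3 word \<Rightarrow> gen3 word" where
  "inn_aut g = (\<lambda>w\<in>carrier F3. g \<otimes>\<^bsub>F3\<^esub> w \<otimes>\<^bsub>F3\<^esub> inv\<^bsub>F3\<^esub> g)"

lemma Inn_F3: "Inn F3 = inn_aut ` carrier F3" by (simp add: Inn_def inn_aut_def)

lemma inn_aut_apply: "reduced g \<Longrightarrow> reduced w \<Longrightarrow> inn_aut g w = reduce (g @ w @ winv g)"
  by (simp add: inn_aut_def carrier_free_group mult_free_group inv_free_group reduce_reduce_append)

lemma inn_aut_in_auto: "reduced g \<Longrightarrow> inn_aut g \<in> auto F3"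
  using Inn_subset_auto[OF group_free_group] by (auto simp: Inn_F3 carrier_free_group)

lemma inn_aut_mult:
  assumes "reduced g" "reduced h"
  shows "inn_aut g \<otimes>\<^bsub>AutF3\<^esub> inn_aut h = inn_aut (reduce (g @ h))"
proof -
  have "compose (carrier F3) (inn_aut g) (inn_aut h) = inn_aut (reduce (g @ h))"
  proof (rule extensionalityI[of _ "carrier F3"])
    fix w assume "w \<in> carrier F3"
    then have w: "reduced w" by (simp add: carrier_free_group)
    have "reduce (g @ reduce (h @ w @ winv h) @ winv g) = reduce (g @ h @ w @ winv h @ winv g)"
      by (metis append_assoc reduce_append_reduce reduce_reduce_append)
    moreover have "reduce (reduce (g @ h) @ w @ winv (reduce (g @ h))) = reduce (g @ h @ w @ winv h @ winv g)"
      by (metis append_assoc reduce_append_reduce reduce_reduce_append inverse_reduce winv_append)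
    ultimately show "compose (carrier F3) (inn_aut g) (inn_aut h) w = inn_aut (reduce (g @ h)) w"
      using assms w by (simp add: compose_def carrier_free_group inn_aut_apply reduced_reduce)
  qed (simp_all add: compose_extensional inn_aut_def)
  then show ?thesis using assms by (simp add: mult_AutF3 inn_aut_in_auto)
qed

lemma inn_aut_Nil: "inn_aut [] = aut tI"
  unfolding aut_tI by (rule extensionalityI[of _ "carrier F3"])
    (simp_all add: inn_aut_def carrier_free_group mult_free_group inv_free_group reduce_reduced)

lemma inn_aut_conj:
  assumes "\<phi> \<in> auto F3" "reduced g"
  shows "\<phi> \<otimes>\<^bsub>AutF3\<^esub> inn_aut g = inn_aut (\<phi> g) \<otimes>\<^bsub>AutF3\<^esub> \<phi>"
proof -
  interpret h: group_hom F3 F3 \<phi> using assms by unfold_locales (simp add: auto_def)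
  have red: "reduced (\<phi> w)" if "reduced w" for w using h.hom_closed[of w] that by (simp add: carrier_free_group)
  have g: "g \<in> carrier F3" using assms by (simp add: carrier_free_group)
  have "compose (carrier F3) \<phi> (inn_aut g) = compose (carrier F3) (inn_aut (\<phi> g)) \<phi>"
    unfolding compose_def by (rule restrict_ext) (use g in \<open>simp add: inn_aut_def\<close>)
  then show ?thesis using assms red by (simp add: mult_AutF3 inn_aut_in_auto)
qed

interpretation Inn_normal: normal "Inn F3" AutF3
proof (rule AutF3.normal_invI)
  show "subgroup (Inn F3) AutF3"
  proof
    show "Inn F3 \<subseteq> carrier AutF3" using Inn_subset_auto[OF group_free_group] by (simp add: carrier_AutF3)
    show "\<one>\<^bsub>AutF3\<^esub> \<in> Inn F3" unfolding one_AutF3 inn_aut_Nil[symmetric] Inn_F3 by (simp add: carrier_free_group)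
    show "x \<otimes>\<^bsub>AutF3\<^esub> y \<in> Inn F3" if "x \<in> Inn F3" "y \<in> Inn F3" for x y
      using that by (auto simp: Inn_F3 carrier_free_group inn_aut_mult reduced_reduce)
    show "inv\<^bsub>AutF3\<^esub> x \<in> Inn F3" if x: "x \<in> Inn F3" for x
    proof -
      obtain g where g: "reduced g" "x = inn_aut g" using x by (auto simp: Inn_F3 carrier_free_group)
      have "inn_aut (winv g) \<otimes>\<^bsub>AutF3\<^esub> inn_aut g = \<one>\<^bsub>AutF3\<^esub>"
        using g by (simp add: inn_aut_mult reduce_winv_append inn_aut_Nil one_AutF3)
      then have "inv\<^bsub>AutF3\<^esub> x = inn_aut (winv g)"
        using g by (intro AutF3.inv_equality) (simp_all add: carrier_AutF3 inn_aut_in_auto)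
      then show ?thesis using g by (simp add: Inn_F3 carrier_free_group)
    qed
  qed
next
  fix \<phi> \<iota> assume \<phi>: "\<phi> \<in> carrier AutF3" and "\<iota> \<in> Inn F3"
  then obtain g where g: "reduced g" "\<iota> = inn_aut g" by (auto simp: Inn_F3 carrier_free_group)
  have "reduced (\<phi> g)" using \<phi> g by (auto simp: carrier_AutF3 auto_def hom_def carrier_free_group)
  moreover from this have "\<phi> \<otimes>\<^bsub>AutF3\<^esub> \<iota> \<otimes>\<^bsub>AutF3\<^esub> inv\<^bsub>AutF3\<^esub> \<phi> = inn_aut (\<phi> g)"
    using \<phi> g by (simp add: inn_aut_conj carrier_AutF3 inn_aut_in_auto AutF3.m_assoc AutF3.inv_closed[unfolded carrier_AutF3]
        AutF3.r_inv[unfolded carrier_AutF3] AutF3.r_one[unfolded carrier_AutF3] AutF3.m_assoc[unfolded carrier_AutF3])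
  ultimately show "\<phi> \<otimes>\<^bsub>AutF3\<^esub> \<iota> \<otimes>\<^bsub>AutF3\<^esub> inv\<^bsub>AutF3\<^esub> \<phi> \<in> Inn F3" by (simp add: Inn_F3 carrier_free_group)
qed

interpretation OutF3: group "Out F3"
  unfolding Out_def by (rule Inn_normal.factorgroup_is_group)

definition out_of :: "triple \<Rightarrow> (gen3 word \<Rightarrow> gen3 word) set" where
  "out_of T = outer_class F3 (aut T)"

lemma out_of_carrier: "nielsen T \<Longrightarrow> out_of T \<in> carrier (Out F3)"
  using hom_in_carrier[OF Inn_normal.r_coset_hom_Mod, of "aut T"] nielsen_in_auto[of T]
  by (simp add: out_of_def outer_class_def Out_def carrier_AutF3)

lemma out_of_tcomp: "nielsen S \<Longrightarrow> nielsen T \<Longrightarrow> out_of (tcomp S T) = out_of S \<otimes>\<^bsub>Out F3\<^esub> out_of T"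
  using hom_mult[OF Inn_normal.r_coset_hom_Mod, of "aut S" "aut T"] nielsen_in_auto[of S] nielsen_in_auto[of T]
  by (simp add: out_of_def outer_class_def Out_def carrier_AutF3 aut_tcomp)

lemma out_of_tI: "out_of tI = \<one>\<^bsub>Out F3\<^esub>"
  using AutF3.coset_join2[OF AutF3.one_closed Inn_normal.is_subgroup Inn_normal.one_closed]
  by (simp add: out_of_def outer_class_def Out_def FactGroup_def flip: one_AutF3)

lemma Out_surj:
  assumes "X \<in> carrier (Out F3)"
  obtains T where "nielsen T" "X = out_of T"
proof -
  obtain \<phi> where "\<phi> \<in> auto F3" "X = outer_class F3 \<phi>"
    using assms by (auto simp: Out_def FactGroup_def RCOSETS_def outer_class_def carrier_AutF3)
  then show thesis using that by (metis auto_eq_aut out_of_def)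
qed

lemma aut_tconj:
  assumes "nielsen T" "reduced g"
  shows "nielsen (tconj g T)" "aut (tconj g T) = inn_aut g \<otimes>\<^bsub>AutF3\<^esub> aut T"
proof -
  have T: "treduced T" "aut T \<in> auto F3" using assms treduced_nielsen nielsen_in_auto by auto
  have red: "treduced (tconj g T)" by (simp add: treduced_def tconj_def reduced_reduce)
  have "inn_aut g \<otimes>\<^bsub>AutF3\<^esub> aut T \<in> auto F3"
    using AutF3.m_closed T inn_aut_in_auto assms by (simp add: carrier_AutF3)
  then obtain S where S: "nielsen S" "inn_aut g \<otimes>\<^bsub>AutF3\<^esub> aut T = aut S" by (rule auto_eq_aut)
  have "tfun S a = tfun (tconj g T) a" for a
  proof -
    have "reduced (tfun T a)" using T by (simp add: treduced_iff)
    have "tfun S a = aut S [(a, True)]"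
      using S treduced_nielsen by (simp add: aut_apply sub_letter treduced_iff letter_image_def)
    also have "\<dots> = inn_aut g (aut T [(a, True)])"
      unfolding S(2)[symmetric] using T assms by (simp add: mult_AutF3 inn_aut_in_auto compose_def carrier_free_group)
    also have "\<dots> = reduce (g @ tfun T a @ winv g)"
      using T assms by (simp add: aut_apply sub_letter treduced_iff letter_image_def inn_aut_apply)
    also have "\<dots> = tfun (tconj g T) a" by (cases a) (simp_all add: tconj_def)
    finally show ?thesis .
  qed
  then have "S = tconj g T" by (rule triple_eqI)
  with S show "nielsen (tconj g T)" "aut (tconj g T) = inn_aut g \<otimes>\<^bsub>AutF3\<^esub> aut T" by auto
qed

lemma out_of_tconj:
  assumes "nielsen T" "reduced g"
  shows "out_of (tconj g T) = out_of T"
proof -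
  have "out_of (tconj g T) = Inn F3 #>\<^bsub>AutF3\<^esub> inn_aut g \<otimes>\<^bsub>AutF3\<^esub> aut T"
    by (simp add: out_of_def outer_class_def aut_tconj assms)
  also have "\<dots> = (Inn F3 #>\<^bsub>AutF3\<^esub> inn_aut g) #>\<^bsub>AutF3\<^esub> aut T"
    using assms nielsen_in_auto inn_aut_in_auto
    by (intro AutF3.coset_mult_assoc[symmetric]) (auto simp: carrier_AutF3 Inn_normal.subset[unfolded carrier_AutF3])
  also have "Inn F3 #>\<^bsub>AutF3\<^esub> inn_aut g = Inn F3"
    using assms inn_aut_in_auto Inn_normal.is_subgroup
    by (intro AutF3.coset_join2) (auto simp: carrier_AutF3 Inn_F3 carrier_free_group)
  finally show ?thesis by (simp add: out_of_def outer_class_def)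
qed

section \<open>The action on homology\<close>

definition expo :: "gen3 word \<Rightarrow> int \<times> int \<times> int" where
  "expo w = (exponent_sum gA w, exponent_sum gB w, exponent_sum gC w)"

text \<open>The columns are the abelianized images of the generators, as in
  \<open>ab_matrix\<close>, so composition acts in the same order.\<close>

definition tact :: "triple \<Rightarrow> int \<times> int \<times> int \<Rightarrow> int \<times> int \<times> int" where
  "tact T v = (case v of (a, b, c) \<Rightarrow>
     (a * exponent_sum gA (tfun T gA) + b * exponent_sum gA (tfun T gB) + c * exponent_sum gA (tfun T gC),
      a * exponent_sum gB (tfun T gA) + b * exponent_sum gB (tfun T gB) + c * exponent_sum gB (tfun T gC),
      a * exponent_sum gC (tfun T gA) + b * exponent_sum gC (tfun T gB) + c * exponent_sum gC (tfun T gC)))"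

lemma exponent_sum_Nil [simp]: "exponent_sum a [] = 0" by (simp add: exponent_sum_def)

lemma exponent_sum_Cons: "exponent_sum a (x # w) =
    (if fst x = a then if snd x then 1 else - 1 else 0) + exponent_sum a w"
  by (simp add: exponent_sum_def case_prod_beta)

lemma exponent_sum_winv: "exponent_sum a (winv w) = - exponent_sum a w"
  by (induction w) (auto simp: winv_Cons exponent_sum_append exponent_sum_Cons neg_def)

lemma exponent_sum_sub:
  "exponent_sum i (sub (tfun T) w) = exponent_sum gA w * exponent_sum i (tfun T gA) +
     exponent_sum gB w * exponent_sum i (tfun T gB) + exponent_sum gC w * exponent_sum i (tfun T gC)"
proof (induction w)
  case (Cons x w)
  have "exponent_sum i (sub (tfun T) (x # w)) = exponent_sum i (letter_image (tfun T) x) + exponent_sum i (sub (tfun T) w)"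
    by (simp add: sub_Cons exponent_sum_reduce exponent_sum_append)
  moreover have "exponent_sum i (letter_image (tfun T) x) =
      (if snd x then 1 else - 1) * exponent_sum i (tfun T (fst x))"
    by (simp add: letter_image_def exponent_sum_winv)
  ultimately show ?case
    using Cons by (cases "fst x") (simp_all add: exponent_sum_Cons algebra_simps)
qed simp

lemma tact_tcomp: "tact (tcomp S T) v = tact S (tact T v)"
  by (cases v) (simp only: tact_def tfun_tcomp exponent_sum_sub prod.case, simp add: algebra_simps)

section \<open>Normality of the group generated by the involutions\<close>

definition taua :: triple where "taua = ([lC, lB', lA', lC', lB], [lB'], [lC'])"
definition taub :: triple where "taub = ([lA'], [lA, lC', lB', lA', lC], [lC'])"
definition tauc :: triple where "tauc = ([lA'], [lB'], [lB, lA', lC', lB', lA])"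
definition taud :: triple where "taud = ([lA'], [lB'], [lC'])"
definition taux :: triple where "taux = ([lA'], [lC', lB', lC], [lC'])"
definition tauy :: triple where "tauy = ([lA'], [lB'], [lA', lC', lA])"
definition tauz :: triple where "tauz = ([lB', lA', lB], [lB'], [lC'])"
definition taus :: "triple list" where "taus = [taua, taub, tauc, taud, taux, tauy, tauz]"
definition tau_group :: "(gen3 word \<Rightarrow> gen3 word) set set" where
  "tau_group = generate (Out F3) (out_of ` set taus)"

definition tXi :: triple where "tXi = ([lA], [lA', lB], [lC])"

lemma out_of_taus:
  "tau_a = out_of taua" "tau_b = out_of taub" "tau_c = out_of tauc" "tau_d = out_of taud"
  "tau_x = out_of taux" "tau_y = out_of tauy" "tau_z = out_of tauz"
  by (simp_all add: out_of_def aut_def tfun_def out3_def taua_def taub_def tauc_def taud_def taux_def tauy_def tauz_def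
      tau_a_def tau_b_def tau_c_def tau_d_def tau_x_def tau_y_def tau_z_def)

lemma taus_set: "{tau_a, tau_b, tau_c, tau_d, tau_x, tau_y, tau_z} = out_of ` set taus"
  by (simp add: out_of_taus taus_def)

lemma taus_involutions: "\<forall>T\<in>set taus. tcomp T T = tI \<and> treduced T"
  by code_simp

lemma nielsen_taus: "T \<in> set taus \<Longrightarrow> nielsen T"
  using taus_involutions aut_in_auto nielsen_iff by blast

lemma tau_group_subgroup: "subgroup tau_group (Out F3)"
  unfolding tau_group_def using nielsen_taus out_of_carrier by (intro OutF3.generate_is_subgroup) auto

lemma tau_word: "set Ts \<subseteq> set taus \<Longrightarrow> nielsen (foldr tcomp Ts tI) \<and> out_of (foldr tcomp Ts tI) \<in> tau_group"
proof (induction Ts)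
  case Nil
  then show ?case by (simp add: out_of_tI nielsen.base subgroup.one_closed[OF tau_group_subgroup])
next
  case (Cons T Ts)
  then have "out_of T \<in> tau_group" unfolding tau_group_def by (auto intro: generate.incl)
  with Cons show ?case
    by (auto simp: out_of_tcomp nielsen_taus intro!: nielsen_tcomp subgroup.m_closed[OF tau_group_subgroup])
qed

lemma tau_word_conj:
  assumes "T = tconj g (foldr tcomp Ts tI)" "set Ts \<subseteq> set taus" "reduced g"
  shows "nielsen T" "out_of T \<in> tau_group"
  using tau_word[OF assms(2)] out_of_tconj[OF _ assms(3)] aut_tconj(1)[OF _ assms(3)] assms(1) by auto

text \<open>For each generator \<open>G\<close> and its inverse, an entry \<open>(g, Ts)\<close> for each involution \<open>T\<close>, in the order
  of \<open>taus\<close>: the conjugate of \<open>T\<close> by \<open>G\<close> is the product of \<open>Ts\<close> followed by conjugation by \<open>g\<close>.\<close>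

definition conj_table :: "(triple \<times> triple \<times> (gen3 word \<times> triple list) list) list" where
  "conj_table = [
     (tX, tXi, [([lC, lB', lA', lA', lC', lA, lB, lC, lA'], [taub, tauy, taua, tauy, taub]),
       ([], [taub, taux, taub]),
       ([lA], [tauc]),
       ([lA], [tauy]),
       ([], [taub]),
       ([lA], [tauy, taud, tauy]),
       ([], [tauz])]),
     (tT, tT, [([], [taud, taub, taud]),
       ([], [taud, taua, taud]),
       ([], [taud, tauc, taud]),
       ([], [taud]),
       ([lC'], [taud, taux, taud]),
       ([lB'], [taud, tauz, taud]),
       ([lA'], [taud, tauy, taud])]),
     (tU, tU, [([], [taud, taua, taud]),
       ([], [taud, tauc, taud]),
       ([], [taud, taub, taud]),
       ([], [taud]),
       ([lB'], [taud, tauz, taud]),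
       ([lA'], [taud, tauy, taud]),
       ([lC'], [taud, taux, taud])]),
     (tS, tS, [([lC, lC], [taux, taud, tauz, taua, tauz, taud, taux]),
       ([], [taux, taub, taux]),
       ([lB, lB], [tauz, tauc, tauz]),
       ([], [taud]),
       ([], [taux]),
       ([], [taud, tauy, taud]),
       ([], [tauz])])]"

lemma conj_table_correct:
  "\<forall>(G, G', ws)\<in>set conj_table. tcomp G G' = tI \<and> treduced G' \<and>
     list_all2 (\<lambda>T (g, Ts). reduced g \<and> set Ts \<subseteq> set taus \<and> tcomp (tcomp G T) G' = tconj g (foldr tcomp Ts tI)) taus ws"
  by code_simp

lemma nielsen_gen: "G \<in> {tX, tT, tU, tS} \<Longrightarrow> nielsen G"
proof -
  assume G: "G \<in> {tX, tT, tU, tS}"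
  then have "treduced G" using treduced_gens by auto
  then show ?thesis using nielsen.step[OF nielsen.base G] by (simp add: tcomp_tI)
qed

text \<open>Words without inverses already exhaust the automorphism group, so the inverse
  automorphism is again given by such a word.\<close>

lemma nielsen_inverse:
  assumes "nielsen T"
  obtains S where "nielsen S" "tcomp S T = tI" "tcomp T S = tI" "out_of S = inv\<^bsub>Out F3\<^esub> out_of T"
proof -
  have T: "aut T \<in> carrier AutF3" using assms nielsen_in_auto by (simp add: carrier_AutF3)
  then have "inv\<^bsub>AutF3\<^esub> aut T \<in> auto F3" using AutF3.inv_closed by (simp add: carrier_AutF3)
  then obtain S where S: "nielsen S" "inv\<^bsub>AutF3\<^esub> aut T = aut S" by (rule auto_eq_aut)
  have "aut (tcomp S T) = aut tI" "aut (tcomp T S) = aut tI"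
    using S T assms by (simp_all add: aut_tcomp one_AutF3[symmetric] S(2)[symmetric])
  then have eq: "tcomp S T = tI" "tcomp T S = tI" by (auto intro: aut_inject treduced_gens)
  then have "out_of S = inv\<^bsub>Out F3\<^esub> out_of T"
    using S assms by (intro OutF3.inv_equality[symmetric]) (simp_all add: out_of_carrier out_of_tI flip: out_of_tcomp)
  with S eq show thesis by (intro that)
qed

lemma tau_group_conj_gen:
  assumes G: "G \<in> {tX, tT, tU, tS}" and h: "h \<in> tau_group"
  shows "out_of G \<otimes>\<^bsub>Out F3\<^esub> h \<otimes>\<^bsub>Out F3\<^esub> inv\<^bsub>Out F3\<^esub> out_of G \<in> tau_group"
proof -
  have "G \<in> fst ` set conj_table" using G by (auto simp: conj_table_def)
  then obtain p where p: "p \<in> set conj_table" "G = fst p" by blast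
  obtain G' ws where "snd p = (G', ws)" by fastforce
  with p have tab: "(G, G', ws) \<in> set conj_table" by (metis prod.collapse)
  obtain H where H: "nielsen H" "tcomp H G = tI" "tcomp G H = tI" "out_of H = inv\<^bsub>Out F3\<^esub> out_of G"
    using nielsen_gen[OF G] by (rule nielsen_inverse)
  have "tcomp H (tcomp G G') = G'" "treduced G'" "tcomp G G' = tI"
    using conj_table_correct tab H by (auto simp: tcomp_tI simp flip: tcomp_assoc)
  \<comment> \<open>Inverses are unique, so the table lists the inverse that was obtained
    abstractly.\<close>
  then have "H = G'" using H treduced_nielsen by (simp add: tcomp_tI)
  have tau: "out_of G \<otimes>\<^bsub>Out F3\<^esub> out_of T \<otimes>\<^bsub>Out F3\<^esub> inv\<^bsub>Out F3\<^esub> out_of G \<in> tau_group" if T: "T \<in> set taus" for T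
  proof -
    obtain g Ts where "reduced g" "set Ts \<subseteq> set taus" "tcomp (tcomp G T) G' = tconj g (foldr tcomp Ts tI)"
      using conj_table_correct tab T by (fastforce simp: list_all2_conv_all_nth in_set_conv_nth)
    then have "out_of (tcomp (tcomp G T) H) \<in> tau_group" unfolding \<open>H = G'\<close> by (intro tau_word_conj) auto
    then show ?thesis
      using H nielsen_gen[OF G] nielsen_taus[OF T] by (simp add: out_of_tcomp nielsen_tcomp)
  qed
  define C where "C = (\<lambda>h. out_of G \<otimes>\<^bsub>Out F3\<^esub> h \<otimes>\<^bsub>Out F3\<^esub> inv\<^bsub>Out F3\<^esub> out_of G)"
  have oG: "out_of G \<in> carrier (Out F3)" using nielsen_gen[OF G] by (rule out_of_carrier)
  have carr: "h \<in> carrier (Out F3)" if "h \<in> tau_group" for h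
    using that tau_group_subgroup subgroup.mem_carrier by metis
  have C_mult: "C (h \<otimes>\<^bsub>Out F3\<^esub> k) = C h \<otimes>\<^bsub>Out F3\<^esub> C k"
    if "h \<in> carrier (Out F3)" "k \<in> carrier (Out F3)" for h k
  proof -
    have "inv\<^bsub>Out F3\<^esub> out_of G \<otimes>\<^bsub>Out F3\<^esub> (out_of G \<otimes>\<^bsub>Out F3\<^esub> z) = z" if "z \<in> carrier (Out F3)" for z
      using that oG by (simp flip: OutF3.m_assoc)
    then show ?thesis using that oG by (simp add: C_def OutF3.m_assoc)
  qed
  have C_inv: "C (inv\<^bsub>Out F3\<^esub> h) = inv\<^bsub>Out F3\<^esub> C h" if "h \<in> carrier (Out F3)" for h
    using that oG by (simp add: C_def OutF3.m_assoc OutF3.inv_mult_group)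
  have "C h \<in> tau_group"
    using h unfolding tau_group_def
  proof (induction rule: generate.induct)
    case one
    then show ?case using oG tau_group_subgroup by (simp add: C_def generate.one)
  next
    case (incl h)
    then show ?case using tau by (auto simp: C_def tau_group_def)
  next
    case (inv h)
    then have h: "h \<in> tau_group" "C h \<in> tau_group" using tau by (auto simp: C_def tau_group_def intro: generate.incl)
    then show ?case unfolding C_inv[OF carr[OF h(1)]] using tau_group_subgroup
      by (auto simp: tau_group_def intro: subgroup.m_inv_closed)
  next
    case (eng h k)
    then show ?case using C_mult carr by (auto simp: tau_group_def intro: generate.eng)
  qed
  then show ?thesis by (simp add: C_def)
qed

text \<open>Conjugating by the generators in one direction is enough, since \<open>nielsen\<close>
  reaches every automorphism without inverses.\<close>

lemma tau_group_conj:
  assumes "nielsen R" "h \<in> tau_group"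
  shows "out_of R \<otimes>\<^bsub>Out F3\<^esub> h \<otimes>\<^bsub>Out F3\<^esub> inv\<^bsub>Out F3\<^esub> out_of R \<in> tau_group"
  using assms
proof (induction rule: nielsen.induct)
  case base
  then show ?case using tau_group_subgroup by (auto simp: out_of_tI dest: subgroup.mem_carrier)
next
  case (step R G)
  have "h \<in> carrier (Out F3)" "out_of R \<in> carrier (Out F3)" "out_of G \<in> carrier (Out F3)"
    using step tau_group_subgroup nielsen_gen[OF step.hyps(2)] by (auto dest: subgroup.mem_carrier intro: out_of_carrier)
  then have "out_of (tcomp G R) \<otimes>\<^bsub>Out F3\<^esub> h \<otimes>\<^bsub>Out F3\<^esub> inv\<^bsub>Out F3\<^esub> out_of (tcomp G R) =
      out_of G \<otimes>\<^bsub>Out F3\<^esub> (out_of R \<otimes>\<^bsub>Out F3\<^esub> h \<otimes>\<^bsub>Out F3\<^esub> inv\<^bsub>Out F3\<^esub> out_of R) \<otimes>\<^bsub>Out F3\<^esub> inv\<^bsub>Out F3\<^esub> out_of G"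
    using out_of_tcomp[OF nielsen_gen[OF step.hyps(2)] step.hyps(1)] by (simp add: OutF3.m_assoc OutF3.inv_mult_group)
  then show ?case using tau_group_conj_gen[OF step.hyps(2) step.IH[OF step.prems]] by simp
qed

section \<open>The quotient by the classes of the involutions\<close>

definition tau_kernel :: "(gen3 word \<Rightarrow> gen3 word) set" where
  "tau_kernel = aut ` {T. nielsen T \<and> out_of T \<in> tau_group \<and> (\<forall>v. tact T v = v)}"

lemma tact_tI [simp]: "tact tI v = v"
  by (cases v) (simp add: tact_def tI_def exponent_sum_Cons)

lemma tau_kernel_iff: "nielsen T \<Longrightarrow> aut T \<in> tau_kernel \<longleftrightarrow> out_of T \<in> tau_group \<and> (\<forall>v. tact T v = v)"
proof
  assume T: "nielsen T" and "aut T \<in> tau_kernel"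
  then obtain S where S: "nielsen S" "out_of S \<in> tau_group" "\<forall>v. tact S v = v" "aut T = aut S"
    unfolding tau_kernel_def by blast
  then have "T = S" using T by (intro aut_inject treduced_nielsen)
  with S show "out_of T \<in> tau_group \<and> (\<forall>v. tact T v = v)" by simp
qed (unfold tau_kernel_def, blast)

interpretation tau_kernel: normal tau_kernel AutF3
proof (rule AutF3.normal_invI)
  show "subgroup tau_kernel AutF3"
  proof
    show "tau_kernel \<subseteq> carrier AutF3" by (auto simp: tau_kernel_def carrier_AutF3 nielsen_in_auto)
    show "\<one>\<^bsub>AutF3\<^esub> \<in> tau_kernel"
      unfolding one_AutF3 using subgroup.one_closed[OF tau_group_subgroup]
      by (simp add: tau_kernel_iff nielsen.base out_of_tI)
    show "x \<otimes>\<^bsub>AutF3\<^esub> y \<in> tau_kernel" if xy: "x \<in> tau_kernel" "y \<in> tau_kernel" for x y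
    proof -
      obtain S T where ST: "nielsen S" "nielsen T" "out_of S \<in> tau_group" "out_of T \<in> tau_group"
        "\<And>v. tact S v = v" "\<And>v. tact T v = v" "x = aut S" "y = aut T"
        using xy unfolding tau_kernel_def by blast
      have "aut (tcomp S T) \<in> tau_kernel"
        using ST subgroup.m_closed[OF tau_group_subgroup] by (simp add: tau_kernel_iff nielsen_tcomp out_of_tcomp tact_tcomp)
      then show ?thesis using ST by (simp add: aut_tcomp)
    qed
    show "inv\<^bsub>AutF3\<^esub> x \<in> tau_kernel" if x: "x \<in> tau_kernel" for x
    proof -
      obtain T where T: "nielsen T" "out_of T \<in> tau_group" "\<And>v. tact T v = v" "x = aut T"
        using x unfolding tau_kernel_def by blast
      obtain S where S: "nielsen S" "tcomp S T = tI" "tcomp T S = tI" "out_of S = inv\<^bsub>Out F3\<^esub> out_of T"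
        using T(1) by (rule nielsen_inverse)
      have "tact S v = v" for v using tact_tcomp[of S T v] T S by simp
      then have "aut S \<in> tau_kernel"
        using S T subgroup.m_inv_closed[OF tau_group_subgroup] by (simp add: tau_kernel_iff)
      moreover have "inv\<^bsub>AutF3\<^esub> aut T = aut S"
        using S T by (intro AutF3.inv_equality) (simp_all add: carrier_AutF3 nielsen_in_auto one_AutF3 flip: aut_tcomp)
      ultimately show ?thesis using T by simp
    qed
  qed
next
  fix \<phi> \<psi> assume \<phi>: "\<phi> \<in> carrier AutF3" and \<psi>: "\<psi> \<in> tau_kernel"
  have "\<phi> \<in> auto F3" using \<phi> by (simp add: carrier_AutF3)
  then obtain R where R: "nielsen R" "\<phi> = aut R" by (rule auto_eq_aut)
  obtain T where T: "nielsen T" "out_of T \<in> tau_group" "\<And>v. tact T v = v" "\<psi> = aut T"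
    using \<psi> unfolding tau_kernel_def by blast
  obtain S where S: "nielsen S" "tcomp S R = tI" "tcomp R S = tI" "out_of S = inv\<^bsub>Out F3\<^esub> out_of R"
    using R(1) by (rule nielsen_inverse)
  have inv: "inv\<^bsub>AutF3\<^esub> aut R = aut S"
    using S R by (intro AutF3.inv_equality) (simp_all add: carrier_AutF3 nielsen_in_auto one_AutF3 flip: aut_tcomp)
  have "tact R (tact S v) = v" for v using S by (simp flip: tact_tcomp)
  then have "aut (tcomp (tcomp R T) S) \<in> tau_kernel"
    using R S T tau_group_conj[OF R(1) T(2)] by (simp add: tau_kernel_iff nielsen_tcomp tact_tcomp out_of_tcomp)
  then show "\<phi> \<otimes>\<^bsub>AutF3\<^esub> \<psi> \<otimes>\<^bsub>AutF3\<^esub> inv\<^bsub>AutF3\<^esub> \<phi> \<in> tau_kernel"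
    using R S T inv by (simp add: aut_tcomp nielsen_tcomp)
qed

section \<open>The quotient as a type of class \<open>group_add\<close>, with its action on
  Z^3\<close>

typedef aut_quotient = "carrier (AutF3 Mod tau_kernel)"
  using group.is_monoid[OF tau_kernel.factorgroup_is_group] monoid.one_closed by blast

interpretation aut_quotient: group "AutF3 Mod tau_kernel"
  by (rule tau_kernel.factorgroup_is_group)

instantiation aut_quotient :: group_add
begin
definition "0 = Abs_aut_quotient \<one>\<^bsub>AutF3 Mod tau_kernel\<^esub>"
definition "p + q = Abs_aut_quotient (Rep_aut_quotient p \<otimes>\<^bsub>AutF3 Mod tau_kernel\<^esub> Rep_aut_quotient q)"
definition "- p = Abs_aut_quotient (inv\<^bsub>AutF3 Mod tau_kernel\<^esub> Rep_aut_quotient p)"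
definition "p - q = p + - (q :: aut_quotient)"
instance
proof
  note Rep = Rep_aut_quotient
  fix p q r :: aut_quotient
  show "p + q + r = p + (q + r)"
    using Rep by (simp add: plus_aut_quotient_def Abs_aut_quotient_inverse aut_quotient.m_assoc del: mult_FactGroup)
  show "0 + p = p" "p + 0 = p" "- p + p = 0" "p + - q = p - q"
    using Rep by (simp_all add: plus_aut_quotient_def zero_aut_quotient_def uminus_aut_quotient_def
        minus_aut_quotient_def Abs_aut_quotient_inverse Rep_aut_quotient_inverse del: mult_FactGroup one_FactGroup)
qed
end

definition quot :: "triple \<Rightarrow> aut_quotient" where
  "quot T = Abs_aut_quotient (tau_kernel #>\<^bsub>AutF3\<^esub> aut T)"

lemma coset_in_quotient: "nielsen T \<Longrightarrow> tau_kernel #>\<^bsub>AutF3\<^esub> aut T \<in> carrier (AutF3 Mod tau_kernel)"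
  using hom_in_carrier[OF tau_kernel.r_coset_hom_Mod, of "aut T"] nielsen_in_auto[of T] by (simp add: carrier_AutF3)

lemma quot_tcomp: "nielsen S \<Longrightarrow> nielsen T \<Longrightarrow> quot (tcomp S T) = quot S + quot T"
  using hom_mult[OF tau_kernel.r_coset_hom_Mod, of "aut S" "aut T"] nielsen_in_auto[of S] nielsen_in_auto[of T]
  by (simp add: quot_def plus_aut_quotient_def Abs_aut_quotient_inverse coset_in_quotient carrier_AutF3 aut_tcomp
      del: mult_FactGroup)

lemma quot_tI: "quot tI = 0"
  using quot_tcomp[OF nielsen.base nielsen.base] add_left_cancel[of "quot tI" "quot tI" 0]
  by (simp add: tcomp_tI treduced_gens)

lemma quot_eq_0_iff: "nielsen T \<Longrightarrow> quot T = 0 \<longleftrightarrow> out_of T \<in> tau_group \<and> (\<forall>v. tact T v = v)"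
proof -
  assume T: "nielsen T"
  have "quot T = 0 \<longleftrightarrow> tau_kernel #>\<^bsub>AutF3\<^esub> aut T = tau_kernel"
    using T coset_in_quotient[OF T] aut_quotient.one_closed
    by (simp add: quot_def zero_aut_quotient_def Abs_aut_quotient_inject del: one_FactGroup) simp
  also have "\<dots> \<longleftrightarrow> aut T \<in> tau_kernel"
    using AutF3.coset_join1[OF _ _ tau_kernel.is_subgroup, of "aut T"]
      AutF3.coset_join2[OF _ tau_kernel.is_subgroup, of "aut T"] nielsen_in_auto[OF T]
    by (auto simp: carrier_AutF3)
  finally show ?thesis using tau_kernel_iff[OF T] by simp
qed

lemma quot_surj:
  obtains T where "nielsen T" "q = quot T"
proof -
  have "Rep_aut_quotient q \<in> carrier (AutF3 Mod tau_kernel)" by (rule Rep_aut_quotient)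
  then obtain \<phi> where \<phi>: "\<phi> \<in> auto F3" "Rep_aut_quotient q = tau_kernel #>\<^bsub>AutF3\<^esub> \<phi>"
    by (auto simp: FactGroup_def RCOSETS_def carrier_AutF3)
  then obtain T where T: "nielsen T" "\<phi> = aut T" by (metis auto_eq_aut)
  have "q = quot T"
    unfolding quot_def T(2)[symmetric] \<phi>(2)[symmetric] by (simp add: Rep_aut_quotient_inverse)
  with T(1) show thesis by (rule that)
qed

definition qact :: "aut_quotient \<Rightarrow> int \<times> int \<times> int \<Rightarrow> int \<times> int \<times> int" where
  "qact q = tact (SOME T. nielsen T \<and> quot T = q)"

text \<open>The choice in \<open>qact\<close> is harmless: two representatives differ by an element
  of \<open>tau_kernel\<close>, which acts trivially by definition.\<close>

lemma qact_quot: "nielsen T \<Longrightarrow> qact (quot T) = tact T"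
proof -
  assume T: "nielsen T"
  define S where "S = (SOME S. nielsen S \<and> quot S = quot T)"
  have S: "nielsen S" "quot S = quot T"
    using someI[of "\<lambda>S. nielsen S \<and> quot S = quot T", OF conjI[OF T refl]] by (simp_all add: S_def)
  obtain R where R: "nielsen R" "tcomp R T = tI" "tcomp T R = tI" using T by (rule nielsen_inverse)
  have "quot (tcomp S R) = 0" using S R T quot_tcomp[OF T R(1)] by (simp add: quot_tcomp quot_tI)
  then have id: "tact (tcomp S R) v = v" for v
    using quot_eq_0_iff[OF nielsen_tcomp[OF S(1) R(1)]] by blast
  have "tact S v = tact T v" for v
    using id[of "tact T v"] tact_tcomp[of R T v] R by (simp add: tact_tcomp)
  then show ?thesis by (auto simp: qact_def S_def)
qed

section \<open>The relations in the quotient\<close>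

definition homology_trivial :: "triple \<Rightarrow> bool" where
  "homology_trivial T \<longleftrightarrow> expo (fst T) = (1, 0, 0) \<and> expo (fst (snd T)) = (0, 1, 0) \<and> expo (snd (snd T)) = (0, 0, 1)"

lemma tact_if_homology_trivial: "homology_trivial T \<Longrightarrow> tact T v = v"
  by (cases v) (simp add: homology_trivial_def expo_def tact_def)

lemma quot_foldr: "set Gs \<subseteq> {tX, tT, tU, tS} \<Longrightarrow> quot (foldr tcomp Gs tI) = foldr (\<lambda>G q. quot G + q) Gs 0"
proof (induction Gs)
  case (Cons G Gs)
  then have "nielsen G" "nielsen (foldr tcomp Gs tI)" using nielsen_gen nielsen_foldr by auto
  then show ?case using Cons by (simp add: quot_tcomp)
qed (simp add: quot_tI)

text \<open>A relation may fail in Aut(F3) by an inner automorphism times a word in the involutions,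
  provided that this factor acts trivially; \<open>homology_trivial\<close> tests that by
  evaluation. The words supplied have even length, so their signs cancel.\<close>

lemma quot_relation:
  assumes "set Gs \<subseteq> {tX, tT, tU, tS}" "set Hs \<subseteq> {tX, tT, tU, tS}"
    and "foldr tcomp Gs tI = tcomp (tconj g (foldr tcomp Ts tI)) (foldr tcomp Hs tI)"
    and "reduced g \<and> set Ts \<subseteq> set taus \<and> homology_trivial (tconj g (foldr tcomp Ts tI))"
  shows "foldr (\<lambda>G q. quot G + q) Gs 0 = foldr (\<lambda>G q. quot G + q) Hs 0"
proof -
  let ?m = "tconj g (foldr tcomp Ts tI)"
  have m: "nielsen ?m" "out_of ?m \<in> tau_group" "\<And>v. tact ?m v = v"
    using tau_word_conj[of ?m g Ts] assms(4) tact_if_homology_trivial by auto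
  then have "quot ?m = 0" by (simp add: quot_eq_0_iff)
  then have "quot (foldr tcomp Gs tI) = quot (foldr tcomp Hs tI)"
    unfolding assms(3) using m nielsen_foldr[OF assms(2)] by (simp add: quot_tcomp)
  then show ?thesis unfolding quot_foldr[OF assms(1)] quot_foldr[OF assms(2)] .
qed

interpretation gl3: gl3_relations "quot tX" "quot tT" "quot tU" "quot tS" qact
proof
  let ?x = "quot tX" and ?t = "quot tT" and ?u = "quot tU" and ?s = "quot tS"
  note n = nielsen_gen
  \<comment> \<open>Nine relations are identities of automorphisms; \<open>s2x\<close>,
    \<open>x12_x32\<close>, \<open>x12_x23\<close> and \<open>xt\<close> hold only modulo
    \<open>tau_kernel\<close>.\<close>
  have exact: "foldr (\<lambda>G q. quot G + q) Gs 0 = foldr (\<lambda>G q. quot G + q) Hs 0"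
    if "set Gs \<subseteq> {tX, tT, tU, tS} \<and> set Hs \<subseteq> {tX, tT, tU, tS}" "foldr tcomp Gs tI = foldr tcomp Hs tI" for Gs Hs
    using that quot_foldr[of Gs] quot_foldr[of Hs] by simp
  show "P g" if "P 0" "\<And>g. P g \<Longrightarrow> P (?x + g)" "\<And>g. P g \<Longrightarrow> P (?t + g)" "\<And>g. P g \<Longrightarrow> P (?u + g)"
    "\<And>g. P g \<Longrightarrow> P (?s + g)" for P g
  proof -
    obtain T where "nielsen T" "g = quot T" by (rule quot_surj)
    moreover from \<open>nielsen T\<close> have "P (quot T)"
    proof (induction rule: nielsen.induct)
      case base
      then show ?case using that(1) by (simp add: quot_tI)
    next
      case (step T G)
      then show ?case using that(2-) n[OF step.hyps(2)] by (auto simp: quot_tcomp)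
    qed
    ultimately show ?thesis by simp
  qed
  show "qact (g + h) v = qact g (qact h v)" for g h v
  proof -
    obtain S T where "nielsen S" "g = quot S" "nielsen T" "h = quot T" by (meson quot_surj)
    then show ?thesis by (simp add: qact_quot nielsen_tcomp tact_tcomp flip: quot_tcomp)
  qed
  show "qact 0 v = v" for v using qact_quot[OF nielsen.base] by (simp add: quot_tI)
  show "qact ?x (a, b, c) = (a + b, b, c)" "qact ?t (a, b, c) = (b, a, c)" "qact ?u (a, b, c) = (a, c, b)"
    "qact ?s (a, b, c) = (- a, b, c)" for a b c
    by (simp_all add: qact_quot n) (simp_all add: tact_def tX_def tT_def tU_def tS_def exponent_sum_Cons)
  have "foldr tcomp [tT, tT] tI = foldr tcomp [] tI" by code_simp
  then have tt: "foldr (\<lambda>G q. quot G + q) [tT, tT] 0 = foldr (\<lambda>G q. quot G + q) [] 0"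
    by (intro exact) simp_all
  have "foldr tcomp [tU, tU] tI = foldr tcomp [] tI" by code_simp
  then have uu: "foldr (\<lambda>G q. quot G + q) [tU, tU] 0 = foldr (\<lambda>G q. quot G + q) [] 0"
    by (intro exact) simp_all
  have "foldr tcomp [tS, tS] tI = foldr tcomp [] tI" by code_simp
  then have ss: "foldr (\<lambda>G q. quot G + q) [tS, tS] 0 = foldr (\<lambda>G q. quot G + q) [] 0"
    by (intro exact) simp_all
  have "foldr tcomp [tT, tU, tT] tI = foldr tcomp [tU, tT, tU] tI" by code_simp
  then have tut: "foldr (\<lambda>G q. quot G + q) [tT, tU, tT] 0 = foldr (\<lambda>G q. quot G + q) [tU, tT, tU] 0"
    by (intro exact) simp_all
  have "foldr tcomp [tU, tS] tI = foldr tcomp [tS, tU] tI" by code_simp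
  then have us: "foldr (\<lambda>G q. quot G + q) [tU, tS] 0 = foldr (\<lambda>G q. quot G + q) [tS, tU] 0"
    by (intro exact) simp_all
  have "foldr tcomp [tS, tT, tS, tT] tI = foldr tcomp [tT, tS, tT, tS] tI" by code_simp
  then have stst: "foldr (\<lambda>G q. quot G + q) [tS, tT, tS, tT] 0 = foldr (\<lambda>G q. quot G + q) [tT, tS, tT, tS] 0"
    by (intro exact) simp_all
  have "foldr tcomp [tS, tX, tS, tX] tI = foldr tcomp [] tI" by code_simp
  then have s1x: "foldr (\<lambda>G q. quot G + q) [tS, tX, tS, tX] 0 = foldr (\<lambda>G q. quot G + q) [] 0"
    by (intro exact) simp_all
  \<comment> \<open>The left side fixes A and C and sends B to A B A^-1.\<close>
  have "foldr tcomp [tT, tS, tT, tX, tT, tS, tT, tX] tI = tcomp (tconj [lA] (foldr tcomp [tauy, taud] tI)) (foldr tcomp [] tI)"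
    and "reduced [lA] \<and> set [tauy, taud] \<subseteq> set taus \<and> homology_trivial (tconj [lA] (foldr tcomp [tauy, taud] tI))"
    by code_simp+
  then have s2x: "foldr (\<lambda>G q. quot G + q) [tT, tS, tT, tX, tT, tS, tT, tX] 0 = foldr (\<lambda>G q. quot G + q) [] 0"
    by (rule quot_relation[rotated 2]) simp_all
  have "foldr tcomp [tU, tT, tS, tT, tU, tX] tI = foldr tcomp [tX, tU, tT, tS, tT, tU] tI" by code_simp
  then have s3x: "foldr (\<lambda>G q. quot G + q) [tU, tT, tS, tT, tU, tX] 0 = foldr (\<lambda>G q. quot G + q) [tX, tU, tT, tS, tT, tU] 0"
    by (intro exact) simp_all
  have "foldr tcomp [tX, tU, tX, tU] tI = foldr tcomp [tU, tX, tU, tX] tI" by code_simp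
  then have x12_x13: "foldr (\<lambda>G q. quot G + q) [tX, tU, tX, tU] 0 = foldr (\<lambda>G q. quot G + q) [tU, tX, tU, tX] 0"
    by (intro exact) simp_all
  \<comment> \<open>The two orders send B to CAB and ACB, so the factor sends B to C^-1 A^-1 C A
    B.\<close>
  have "foldr tcomp [tX, tU, tT, tU, tX, tU, tT, tU] tI = tcomp (tconj [lA] (foldr tcomp [tauy, taub, taux, taud] tI)) (foldr tcomp [tU, tT, tU, tX, tU, tT, tU, tX] tI)"
    and "reduced [lA] \<and> set [tauy, taub, taux, taud] \<subseteq> set taus \<and> homology_trivial (tconj [lA] (foldr tcomp [tauy, taub, taux, taud] tI))"
    by code_simp+
  then have x12_x32: "foldr (\<lambda>G q. quot G + q) [tX, tU, tT, tU, tX, tU, tT, tU] 0 = foldr (\<lambda>G q. quot G + q) [tU, tT, tU, tX, tU, tT, tU, tX] 0"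
    by (rule quot_relation[rotated 2]) simp_all
  \<comment> \<open>Both sides send B to AB, but C goes to ABC on the left and to BAC on the right;
    the factor sends C to A^-1 B^-1 A B C.\<close>
  have "foldr tcomp [tX, tT, tU, tX, tU, tT] tI = tcomp (tconj [lB] (foldr tcomp [tauz, tauc, tauy, taud] tI)) (foldr tcomp [tU, tX, tU, tT, tU, tX, tU, tT, tX] tI)"
    and "reduced [lB] \<and> set [tauz, tauc, tauy, taud] \<subseteq> set taus \<and> homology_trivial (tconj [lB] (foldr tcomp [tauz, tauc, tauy, taud] tI))"
    by code_simp+
  then have x12_x23: "foldr (\<lambda>G q. quot G + q) [tX, tT, tU, tX, tU, tT] 0 = foldr (\<lambda>G q. quot G + q) [tU, tX, tU, tT, tU, tX, tU, tT, tX] 0"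
    by (rule quot_relation[rotated 2]) simp_all
  \<comment> \<open>The products are (AB, A, C) and (BA, B A B^-1, C); the factor sends A to B^-1 A
    B.\<close>
  have "foldr tcomp [tX, tT] tI = tcomp (tconj [] (foldr tcomp [tauz, taud] tI)) (foldr tcomp [tT, tX, tT, tT, tS, tT, tX] tI)"
    and "reduced ([] :: gen3 word) \<and> set [tauz, taud] \<subseteq> set taus \<and> homology_trivial (tconj [] (foldr tcomp [tauz, taud] tI))"
    by code_simp+
  then have xt: "foldr (\<lambda>G q. quot G + q) [tX, tT] 0 = foldr (\<lambda>G q. quot G + q) [tT, tX, tT, tT, tS, tT, tX] 0"
    by (rule quot_relation[rotated 2]) simp_all
  show "?t + ?t = 0" "?u + ?u = 0" "?s + ?s = 0" using tt uu ss by simp_all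
  show "?t + ?u + ?t = ?u + ?t + ?u" "?u + ?s = ?s + ?u"
    "?s + (?t + ?s + ?t) = (?t + ?s + ?t) + ?s"
    using tut us stst by (simp_all add: add.assoc)
  show "?s + ?x + ?s = - ?x" "(?t + ?s + ?t) + ?x + (?t + ?s + ?t) = - ?x"
    using s1x s2x by (simp_all add: add.assoc eq_neg_iff_add_eq_0)
  show "(?u + (?t + ?s + ?t) + ?u) + ?x = ?x + (?u + (?t + ?s + ?t) + ?u)"
    "?x + (?u + ?x + ?u) = (?u + ?x + ?u) + ?x"
    "?x + (?u + (?t + (?u + ?x + ?u) + ?t) + ?u) = (?u + (?t + (?u + ?x + ?u) + ?t) + ?u) + ?x"
    "?x + (?t + (?u + ?x + ?u) + ?t) = (?u + ?x + ?u) + (?t + (?u + ?x + ?u) + ?t) + ?x"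
    using s3x x12_x13 x12_x32 x12_x23 by (simp_all add: add.assoc)
  show "?x + ?t - ?x = ?t + ?x + ?t + (?t + ?s + ?t)"
    unfolding diff_eq_eq using xt unfolding add.assoc by simp
qed

text \<open>Faithfulness makes the class of \<open>T\<close> in the quotient vanish, which by
  construction puts the outer class of \<open>T\<close> into \<open>tau_group\<close>.\<close>

lemma out_of_in_tau_group:
  assumes "nielsen T" "\<And>v. tact T v = v"
  shows "out_of T \<in> tau_group"
proof -
  have "quot T = 0" by (rule gl3.eq_0_if_act_trivial) (simp add: qact_quot assms)
  then show ?thesis using quot_eq_0_iff assms by blast
qed

section \<open>Matrices, orders of the involutions, and the two inclusions\<close>

lemma ab_matrix_aut:
  assumes "nielsen T"
  shows "ab_matrix (aut T) = mat 1 \<longleftrightarrow> (\<forall>v. tact T v = v)"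
    and "ab_matrix (aut T) = - mat 1 \<longleftrightarrow> (\<forall>a b c. tact T (a, b, c) = (- a, - b, - c))"
proof -
  have col: "aut T [(a, True)] = tfun T a" for a
    using treduced_nielsen[OF assms] by (simp add: aut_apply sub_letter treduced_iff letter_image_def)
  have all: "(\<forall>a. P a) \<longleftrightarrow> P gA \<and> P gB \<and> P gC" for P by (metis gen3.exhaust)
  have ex: "tact T (1, 0, 0) = expo (tfun T gA)" "tact T (0, 1, 0) = expo (tfun T gB)" "tact T (0, 0, 1) = expo (tfun T gC)"
    by (simp_all add: tact_def expo_def)
  have lin: "tact T (a, b, c) =
      (a * fst (expo (tfun T gA)) + b * fst (expo (tfun T gB)) + c * fst (expo (tfun T gC)),
       a * fst (snd (expo (tfun T gA))) + b * fst (snd (expo (tfun T gB))) + c * fst (snd (expo (tfun T gC))),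
       a * snd (snd (expo (tfun T gA))) + b * snd (snd (expo (tfun T gB))) + c * snd (snd (expo (tfun T gC))))" for a b c
    by (simp add: tact_def expo_def)
  have "ab_matrix (aut T) = mat 1 \<longleftrightarrow> expo (tfun T gA) = (1, 0, 0) \<and> expo (tfun T gB) = (0, 1, 0) \<and> expo (tfun T gC) = (0, 0, 1)"
    by (auto simp: ab_matrix_def vec_eq_iff mat_def col all expo_def)
  also have "\<dots> \<longleftrightarrow> (\<forall>v. tact T v = v)" (is "?l \<longleftrightarrow> ?r")
  proof
    show ?r if ?l using that by (auto simp: lin)
    show ?l if ?r unfolding ex[symmetric] using that by simp
  qed
  finally show "ab_matrix (aut T) = mat 1 \<longleftrightarrow> (\<forall>v. tact T v = v)" .
  have "ab_matrix (aut T) = - mat 1 \<longleftrightarrow> expo (tfun T gA) = (- 1, 0, 0) \<and> expo (tfun T gB) = (0, - 1, 0) \<and> expo (tfun T gC) = (0, 0, - 1)"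
    by (auto simp: ab_matrix_def vec_eq_iff mat_def col all expo_def)
  also have "\<dots> \<longleftrightarrow> (\<forall>a b c. tact T (a, b, c) = (- a, - b, - c))" (is "?l \<longleftrightarrow> ?r")
  proof
    show ?r if ?l using that by (auto simp: lin)
    show ?l if ?r unfolding ex[symmetric] using that by simp
  qed
  finally show "ab_matrix (aut T) = - mat 1 \<longleftrightarrow> (\<forall>a b c. tact T (a, b, c) = (- a, - b, - c))" .
qed

lemma out_of_extended_Torelli_iff:
  assumes "nielsen T"
  shows "out_of T \<in> extended_Torelli \<longleftrightarrow>
    (\<forall>v. tact T v = v) \<or> (\<forall>a b c. tact T (a, b, c) = (- a, - b, - c))"
  using ab_matrix_aut[OF assms] out_of_carrier[OF assms] Out_ab_outer_class[OF nielsen_in_auto[OF assms]]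
  by (simp add: extended_Torelli_def out_of_def)

lemma tact_taus: "T \<in> set taus \<Longrightarrow> tact T (a, b, c) = (- a, - b, - c)"
  by (auto simp: taus_def taua_def taub_def tauc_def taud_def taux_def tauy_def tauz_def tact_def exponent_sum_Cons)

lemma out_of_tau_involution:
  assumes "T \<in> set taus"
  shows "out_of T \<otimes>\<^bsub>Out F3\<^esub> out_of T = \<one>\<^bsub>Out F3\<^esub>" "out_of T \<noteq> \<one>\<^bsub>Out F3\<^esub>" "inv\<^bsub>Out F3\<^esub> out_of T = out_of T"
proof -
  have T: "nielsen T" "tcomp T T = tI" using assms nielsen_taus taus_involutions by auto
  then show sq: "out_of T \<otimes>\<^bsub>Out F3\<^esub> out_of T = \<one>\<^bsub>Out F3\<^esub>" by (simp add: out_of_tI flip: out_of_tcomp)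
  then show "inv\<^bsub>Out F3\<^esub> out_of T = out_of T" using T out_of_carrier by (intro OutF3.inv_equality) auto
  \<comment> \<open>Nontriviality is seen on homology, where the involution acts as -1.\<close>
  have "Out_ab (out_of T) = - mat 1"
    using ab_matrix_aut(2)[OF T(1)] tact_taus[OF assms] Out_ab_outer_class[OF nielsen_in_auto[OF T(1)]]
    by (simp add: out_of_def)
  moreover have "Out_ab \<one>\<^bsub>Out F3\<^esub> = mat 1"
    using ab_matrix_aut(1)[OF nielsen.base] Out_ab_outer_class[OF nielsen_in_auto[OF nielsen.base]]
    by (simp add: out_of_def flip: out_of_tI)
  moreover have "- mat 1 \<noteq> (mat 1 :: int ^ gen3 ^ gen3)"
    by (auto simp: vec_eq_iff mat_def)
  ultimately show "out_of T \<noteq> \<one>\<^bsub>Out F3\<^esub>" by metis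
qed

lemma extended_Torelli_subset_tau_group: "extended_Torelli \<subseteq> tau_group"
proof
  fix X :: "(gen3 word \<Rightarrow> gen3 word) set"
  assume X: "X \<in> extended_Torelli"
  then have "X \<in> carrier (Out F3)" by (simp add: extended_Torelli_def)
  then obtain T where T: "nielsen T" "X = out_of T" by (rule Out_surj)
  have d: "taud \<in> set taus" by (simp add: taus_def)
  note nd = nielsen_taus[OF d]
  from X consider "\<forall>v. tact T v = v" | "\<forall>a b c. tact T (a, b, c) = (- a, - b, - c)"
    unfolding T(2) out_of_extended_Torelli_iff[OF T(1)] by blast
  then show "X \<in> tau_group"
  proof cases
    case 1
    then show ?thesis using out_of_in_tau_group T by blast
  next
    case 2
    have "tact (tcomp T taud) v = v" for v
      by (cases v) (simp add: tact_tcomp tact_taus[OF d] 2)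
    then have "out_of (tcomp T taud) \<in> tau_group"
      using T nd by (intro out_of_in_tau_group nielsen_tcomp)
    moreover have "out_of taud \<in> tau_group" using d unfolding tau_group_def by (auto intro: generate.incl)
    ultimately have "out_of (tcomp T taud) \<otimes>\<^bsub>Out F3\<^esub> out_of taud \<in> tau_group"
      by (rule subgroup.m_closed[OF tau_group_subgroup])
    moreover have "out_of (tcomp T taud) \<otimes>\<^bsub>Out F3\<^esub> out_of taud = out_of T"
      using T(1) nd out_of_carrier out_of_tau_involution(1)[OF d] by (simp add: out_of_tcomp OutF3.m_assoc)
    ultimately show ?thesis using T by simp
  qed
qed

lemma tau_group_subset_extended_Torelli: "tau_group \<subseteq> extended_Torelli"
proof
  fix X assume "X \<in> tau_group"
  then have "\<exists>T. nielsen T \<and> X = out_of T \<and>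
      ((\<forall>v. tact T v = v) \<or> (\<forall>a b c. tact T (a, b, c) = (- a, - b, - c)))"
    unfolding tau_group_def
  proof (induction rule: generate.induct)
    case one
    then show ?case by (intro exI[of _ tI]) (simp add: out_of_tI nielsen.base)
  next
    case (incl h)
    then show ?case using nielsen_taus tact_taus by blast
  next
    case (inv h)
    then show ?case using nielsen_taus tact_taus out_of_tau_involution(3) by (metis (no_types, lifting) imageE)
  next
    case (eng h k)
    then obtain S T where "nielsen S" "h = out_of S" "nielsen T" "k = out_of T"
      and st: "(\<forall>v. tact S v = v) \<or> (\<forall>a b c. tact S (a, b, c) = (- a, - b, - c))"
        "(\<forall>v. tact T v = v) \<or> (\<forall>a b c. tact T (a, b, c) = (- a, - b, - c))" by blast
    then show ?case by (intro exI[of _ "tcomp S T"]) (auto simp: out_of_tcomp nielsen_tcomp tact_tcomp)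
  qed
  then show "X \<in> extended_Torelli" using out_of_extended_Torelli_iff by blast
qed

lemma ord_involution:
  assumes "T \<in> set taus"
  shows "group.ord (Out F3) (out_of T) = 2"
proof -
  have c: "out_of T \<in> carrier (Out F3)" using assms nielsen_taus out_of_carrier by blast
  have "out_of T [^]\<^bsub>Out F3\<^esub> (2 :: nat) = \<one>\<^bsub>Out F3\<^esub>"
    using c out_of_tau_involution[OF assms] by (simp add: numeral_2_eq_2)
  then have "OutF3.ord (out_of T) dvd 2" using c by (simp add: OutF3.pow_eq_id)
  then have "OutF3.ord (out_of T) \<le> 2" "OutF3.ord (out_of T) \<noteq> 0"
    by (simp add: dvd_imp_le, metis dvd_0_left zero_neq_numeral)
  then have "OutF3.ord (out_of T) = 1 \<or> OutF3.ord (out_of T) = 2" by linarith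
  then show ?thesis using OutF3.ord_eq_1[OF c] out_of_tau_involution[OF assms] by auto
qed

theorem propositionB1:
  shows "(\<forall>t \<in> {tau_a, tau_b, tau_c, tau_d, tau_x, tau_y, tau_z}.
            t \<in> carrier (Out F3) \<and> group.ord (Out F3) t = 2) \<and>
         generate (Out F3) {tau_a, tau_b, tau_c, tau_d, tau_x, tau_y, tau_z}
           = (extended_Torelli :: (gen3 word \<Rightarrow> gen3 word) set set)"
  unfolding taus_set using ord_involution out_of_carrier nielsen_taus
    extended_Torelli_subset_tau_group tau_group_subset_extended_Torelli
  by (auto simp: tau_group_def)

end
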